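(* Let $d$ and $n$ be positive integers with $n \geq d+1$, let $\tau_1 < \cdots < \tau_n$ be integers, let $\mathcal{P} = C_d(\tau_1,\ldots,\tau_n) \subset \mathbb{R}^d$ be the corresponding integral cyclic polytope, and let $K$ be a field. Then the semigroup $K$-algebra $K[\mathcal{P}]$ satisfies Serre's condition $(R_1)$.
   Context: For real numbers $\tau_1 < \cdots < \tau_n$ with $n \geq d+1$, the cyclic polytope $C_d(\tau_1,\ldots,\tau_n) \subset \mathbb{R}^d$ is the convex hull of the points $(\tau_i,\tau_i^2,\ldots,\tau_i^d)$, $i=1,\ldots,n$. It is called integral when all $\tau_i$ are integers. For an integral polytope $\mathcal{P} \subset \mathbb{R}^d$ put $\mathcal{A}_{\mathcal{P}} = \{(1,\alpha) \in \mathbb{R}^{d+1} : \alpha \in \mathcal{P}\} \cap \mathbb{Z}^{d+1}$, and let $\mathbb{Z}_{\geq 0}\mathcal{A}_{\mathcal{P}}$ be the additive submonoid of $\mathbb{Z}^{d+1}$ generated by $\mathcal{A}_{\mathcal{P}}$. Then $K[\mathcal{P}]$ denotes the semigroup algebra $K[\mathbb{Z}_{\geq 0}\mathcal{A}_{\mathcal{P}}]$, i.e. the $K$-algebra with $K$-basis the monomials $t^{\mathbf{a}} = t_0^{a_0}t_1^{a_1}\cdots t_d^{a_d}$, $\mathbf{a} \in \mathbb{Z}_{\geq 0}\mathcal{A}_{\mathcal{P}}$, and multiplication $t^{\mathbf{a}}t^{\mathbf{b}} = t^{\mathbf{a}+\mathbf{b}}$. A Noetherian ring $R$ satisfies Serre's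 condition $(R_1)$ if $R_{\mathfrak{p}}$ is a regular local ring for all $\mathfrak{p} \in \operatorname{Spec}(R)$ with $\dim R_{\mathfrak{p}} \leq 1$. *)

theory Defs
  imports "HOL-Analysis.Analysis" "HOL-Analysis.Finite_Function_Topology"
    "HOL-Algebra.Ring_Divisibility"
begin

section \<open>Cyclic polytopes\<close>

text \<open>
  Points of \<open>\<real>^d\<close> are represented by finitely supported functions \<open>nat \<Rightarrow>\<^sub>0 real\<close> whose support
  lies in \<open>{1..d}\<close>, and points of \<open>\<real>^(d+1)\<close> and \<open>\<int>^(d+1)\<close> by finitely supported functions whose
  support lies in \<open>{0..d}\<close>. Index \<open>0\<close> is the homogenizing coordinate.
\<close>

definition moment_point :: "nat \<Rightarrow> real \<Rightarrow> (nat \<Rightarrow>\<^sub>0 real)" where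
  "moment_point d t = (\<Sum>i=1..d. Poly_Mapping.single i (t ^ i))"

definition cyclic_polytope :: "nat \<Rightarrow> nat \<Rightarrow> (nat \<Rightarrow> real) \<Rightarrow> (nat \<Rightarrow>\<^sub>0 real) set" where
  "cyclic_polytope d n \<tau> = convex hull ((\<lambda>i. moment_point d (\<tau> i)) ` {1..n})"


section \<open>The semigroup ring of a lattice polytope\<close>

text \<open>
  For a point \<open>\<alpha>\<close> whose \<open>0\<close>-th coordinate vanishes, \<open>Poly_Mapping.single 0 1 + \<alpha>\<close> is \<open>(1, \<alpha>)\<close>.
\<close>

definition lattice_points :: "(nat \<Rightarrow>\<^sub>0 real) set \<Rightarrow> (nat \<Rightarrow>\<^sub>0 int) set" where
  "lattice_points P =
     {a. Poly_Mapping.map real_of_int a \<in> (\<lambda>\<alpha>. Poly_Mapping.single 0 1 + \<alpha>) ` P}"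

inductive_set generated_submonoid :: "'a::comm_monoid_add set \<Rightarrow> 'a set"
  for A :: "'a set" where
  zero: "0 \<in> generated_submonoid A"
| add_generator: "a \<in> A \<Longrightarrow> b \<in> generated_submonoid A \<Longrightarrow> a + b \<in> generated_submonoid A"

text \<open>
  The type \<open>'m \<Rightarrow>\<^sub>0 'k\<close> with its convolution product is the semigroup algebra of all of \<open>'m\<close>;
  \<open>Poly_Mapping.single a 1\<close> is the monomial \<open>t^a\<close>. The semigroup algebra of a submonoid \<open>M\<close> is the
  subring of the elements whose monomials have exponents in \<open>M\<close>.
\<close>

definition semigroup_algebra :: "'m::comm_monoid_add set \<Rightarrow> ('m \<Rightarrow>\<^sub>0 'k::field) ring" where
  "semigroup_algebra M =
     \<lparr>carrier = {f. Poly_Mapping.keys f \<subseteq> M}, mult = (*), one = 1, zero = 0, add = (+)\<rparr>"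

definition polytope_algebra :: "(nat \<Rightarrow>\<^sub>0 real) set \<Rightarrow> ((nat \<Rightarrow>\<^sub>0 int) \<Rightarrow>\<^sub>0 'k::field) ring" where
  "polytope_algebra P = semigroup_algebra (generated_submonoid (lattice_points P))"


section \<open>Localization\<close>

definition ring_frac_rel :: "('a, 'b) ring_scheme \<Rightarrow> 'a set \<Rightarrow> (('a \<times> 'a) \<times> ('a \<times> 'a)) set" where
  "ring_frac_rel R S = {((a, s), (b, t)) | a s b t.
     a \<in> carrier R \<and> s \<in> S \<and> b \<in> carrier R \<and> t \<in> S \<and>
     (\<exists>u\<in>S. u \<otimes>\<^bsub>R\<^esub> (a \<otimes>\<^bsub>R\<^esub> t) = u \<otimes>\<^bsub>R\<^esub> (b \<otimes>\<^bsub>R\<^esub> s))}"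

definition ring_frac :: "('a, 'b) ring_scheme \<Rightarrow> 'a set \<Rightarrow> 'a \<Rightarrow> 'a \<Rightarrow> ('a \<times> 'a) set" where
  "ring_frac R S a s = ring_frac_rel R S `` {(a, s)}"

text \<open>
  Meaningful for a commutative ring \<open>R\<close> and a multiplicatively closed set \<open>S\<close> containing \<open>\<one>\<close>. The
  unions over representatives are unions of one and the same class.
\<close>

definition localization :: "('a, 'b) ring_scheme \<Rightarrow> 'a set \<Rightarrow> ('a \<times> 'a) set ring" where
  "localization R S =
     \<lparr>carrier = (carrier R \<times> S) // ring_frac_rel R S,
      mult = (\<lambda>X Y. \<Union>(a, s)\<in>X. \<Union>(b, t)\<in>Y. ring_frac R S (a \<otimes>\<^bsub>R\<^esub> b) (s \<otimes>\<^bsub>R\<^esub> t)),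
      one = ring_frac R S \<one>\<^bsub>R\<^esub> \<one>\<^bsub>R\<^esub>,
      zero = ring_frac R S \<zero>\<^bsub>R\<^esub> \<one>\<^bsub>R\<^esub>,
      add = (\<lambda>X Y. \<Union>(a, s)\<in>X. \<Union>(b, t)\<in>Y.
               ring_frac R S (a \<otimes>\<^bsub>R\<^esub> t \<oplus>\<^bsub>R\<^esub> b \<otimes>\<^bsub>R\<^esub> s) (s \<otimes>\<^bsub>R\<^esub> t))\<rparr>"

definition localization_at :: "('a, 'b) ring_scheme \<Rightarrow> 'a set \<Rightarrow> ('a \<times> 'a) set ring" where
  "localization_at R p = localization R (carrier R - p)"


section \<open>Regular local rings and Serre's condition\<close>

text \<open>The zero ring gets dimension \<open>0\<close> here, since \<open>Sup {} = 0\<close> in \<open>enat\<close>.\<close>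

definition krull_dim :: "('a, 'b) ring_scheme \<Rightarrow> enat" where
  "krull_dim R = Sup {enat k | k. \<exists>p :: nat \<Rightarrow> 'a set.
     (\<forall>i\<le>k. primeideal (p i) R) \<and> (\<forall>i<k. p i \<subset> p (Suc i))}"

definition regular_local_ring :: "('a, 'b) ring_scheme \<Rightarrow> bool" where
  "regular_local_ring R \<longleftrightarrow> cring R \<and> noetherian_ring R \<and>
     (\<exists>m. maximalideal m R \<and> (\<forall>m'. maximalideal m' R \<longrightarrow> m' = m) \<and>
       (\<exists>A \<subseteq> carrier R. finite A \<and> enat (card A) = krull_dim R \<and> m = Idl\<^bsub>R\<^esub> A))"

definition serre_R1 :: "('a, 'b) ring_scheme \<Rightarrow> bool" where
  "serre_R1 R \<longleftrightarrow> cring R \<and> noetherian_ring R \<and>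
     (\<forall>p. primeideal p R \<longrightarrow> krull_dim (localization_at R p) \<le> 1 \<longrightarrow>
        regular_local_ring (localization_at R p))"

end

theory Submission
  imports Defs "HOL-Computational_Algebra.Polynomial"
begin

text \<open>
  Let \<open>M\<close> be the monoid of the polytope, \<open>R = K[M]\<close>, and \<open>p \<noteq> 0\<close> a prime of height at most one. For every
  \<open>\<int>\<close>-grading of \<open>R\<close> the homogeneous core of \<open>p\<close> is a prime contained in \<open>p\<close>, hence \<open>0\<close> or \<open>p\<close>.

  If \<open>p\<close> contains no monomial, then some coordinate grading has core \<open>0\<close>: all homogeneous elements become
  units in \<open>R\<^sub>p\<close>, and division with remainder shows that an element of \<open>p\<close> of least width generates \<open>pR\<^sub>p\<close>.

  If \<open>p\<close> contains a monomial, then the vertices whose monomials avoid \<open>p\<close> lie on a facet, by Gale's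
  evenness condition and the affine relations of the moment curve, and \<open>p\<close> is spanned by the monomials off
  that facet. Let \<open>S\<close> be the nodes of the facet; its support form is, up to sign, \<open>\<Prod>\<^sub>s\<^sub>\<in>\<^sub>S (X - s)\<close> evaluated on
  moment vectors. Since the nodes are integers, the functionals that take the value \<open>\<plusminus>1\<close> on every Newton
  basis polynomial (for a node ordering in which each node is extremal among the remaining ones) are
  lattice points of the simplices of the polytope. Hence the facet contains lattice points generating the
  full lattice of its hyperplane, and the support form takes the value \<open>1\<close> on the monoid; a monomial of
  height \<open>1\<close> generates \<open>pR\<^sub>p\<close>.
\<close>

section \<open>Ideals of subrings\<close>

text \<open>At the prime of a facet two things can go wrong for a general lattice polytope: the
  lattice points on the facet may generate a proper subgroup of the lattice of its hyperplane, and
  the support form may miss the value 1 on the monoid. Both are excluded by one observation: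
  distinct integer nodes are at distance at least 1, so dividing barycentric weights by such
  distances keeps them admissible. Regularity in dimension one only asks for a single generator of
  the maximal ideal. Clearing denominators turns this into \<open>s * f = h * g\<close> with
  \<open>s\<close> outside \<open>p\<close>, an equation inside the algebra; both cases end in it.
  No face theory of polytopes is used. The facet is found from \<open>p\<close>: an affine relation
  among \<open>d + 2\<close> points of the moment curve, split by sign, is an equality of two
  monomials, and by primality either both or none lie in \<open>p\<close>. For the same reason real
  barycentric weights may be replaced by integral ones, as membership in \<open>p\<close> does not
  change when a monomial is replaced by a positive power.\<close>

definition subset_ring :: "'a::comm_ring_1 set \<Rightarrow> 'a ring" where
  "subset_ring C = \<lparr>carrier = C, mult = (*), one = 1, zero = 0, add = (+)\<rparr>"

lemma subset_ring_simps [simp]: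
  "carrier (subset_ring C) = C"
  "x \<otimes>\<^bsub>subset_ring C\<^esub> y = x * y"
  "x \<oplus>\<^bsub>subset_ring C\<^esub> y = x + y"
  "\<one>\<^bsub>subset_ring C\<^esub> = 1"
  "\<zero>\<^bsub>subset_ring C\<^esub> = 0"
  by (simp_all add: subset_ring_def)

definition ideal_in :: "'a::comm_ring_1 set \<Rightarrow> 'a set \<Rightarrow> bool" where
  "ideal_in C I \<longleftrightarrow> I \<subseteq> C \<and> 0 \<in> I \<and> (\<forall>x\<in>I. \<forall>y\<in>I. x + y \<in> I) \<and> (\<forall>r\<in>C. \<forall>x\<in>I. r * x \<in> I)"

definition prime_in :: "'a::comm_ring_1 set \<Rightarrow> 'a set \<Rightarrow> bool" where
  "prime_in C p \<longleftrightarrow> ideal_in C p \<and> 1 \<notin> p \<and> (\<forall>x\<in>C. \<forall>y\<in>C. x * y \<in> p \<longrightarrow> x \<in> p \<or> y \<in> p)"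

lemma ideal_inD:
  assumes "ideal_in C I"
  shows "I \<subseteq> C" "0 \<in> I" "\<And>x y. x \<in> I \<Longrightarrow> y \<in> I \<Longrightarrow> x + y \<in> I"
    "\<And>r x. r \<in> C \<Longrightarrow> x \<in> I \<Longrightarrow> r * x \<in> I"
  using assms by (auto simp: ideal_in_def)

lemma prime_inD:
  assumes "prime_in C p"
  shows "p \<subseteq> C" "0 \<in> p" "1 \<notin> p" "\<And>x y. x \<in> p \<Longrightarrow> y \<in> p \<Longrightarrow> x + y \<in> p"
    "\<And>r x. r \<in> C \<Longrightarrow> x \<in> p \<Longrightarrow> r * x \<in> p"
    "\<And>x y. x \<in> C \<Longrightarrow> y \<in> C \<Longrightarrow> x * y \<in> p \<Longrightarrow> x \<in> p \<or> y \<in> p"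
  using assms by (auto simp: prime_in_def ideal_in_def)

lemma ideal_in_sum:
  assumes "ideal_in C p" "\<And>i. i \<in> A \<Longrightarrow> f i \<in> p"
  shows "sum f A \<in> p"
  using assms(2) by (induction A rule: infinite_finite_induct) (auto simp: ideal_inD[OF assms(1)])

locale subring_set =
  fixes C :: "'a::comm_ring_1 set"
  assumes one_mem [simp]: "1 \<in> C"
    and add_mem [simp]: "x \<in> C \<Longrightarrow> y \<in> C \<Longrightarrow> x + y \<in> C"
    and uminus_mem [simp]: "x \<in> C \<Longrightarrow> - x \<in> C"
    and mult_mem [simp]: "x \<in> C \<Longrightarrow> y \<in> C \<Longrightarrow> x * y \<in> C"
begin

lemma zero_mem [simp]: "0 \<in> C"
  using add_mem[OF one_mem uminus_mem[OF one_mem]] by simp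

lemma diff_mem [simp]: "x \<in> C \<Longrightarrow> y \<in> C \<Longrightarrow> x - y \<in> C"
  using add_mem[of x "- y"] by simp

lemma sum_mem: "(\<And>i. i \<in> A \<Longrightarrow> f i \<in> C) \<Longrightarrow> sum f A \<in> C"
  by (induction A rule: infinite_finite_induct) auto

lemma power_mem [simp]: "x \<in> C \<Longrightarrow> x ^ k \<in> C"
  by (induction k) auto

lemma cring_subset_ring: "cring (subset_ring C)"
proof (rule cringI)
  show "abelian_group (subset_ring C)"
  proof (rule abelian_groupI)
    show "\<exists>y\<in>carrier (subset_ring C). y \<oplus>\<^bsub>subset_ring C\<^esub> x = \<zero>\<^bsub>subset_ring C\<^esub>"
      if "x \<in> carrier (subset_ring C)" for x
      using that by (intro bexI[of _ "- x"]) auto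
  qed (auto simp: algebra_simps)
  show "Group.comm_monoid (subset_ring C)"
    by (rule comm_monoidI) (auto simp: algebra_simps)
qed (auto simp: algebra_simps)

lemma ring_subset_ring: "ring (subset_ring C)"
  using cring_subset_ring by (rule cring.axioms(1))

lemma ideal_in_uminus: "ideal_in C I \<Longrightarrow> x \<in> I \<Longrightarrow> - x \<in> I"
  using ideal_inD(4)[of C I "- 1" x] by simp

lemma ideal_in_diff: "ideal_in C I \<Longrightarrow> x \<in> I \<Longrightarrow> y \<in> I \<Longrightarrow> x - y \<in> I"
  using ideal_in_uminus[of I y] ideal_inD(3)[of C I x "- y"] by simp

lemma a_inv_subset_ring:
  assumes "x \<in> C"
  shows "inv\<^bsub>add_monoid (subset_ring C)\<^esub> x = - x"
proof -
  interpret R: cring "subset_ring C" by (rule cring_subset_ring)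
  have "\<ominus>\<^bsub>subset_ring C\<^esub> x = - x"
    using assms by (intro R.minus_equality) auto
  then show ?thesis by (simp add: a_inv_def)
qed

lemma ideal_iff: "ideal I (subset_ring C) \<longleftrightarrow> ideal_in C I"
proof
  assume "ideal I (subset_ring C)"
  then interpret I: ideal I "subset_ring C" .
  have "0 \<in> I" using additive_subgroup.zero_closed[OF I.additive_subgroup_axioms] by simp
  moreover have "x + y \<in> I" if "x \<in> I" "y \<in> I" for x y
    using additive_subgroup.a_closed[OF I.additive_subgroup_axioms that] by simp
  ultimately show "ideal_in C I"
    using I.a_subset I.I_l_closed by (auto simp: ideal_in_def)
next
  assume I: "ideal_in C I"
  show "ideal I (subset_ring C)"
  proof (rule idealI[OF ring_subset_ring])
    show "subgroup I (add_monoid (subset_ring C))"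
    proof
      show "inv\<^bsub>add_monoid (subset_ring C)\<^esub> x \<in> I" if "x \<in> I" for x
        using that ideal_in_uminus[OF I] ideal_inD(1)[OF I] a_inv_subset_ring by auto
    qed (use ideal_inD[OF I] in auto)
  next
    fix a x assume "a \<in> I" "x \<in> carrier (subset_ring C)"
    then have "x * a \<in> I" using ideal_inD(4)[OF I] by simp
    then show "x \<otimes>\<^bsub>subset_ring C\<^esub> a \<in> I" "a \<otimes>\<^bsub>subset_ring C\<^esub> x \<in> I"
      by (simp_all add: mult.commute)
  qed
qed

lemma primeideal_iff: "primeideal p (subset_ring C) \<longleftrightarrow> prime_in C p"
proof
  assume "primeideal p (subset_ring C)"
  then interpret p: primeideal p "subset_ring C" .
  have p: "ideal_in C p" using p.ideal_axioms by (simp add: ideal_iff)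
  have "1 \<notin> p"
  proof
    assume "1 \<in> p"
    then have "x \<in> p" if "x \<in> C" for x using ideal_inD(4)[OF p that] by fastforce
    then show False using p.I_notcarr ideal_inD(1)[OF p] by auto
  qed
  then show "prime_in C p" using p p.I_prime by (auto simp: prime_in_def)
next
  assume p: "prime_in C p"
  show "primeideal p (subset_ring C)"
    by (rule primeidealI[OF _ cring_subset_ring])
      (use p prime_inD(3,6)[OF p] one_mem in \<open>auto simp: prime_in_def ideal_iff\<close>)
qed

end

lemma (in cring) primeideal_one_notin: "primeideal p R \<Longrightarrow> \<one> \<notin> p"
  using primeideal.I_notcarr primeideal.axioms(1) ideal.one_imp_carrier by metis

section \<open>Localization of a domain at a prime ideal\<close>

locale subdomain_prime = subring_set C for C :: "'a::idom set" +
  fixes p :: "'a set"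
  assumes prime: "prime_in C p"
begin

abbreviation "Lp \<equiv> localization_at (subset_ring C) p"
abbreviation "fr \<equiv> ring_frac (subset_ring C) (C - p)"

lemma denom_nonzero: "s \<in> C - p \<Longrightarrow> s \<noteq> 0"
  using prime_inD(2)[OF prime] by auto

lemma denom_mult: "s \<in> C - p \<Longrightarrow> t \<in> C - p \<Longrightarrow> s * t \<in> C - p"
  using prime_inD(6)[OF prime] by auto

lemma denom_one: "1 \<in> C - p"
  using prime_inD(3)[OF prime] by auto

text \<open>Elements outside \<open>p\<close> are nonzero, so in a domain the factor
  \<open>u\<close> of the localization relation cancels and fractions are compared by plain
  cross-multiplication.\<close>

lemma fr_altdef:
  assumes "a \<in> C" "s \<in> C - p"
  shows "fr a s = {(b, t). b \<in> C \<and> t \<in> C - p \<and> a * t = b * s}"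
proof -
  have "(\<exists>u\<in>C - p. u * (a * t) = u * (b * s)) \<longleftrightarrow> a * t = b * s" for b t
    using denom_nonzero denom_one by (metis mult_left_cancel)
  then show ?thesis
    using assms by (auto simp: ring_frac_def ring_frac_rel_def Image_def)
qed

lemma fr_eq_iff:
  assumes "a \<in> C" "s \<in> C - p" "b \<in> C" "t \<in> C - p"
  shows "fr a s = fr b t \<longleftrightarrow> a * t = b * s"
proof
  assume "fr a s = fr b t"
  moreover have "(b, t) \<in> fr b t" using assms by (simp add: fr_altdef)
  ultimately show "a * t = b * s" using assms by (auto simp: fr_altdef)
next
  assume eq: "a * t = b * s"
  have "a * v = c * s \<longleftrightarrow> b * v = c * t" if "v \<in> C - p" for c v
  proof -
    have 1: "t * (a * v) = s * (b * v)"
      using arg_cong[OF eq, of "\<lambda>x. x * v"] by (simp add: ac_simps)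
    have 2: "t * (c * s) = s * (c * t)" by (simp add: ac_simps)
    have "a * v = c * s \<longleftrightarrow> t * (a * v) = t * (c * s)" using denom_nonzero assms by simp
    also have "\<dots> \<longleftrightarrow> b * v = c * t" unfolding 1 2 using denom_nonzero assms by simp
    finally show ?thesis .
  qed
  then show "fr a s = fr b t" using assms by (auto simp: fr_altdef)
qed

lemma carrier_Lp: "carrier Lp = {fr a s | a s. a \<in> C \<and> s \<in> C - p}"
  by (auto simp: localization_at_def localization_def quotient_def ring_frac_def)

lemma Lp_cases:
  assumes "X \<in> carrier Lp"
  obtains a s where "a \<in> C" "s \<in> C - p" "X = fr a s"
  using assms by (auto simp: carrier_Lp)

lemma fr_mem [intro, simp]: "a \<in> C \<Longrightarrow> s \<in> C - p \<Longrightarrow> fr a s \<in> carrier Lp"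
  by (auto simp: carrier_Lp)

lemma fr_self: "a \<in> C \<Longrightarrow> s \<in> C - p \<Longrightarrow> (a, s) \<in> fr a s"
  by (simp add: fr_altdef)

lemma mult_fr [simp]:
  assumes "a \<in> C" "s \<in> C - p" "b \<in> C" "t \<in> C - p"
  shows "fr a s \<otimes>\<^bsub>Lp\<^esub> fr b t = fr (a * b) (s * t)"
proof -
  have *: "fr (a' * b') (s' * t') = fr (a * b) (s * t)"
    if h: "(a', s') \<in> fr a s" "(b', t') \<in> fr b t" for a' s' b' t'
  proof -
    have "a * s' = a' * s" "b * t' = b' * t" "a' \<in> C" "s' \<in> C - p" "b' \<in> C" "t' \<in> C - p"
      using h assms by (auto simp: fr_altdef)
    moreover from this have "(a * s') * (b * t') = (a' * s) * (b' * t)" by simp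
    ultimately show ?thesis
      using assms by (subst fr_eq_iff) (auto simp: denom_mult algebra_simps simp del: Diff_iff)
  qed
  have "fr a s \<otimes>\<^bsub>Lp\<^esub> fr b t = (\<Union>(a', s')\<in>fr a s. \<Union>(b', t')\<in>fr b t. fr (a' * b') (s' * t'))"
    by (simp add: localization_at_def localization_def)
  \<comment> \<open>All representatives give the same class by \<open>*\<close>, and the index sets
    contain \<open>(a, s)\<close> and \<open>(b, t)\<close>, so the union of this constant family is
    that class.\<close>
  also have "\<dots> = (\<Union>x\<in>fr a s. \<Union>y\<in>fr b t. fr (a * b) (s * t))"
    by (intro SUP_cong refl) (auto simp: *)
  also have "\<dots> = fr (a * b) (s * t)" using fr_self assms by blast
  finally show ?thesis .
qed

lemma add_fr [simp]:
  assumes "a \<in> C" "s \<in> C - p" "b \<in> C" "t \<in> C - p"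
  shows "fr a s \<oplus>\<^bsub>Lp\<^esub> fr b t = fr (a * t + b * s) (s * t)"
proof -
  have *: "fr (a' * t' + b' * s') (s' * t') = fr (a * t + b * s) (s * t)"
    if h: "(a', s') \<in> fr a s" "(b', t') \<in> fr b t" for a' s' b' t'
  proof -
    have e: "a * s' = a' * s" "b * t' = b' * t" and m: "a' \<in> C" "s' \<in> C - p" "b' \<in> C" "t' \<in> C - p"
      using h assms by (auto simp: fr_altdef)
    have "(a' * t' + b' * s') * (s * t) = (a' * s) * (t' * t) + (b' * t) * (s' * s)"
      by (simp add: algebra_simps)
    also have "\<dots> = (a * t + b * s) * (s' * t')"
      by (simp flip: e add: algebra_simps)
    finally show ?thesis
      using assms m by (subst fr_eq_iff) (auto simp: denom_mult simp del: Diff_iff)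
  qed
  have "fr a s \<oplus>\<^bsub>Lp\<^esub> fr b t
      = (\<Union>(a', s')\<in>fr a s. \<Union>(b', t')\<in>fr b t. fr (a' * t' + b' * s') (s' * t'))"
    by (simp add: localization_at_def localization_def)
  also have "\<dots> = (\<Union>x\<in>fr a s. \<Union>y\<in>fr b t. fr (a * t + b * s) (s * t))"
    by (intro SUP_cong refl) (auto simp: *)
  also have "\<dots> = fr (a * t + b * s) (s * t)" using fr_self assms by blast
  finally show ?thesis .
qed

lemma one_Lp: "\<one>\<^bsub>Lp\<^esub> = fr 1 1" and zero_Lp: "\<zero>\<^bsub>Lp\<^esub> = fr 0 1"
  by (simp_all add: localization_at_def localization_def)

lemma fr_eqI:
  assumes "a \<in> C" "s \<in> C - p" "b \<in> C" "t \<in> C - p" "a * t = b * s"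
  shows "fr a s = fr b t"
  using assms fr_eq_iff by blast

lemma fr_zero: "s \<in> C - p \<Longrightarrow> fr 0 s = fr 0 1"
  by (rule fr_eqI) (simp_all add: denom_one del: Diff_iff)

lemma cring_Lp: "cring Lp"
proof (rule cringI)
  have mC: "s \<in> C" if "s \<in> C - p" for s using that by (rule DiffD1)
  show "abelian_group Lp"
  proof (rule abelian_groupI)
    show "\<zero>\<^bsub>Lp\<^esub> \<in> carrier Lp" unfolding zero_Lp by (intro fr_mem zero_mem one_mem denom_one)
    fix X assume "X \<in> carrier Lp"
    then obtain a s where X: "a \<in> C" "s \<in> C - p" "X = fr a s" by (rule Lp_cases)
    show "\<zero>\<^bsub>Lp\<^esub> \<oplus>\<^bsub>Lp\<^esub> X = X"
      using add_fr[OF zero_mem denom_one X(1,2)] unfolding X(3) zero_Lp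
      by (simp only: mult_zero_left mult_1 mult_1_right add_0)
    have "fr (- a) s \<oplus>\<^bsub>Lp\<^esub> X = \<zero>\<^bsub>Lp\<^esub>"
      using add_fr[OF uminus_mem[OF X(1)] X(2) X(1,2)] fr_zero[OF denom_mult[OF X(2,2)]]
      unfolding X(3) zero_Lp by (simp only: mult_minus_left left_minus)
    then show "\<exists>Y\<in>carrier Lp. Y \<oplus>\<^bsub>Lp\<^esub> X = \<zero>\<^bsub>Lp\<^esub>"
      using X by (intro bexI[of _ "fr (- a) s"] fr_mem uminus_mem)
  next
    fix X Y assume "X \<in> carrier Lp" "Y \<in> carrier Lp"
    then obtain a s b t where X: "a \<in> C" "s \<in> C - p" "X = fr a s" and Y: "b \<in> C" "t \<in> C - p" "Y = fr b t"
      by (elim Lp_cases)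
    show "X \<oplus>\<^bsub>Lp\<^esub> Y \<in> carrier Lp"
      unfolding X(3) Y(3) add_fr[OF X(1,2) Y(1,2)]
      by (intro fr_mem add_mem mult_mem denom_mult X Y mC)
    show "X \<oplus>\<^bsub>Lp\<^esub> Y = Y \<oplus>\<^bsub>Lp\<^esub> X"
      unfolding X(3) Y(3) add_fr[OF X(1,2) Y(1,2)] add_fr[OF Y(1,2) X(1,2)] by (simp add: ac_simps)
  next
    fix X Y Z assume "X \<in> carrier Lp" "Y \<in> carrier Lp" "Z \<in> carrier Lp"
    then obtain a s b t c u where X: "a \<in> C" "s \<in> C - p" "X = fr a s" and Y: "b \<in> C" "t \<in> C - p" "Y = fr b t"
      and Z: "c \<in> C" "u \<in> C - p" "Z = fr c u"
      by (elim Lp_cases)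
    have "(X \<oplus>\<^bsub>Lp\<^esub> Y) \<oplus>\<^bsub>Lp\<^esub> Z = fr ((a * t + b * s) * u + c * (s * t)) (s * t * u)"
      unfolding X(3) Y(3) Z(3) add_fr[OF X(1,2) Y(1,2)]
      by (intro add_fr add_mem mult_mem denom_mult X Y Z mC)
    also have "\<dots> = fr (a * (t * u) + (b * u + c * t) * s) (s * (t * u))"
      by (simp add: algebra_simps)
    also have "\<dots> = X \<oplus>\<^bsub>Lp\<^esub> (Y \<oplus>\<^bsub>Lp\<^esub> Z)"
      unfolding X(3) Y(3) Z(3) add_fr[OF Y(1,2) Z(1,2)]
      by (intro add_fr[symmetric] add_mem mult_mem denom_mult X Y Z mC)
    finally show "(X \<oplus>\<^bsub>Lp\<^esub> Y) \<oplus>\<^bsub>Lp\<^esub> Z = X \<oplus>\<^bsub>Lp\<^esub> (Y \<oplus>\<^bsub>Lp\<^esub> Z)" .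
  qed
  show "Group.comm_monoid Lp"
  proof (rule comm_monoidI)
    show "\<one>\<^bsub>Lp\<^esub> \<in> carrier Lp" unfolding one_Lp by (intro fr_mem zero_mem one_mem denom_one)
    fix X assume "X \<in> carrier Lp"
    then obtain a s where X: "a \<in> C" "s \<in> C - p" "X = fr a s" by (rule Lp_cases)
    show "\<one>\<^bsub>Lp\<^esub> \<otimes>\<^bsub>Lp\<^esub> X = X"
      using mult_fr[OF one_mem denom_one X(1,2)] unfolding X(3) one_Lp by (simp only: mult_1)
  next
    fix X Y assume "X \<in> carrier Lp" "Y \<in> carrier Lp"
    then obtain a s b t where X: "a \<in> C" "s \<in> C - p" "X = fr a s" and Y: "b \<in> C" "t \<in> C - p" "Y = fr b t"
      by (elim Lp_cases)
    show "X \<otimes>\<^bsub>Lp\<^esub> Y \<in> carrier Lp"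
      unfolding X(3) Y(3) mult_fr[OF X(1,2) Y(1,2)] by (intro fr_mem mult_mem denom_mult X Y)
    show "X \<otimes>\<^bsub>Lp\<^esub> Y = Y \<otimes>\<^bsub>Lp\<^esub> X"
      unfolding X(3) Y(3) mult_fr[OF X(1,2) Y(1,2)] mult_fr[OF Y(1,2) X(1,2)] by (simp add: ac_simps)
  next
    fix X Y Z assume "X \<in> carrier Lp" "Y \<in> carrier Lp" "Z \<in> carrier Lp"
    then obtain a s b t c u where X: "a \<in> C" "s \<in> C - p" "X = fr a s" and Y: "b \<in> C" "t \<in> C - p" "Y = fr b t"
      and Z: "c \<in> C" "u \<in> C - p" "Z = fr c u"
      by (elim Lp_cases)
    have "(X \<otimes>\<^bsub>Lp\<^esub> Y) \<otimes>\<^bsub>Lp\<^esub> Z = fr (a * b * c) (s * t * u)"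
      unfolding X(3) Y(3) Z(3) mult_fr[OF X(1,2) Y(1,2)] by (intro mult_fr add_mem mult_mem denom_mult X Y Z mC)
    also have "\<dots> = fr (a * (b * c)) (s * (t * u))" by (simp add: ac_simps)
    also have "\<dots> = X \<otimes>\<^bsub>Lp\<^esub> (Y \<otimes>\<^bsub>Lp\<^esub> Z)"
      unfolding X(3) Y(3) Z(3) mult_fr[OF Y(1,2) Z(1,2)] by (intro mult_fr[symmetric] add_mem mult_mem denom_mult X Y Z mC)
    finally show "(X \<otimes>\<^bsub>Lp\<^esub> Y) \<otimes>\<^bsub>Lp\<^esub> Z = X \<otimes>\<^bsub>Lp\<^esub> (Y \<otimes>\<^bsub>Lp\<^esub> Z)" .
  qed
  fix X Y Z assume "X \<in> carrier Lp" "Y \<in> carrier Lp" "Z \<in> carrier Lp"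
  then obtain a s b t c u where X: "a \<in> C" "s \<in> C - p" "X = fr a s" and Y: "b \<in> C" "t \<in> C - p" "Y = fr b t"
    and Z: "c \<in> C" "u \<in> C - p" "Z = fr c u"
    by (elim Lp_cases)
  have "(X \<oplus>\<^bsub>Lp\<^esub> Y) \<otimes>\<^bsub>Lp\<^esub> Z = fr ((a * t + b * s) * c) (s * t * u)"
    unfolding X(3) Y(3) Z(3) add_fr[OF X(1,2) Y(1,2)] by (intro mult_fr add_mem mult_mem denom_mult X Y Z mC)
  also have "\<dots> = fr (a * c * (t * u) + b * c * (s * u)) (s * u * (t * u))"
    by (intro fr_eqI add_mem mult_mem denom_mult X Y Z mC) (simp add: algebra_simps)
  also have "\<dots> = X \<otimes>\<^bsub>Lp\<^esub> Z \<oplus>\<^bsub>Lp\<^esub> Y \<otimes>\<^bsub>Lp\<^esub> Z"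
    unfolding X(3) Y(3) Z(3) mult_fr[OF Y(1,2) Z(1,2)] mult_fr[OF X(1,2) Z(1,2)]
    by (intro add_fr[symmetric] add_mem mult_mem denom_mult X Y Z mC)
  finally show "(X \<oplus>\<^bsub>Lp\<^esub> Y) \<otimes>\<^bsub>Lp\<^esub> Z = X \<otimes>\<^bsub>Lp\<^esub> Z \<oplus>\<^bsub>Lp\<^esub> Y \<otimes>\<^bsub>Lp\<^esub> Z" .
qed

section \<open>Ideals and primes of the localization\<close>

sublocale Lp: cring Lp
  by (rule cring_Lp)

text \<open>For an ideal \<open>q\<close> of \<open>C\<close> this is its extension to the
  localization. Sums of fractions can be brought to a common denominator, so single fractions
  suffice.\<close>

definition ext :: "'a set \<Rightarrow> ('a \<times> 'a) set set" where
  "ext q = {fr a s | a s. a \<in> q \<and> s \<in> C - p}"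

lemma fr_in_ext: "a \<in> q \<Longrightarrow> s \<in> C - p \<Longrightarrow> fr a s \<in> ext q"
  unfolding ext_def by blast

text \<open>Contracting the extension of a prime below \<open>p\<close> gives the prime back: if a /
  s = b / t with \<open>b\<close> in \<open>q\<close>, then \<open>a * t\<close> lies in
  \<open>q\<close>, while \<open>t\<close>, being outside \<open>p\<close>, is outside
  \<open>q\<close>. Hence chains of primes below \<open>p\<close> stay strict in
  \<open>Lp\<close>.\<close>

lemma fr_in_ext_iff:
  assumes "prime_in C q" "q \<subseteq> p" "a \<in> C" "s \<in> C - p"
  shows "fr a s \<in> ext q \<longleftrightarrow> a \<in> q"
proof
  assume "fr a s \<in> ext q"
  then obtain b t where b: "fr a s = fr b t" "b \<in> q" "t \<in> C - p" by (auto simp: ext_def)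
  have "b \<in> C" using b prime_inD(1)[OF assms(1)] by auto
  then have "a * t = b * s" using b assms fr_eq_iff by blast
  moreover have "b * s \<in> q" using b assms prime_inD(5)[OF assms(1), of s b] by (simp add: mult.commute)
  ultimately have "a * t \<in> q" by simp
  then show "a \<in> q" using prime_inD(6)[OF assms(1), of a t] assms b by auto
qed (use assms in \<open>auto simp: ext_def\<close>)

lemma ideal_ext:
  assumes "ideal_in C I"
  shows "ideal (ext I) Lp"
proof (rule idealI[OF Lp.ring_axioms])
  note I = ideal_inD[OF assms]
  note [simp] = denom_mult denom_one
  note [simp del] = Diff_iff
  have mC: "s \<in> C" if "s \<in> C - p" for s using that by (rule DiffD1)
  have IC: "s \<in> C" if "s \<in> I" for s using that I by auto
  note [simp] = mC IC
  show "subgroup (ext I) (add_monoid Lp)"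
  proof
    show "ext I \<subseteq> carrier (add_monoid Lp)" by (auto simp: ext_def)
    show "\<one>\<^bsub>add_monoid Lp\<^esub> \<in> ext I"
      using I(2) denom_one unfolding ext_def monoid.simps zero_Lp by blast
    show "X \<otimes>\<^bsub>add_monoid Lp\<^esub> Y \<in> ext I" if XY: "X \<in> ext I" "Y \<in> ext I" for X Y
    proof -
      obtain a s b t where *: "a \<in> I" "s \<in> C - p" "X = fr a s" "b \<in> I" "t \<in> C - p" "Y = fr b t"
        using XY by (auto simp: ext_def)
      then have "X \<otimes>\<^bsub>add_monoid Lp\<^esub> Y = fr (a * t + b * s) (s * t)" by simp
      moreover have "a * t + b * s \<in> I" using * I(3,4) by (metis mC mult.commute)
      moreover have "s * t \<in> C - p" using * by simp
      ultimately show ?thesis by (simp only: fr_in_ext)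
    qed
    show "inv\<^bsub>add_monoid Lp\<^esub> X \<in> ext I" if X: "X \<in> ext I" for X
    proof -
      obtain a s where *: "a \<in> I" "s \<in> C - p" "X = fr a s"
        using X by (auto simp: ext_def)
      have "\<ominus>\<^bsub>Lp\<^esub> X = fr (- a) s"
      proof (rule Lp.minus_equality)
        have aC: "a \<in> C" "- a \<in> C" using * by simp_all
        show "fr (- a) s \<oplus>\<^bsub>Lp\<^esub> X = \<zero>\<^bsub>Lp\<^esub>"
          using add_fr[OF aC(2) *(2) aC(1) *(2)] fr_zero[OF denom_mult[OF *(2,2)]]
          unfolding *(3) zero_Lp by (simp only: mult_minus_left left_minus)
        show "X \<in> carrier Lp" "fr (- a) s \<in> carrier Lp" unfolding *(3) by (intro fr_mem aC *)+
      qed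
      moreover have "- a \<in> I" using ideal_in_uminus[OF assms] *(1) .
      ultimately show ?thesis using *(2) by (metis a_inv_def fr_in_ext)
    qed
  qed
  fix X Y assume "X \<in> ext I" "Y \<in> carrier Lp"
  then obtain a s b t where *: "a \<in> I" "s \<in> C - p" "X = fr a s" "b \<in> C" "t \<in> C - p" "Y = fr b t"
    by (auto simp: ext_def carrier_Lp)
  have e: "Y \<otimes>\<^bsub>Lp\<^esub> X = fr (b * a) (t * s)" "X \<otimes>\<^bsub>Lp\<^esub> Y = fr (b * a) (t * s)"
    using * by (simp_all add: mult.commute)
  have "fr (b * a) (t * s) \<in> ext I"
  proof (rule fr_in_ext)
    show "b * a \<in> I" using *(4,1) by (rule I(4))
    show "t * s \<in> C - p" using *(5,2) by (rule denom_mult)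
  qed
  then show "Y \<otimes>\<^bsub>Lp\<^esub> X \<in> ext I" "X \<otimes>\<^bsub>Lp\<^esub> Y \<in> ext I"
    by (simp_all only: e)
qed

lemma one_notin_ext:
  assumes "prime_in C q" "q \<subseteq> p"
  shows "\<one>\<^bsub>Lp\<^esub> \<notin> ext q"
  unfolding one_Lp fr_in_ext_iff[OF assms one_mem denom_one] by (rule prime_inD(3)[OF assms(1)])

lemma primeideal_ext:
  assumes "prime_in C q" "q \<subseteq> p"
  shows "primeideal (ext q) Lp"
proof (rule primeidealI[OF _ cring_Lp])
  show "ideal (ext q) Lp" using ideal_ext assms by (simp add: prime_in_def)
  show "carrier Lp \<noteq> ext q" using one_notin_ext[OF assms] by auto
  fix X Y assume XY: "X \<in> carrier Lp" "Y \<in> carrier Lp" "X \<otimes>\<^bsub>Lp\<^esub> Y \<in> ext q"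
  then obtain a s b t where *: "a \<in> C" "s \<in> C - p" "X = fr a s" "b \<in> C" "t \<in> C - p" "Y = fr b t"
    by (elim Lp_cases)
  then have "a * b \<in> q" using XY fr_in_ext_iff[OF assms, of "a * b" "s * t"] denom_mult by simp
  then have "a \<in> q \<or> b \<in> q" using prime_inD(6)[OF assms(1)] * by simp
  then show "X \<in> ext q \<or> Y \<in> ext q" using * by (auto simp: ext_def)
qed

lemma ext_strict_mono:
  assumes "prime_in C q" "q \<subseteq> p" "prime_in C q'" "q' \<subseteq> p" "q \<subset> q'"
  shows "ext q \<subset> ext q'"
proof -
  obtain a where a: "a \<in> q'" "a \<notin> q" using assms by auto
  then have "a \<in> C" using prime_inD(1)[OF assms(3)] by auto
  then have "fr a 1 \<in> ext q'" "fr a 1 \<notin> ext q"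
    using fr_in_ext_iff assms a denom_one by (meson)+
  moreover have "ext q \<subseteq> ext q'" using assms(5) unfolding ext_def by blast
  ultimately show ?thesis by auto
qed

lemma prime_in_zero: "prime_in C {0}"
  by (auto simp: prime_in_def ideal_in_def)

text \<open>A fraction whose numerator avoids \<open>p\<close> is a unit, with inverse
  \<open>fr s a\<close>. So \<open>ext p\<close> contains every proper ideal, which makes it the
  only maximal one.\<close>

lemma ideal_subset_ext:
  assumes "ideal J Lp" "\<one>\<^bsub>Lp\<^esub> \<notin> J"
  shows "J \<subseteq> ext p"
proof
  interpret J: ideal J Lp by fact
  fix X assume X: "X \<in> J"
  then have "X \<in> carrier Lp" by (rule J.Icarr)
  then obtain a s where *: "a \<in> C" "s \<in> C - p" "X = fr a s" by (rule Lp_cases)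
  show "X \<in> ext p"
  proof (rule ccontr)
    assume "X \<notin> ext p"
    then have a: "a \<in> C - p" using * by (auto simp: ext_def)
    have "fr s a \<otimes>\<^bsub>Lp\<^esub> X \<in> J" using J.I_l_closed[OF X, of "fr s a"] * a by (simp del: mult_fr)
    moreover have "fr s a \<otimes>\<^bsub>Lp\<^esub> X = \<one>\<^bsub>Lp\<^esub>"
      unfolding *(3) one_Lp mult_fr[OF DiffD1[OF *(2)] a *(1,2)]
      using * a by (intro fr_eqI denom_mult denom_one) (simp_all add: mult.commute)
    ultimately show False using assms by simp
  qed
qed

lemma maximalideal_ext: "maximalideal (ext p) Lp"
proof (rule maximalidealI)
  show "ideal (ext p) Lp" using ideal_ext prime by (simp add: prime_in_def)
  show "carrier Lp \<noteq> ext p" using one_notin_ext[OF prime] by auto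
  show "J = ext p \<or> J = carrier Lp" if J: "ideal J Lp" "ext p \<subseteq> J" for J
    using ideal_subset_ext[OF J(1)] ideal.one_imp_carrier[OF J(1)] J(2) by blast
qed

lemma maximalideal_unique:
  assumes "maximalideal J Lp"
  shows "J = ext p"
proof -
  interpret J: maximalideal J Lp by fact
  have 1: "\<one>\<^bsub>Lp\<^esub> \<notin> J" using J.I_notcarr J.one_imp_carrier by auto
  have "J \<subseteq> ext p" using ideal_subset_ext[OF J.ideal_axioms 1] .
  moreover have "ideal (ext p) Lp" using ideal_ext prime by (simp add: prime_in_def)
  moreover have "ext p \<noteq> carrier Lp" using one_notin_ext[OF prime] by auto
  moreover have "ext p \<subseteq> carrier Lp" using prime_inD(1)[OF prime] by (auto simp: ext_def)
  ultimately show ?thesis using J.I_maximal by blast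
qed

text \<open>Every ideal of \<open>Lp\<close> is the extension of its contraction to
  \<open>C\<close>, so finitely many generators of the contraction also generate the ideal.\<close>

lemma noetherian_Lp:
  assumes "noetherian_ring (subset_ring C)"
  shows "noetherian_ring Lp"
proof (rule Lp.noetherian_ringI)
  fix J assume "ideal J Lp"
  then interpret J: ideal J Lp .
  have fr1: "a \<in> C \<Longrightarrow> fr a 1 \<in> carrier Lp" for a using denom_one by simp
  have contr: "ideal_in C {a \<in> C. fr a 1 \<in> K}" if "ideal K Lp" for K
  proof -
    interpret K: ideal K Lp by fact
    show ?thesis
      unfolding ideal_in_def
    proof (intro conjI ballI)
      show "0 \<in> {a \<in> C. fr a 1 \<in> K}" using additive_subgroup.zero_closed[OF K.additive_subgroup_axioms] by (simp add: zero_Lp)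
      fix x y assume "x \<in> {a \<in> C. fr a 1 \<in> K}" "y \<in> {a \<in> C. fr a 1 \<in> K}"
      then show "x + y \<in> {a \<in> C. fr a 1 \<in> K}"
        using additive_subgroup.a_closed[OF K.additive_subgroup_axioms, of "fr x 1" "fr y 1"] denom_one by (auto simp del: Diff_iff)
    next
      fix r x assume "r \<in> C" "x \<in> {a \<in> C. fr a 1 \<in> K}"
      then show "r * x \<in> {a \<in> C. fr a 1 \<in> K}"
        using K.I_l_closed[of "fr x 1" "fr r 1"] denom_one by (auto simp del: Diff_iff)
    qed auto
  qed
  interpret R: noetherian_ring "subset_ring C" by fact
  have "ideal {a \<in> C. fr a 1 \<in> J} (subset_ring C)"
    using contr[OF J.ideal_axioms] by (simp add: ideal_iff)
  then obtain A where A: "A \<subseteq> C" "finite A" "{a \<in> C. fr a 1 \<in> J} = Idl\<^bsub>subset_ring C\<^esub> A"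
    using R.finetely_gen by (metis subset_ring_simps(1))
  define B where "B = (\<lambda>a. fr a 1) ` A"
  have BL: "B \<subseteq> carrier Lp" using A(1) fr1 by (auto simp: B_def)
  interpret K: ideal "Idl\<^bsub>Lp\<^esub> B" Lp by (rule Lp.genideal_ideal[OF BL])
  have "A \<subseteq> {a \<in> C. fr a 1 \<in> J}"
    unfolding A(3) using A(1) R.genideal_self[of A] by simp
  then have "B \<subseteq> J" by (auto simp: B_def)
  then have sub: "Idl\<^bsub>Lp\<^esub> B \<subseteq> J" by (rule Lp.genideal_minimal[OF J.ideal_axioms])
  have "A \<subseteq> {a \<in> C. fr a 1 \<in> Idl\<^bsub>Lp\<^esub> B}"
    using Lp.genideal_self[OF BL] A(1) by (auto simp: B_def)
  then have AK: "{a \<in> C. fr a 1 \<in> J} \<subseteq> {a \<in> C. fr a 1 \<in> Idl\<^bsub>Lp\<^esub> B}"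
    unfolding A(3) by (intro R.genideal_minimal) (simp_all add: ideal_iff contr K.ideal_axioms)
  have "J \<subseteq> Idl\<^bsub>Lp\<^esub> B"
  proof
    fix X assume X: "X \<in> J"
    then obtain a s where *: "a \<in> C" "s \<in> C - p" "X = fr a s" using J.Icarr Lp_cases by metis
    have "fr s 1 \<otimes>\<^bsub>Lp\<^esub> X \<in> J" using J.I_l_closed[OF X, of "fr s 1"] * fr1 by (simp del: mult_fr)
    moreover have "fr s 1 \<otimes>\<^bsub>Lp\<^esub> X = fr a 1"
      unfolding *(3) mult_fr[OF DiffD1[OF *(2)] denom_one *(1,2)]
      using * by (intro fr_eqI denom_mult denom_one) (simp_all add: mult.commute)
    ultimately have "fr a 1 \<in> Idl\<^bsub>Lp\<^esub> B" using AK * by auto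
    then have "fr 1 s \<otimes>\<^bsub>Lp\<^esub> fr a 1 \<in> Idl\<^bsub>Lp\<^esub> B"
      using K.I_l_closed[of "fr a 1" "fr 1 s"] * by (simp del: mult_fr)
    moreover have "fr 1 s \<otimes>\<^bsub>Lp\<^esub> fr a 1 = X" using * denom_one by simp
    ultimately show "X \<in> Idl\<^bsub>Lp\<^esub> B" by simp
  qed
  then show "\<exists>B\<subseteq>carrier Lp. finite B \<and> J = Idl\<^bsub>Lp\<^esub> B"
    using sub BL A(2) by (intro exI[of _ B]) (auto simp: B_def)
qed

section \<open>Dimension and regularity of the localization\<close>

lemma krull_dim_ge:
  assumes "\<And>i. i \<le> k \<Longrightarrow> primeideal (P i) R" "\<And>i. i < k \<Longrightarrow> P i \<subset> P (Suc i)"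
  shows "enat k \<le> krull_dim R"
  unfolding krull_dim_def using assms by (intro Sup_upper) blast

text \<open>The zero ideal is prime in a domain, so a prime strictly between \<open>{0}\<close> and
  \<open>p\<close> would give a chain of length 2 in \<open>Lp\<close>. This turns the dimension
  bound into minimality of \<open>p\<close> among the nonzero primes.\<close>

lemma prime_eq_of_krull_dim_le_1:
  assumes "krull_dim Lp \<le> 1" "prime_in C q" "q \<subseteq> p" "q \<noteq> {0}"
  shows "q = p"
proof (rule ccontr)
  assume "q \<noteq> p"
  define P where "P i = (if i = 0 then ext {0} else if i = 1 then ext q else ext p)" for i :: nat
  have 0: "{0} \<subseteq> p" "{0} \<subset> q" using prime_inD(2)[OF prime] prime_inD(2)[OF assms(2)] assms(4) by auto
  have "enat 2 \<le> krull_dim Lp"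
  proof (rule krull_dim_ge[of _ P])
    show "primeideal (P i) Lp" for i
      using primeideal_ext prime_in_zero assms prime 0 by (simp add: P_def)
    fix i :: nat assume "i < 2"
    then consider "i = 0" | "i = 1" by linarith
    then show "P i \<subset> P (Suc i)"
      by cases (use ext_strict_mono prime_in_zero assms prime 0 \<open>q \<noteq> p\<close> in \<open>auto simp: P_def psubset_eq\<close>)
  qed
  then have "enat 2 \<le> 1" using assms(1) order_trans by blast
  then show False by (simp add: one_enat_def)
qed

text \<open>The hypothesis on \<open>g\<close> says that \<open>g\<close> generates the maximal ideal of the localization.\<close>

lemma regular_local_ring_Lp:
  assumes "noetherian_ring (subset_ring C)" "krull_dim Lp \<le> 1"
    and "p \<noteq> {0} \<Longrightarrow> \<exists>g\<in>p. \<forall>f\<in>p. \<exists>s\<in>C - p. \<exists>h\<in>C. s * f = h * g"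
  shows "regular_local_ring Lp"
proof -
  have "\<exists>A \<subseteq> carrier Lp. finite A \<and> enat (card A) = krull_dim Lp \<and> ext p = Idl\<^bsub>Lp\<^esub> A"
  proof (cases "p = {0}")
    case True
    \<comment> \<open>Here \<open>Lp\<close> is the fraction field of \<open>C\<close>: dimension 0,
      maximal ideal zero, and the empty set as the required generating set.\<close>
    have ext0: "ext p = {\<zero>\<^bsub>Lp\<^esub>}"
      using True denom_one fr_zero unfolding ext_def zero_Lp by blast
    have "krull_dim Lp = 0"
    proof -
      have "k = 0" if h: "\<forall>i\<le>k. primeideal (P i) Lp" "\<forall>i<k. P i \<subset> P (Suc i)" for k and P :: "nat \<Rightarrow> _"
      proof (rule ccontr)
        assume "k \<noteq> 0"
        then have P: "primeideal (P 0) Lp" "primeideal (P 1) Lp" "P 0 \<subset> P 1" using h by auto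
        then have "\<zero>\<^bsub>Lp\<^esub> \<in> P 0"
          using additive_subgroup.zero_closed ideal.axioms(1) primeideal.axioms(1) by metis
        moreover have "P 1 \<subseteq> ext p"
          using P(2) Lp.primeideal_one_notin ideal_subset_ext primeideal.axioms(1) by metis
        ultimately show False using P(3) ext0 by auto
      qed
      then have "{enat k | k. \<exists>P :: nat \<Rightarrow> _. (\<forall>i\<le>k. primeideal (P i) Lp) \<and> (\<forall>i<k. P i \<subset> P (Suc i))} \<subseteq> {0}"
        by (auto simp: zero_enat_def)
      then have "krull_dim Lp \<le> Sup {0}" unfolding krull_dim_def by (rule Sup_subset_mono)
      then show ?thesis by simp
    qed
    moreover have "Idl\<^bsub>Lp\<^esub> {} = {\<zero>\<^bsub>Lp\<^esub>}"
    proof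
      show "Idl\<^bsub>Lp\<^esub> {} \<subseteq> {\<zero>\<^bsub>Lp\<^esub>}" by (rule Lp.genideal_minimal[OF Lp.zeroideal]) simp
      show "{\<zero>\<^bsub>Lp\<^esub>} \<subseteq> Idl\<^bsub>Lp\<^esub> {}"
        using Lp.genideal_ideal[of "{}"] additive_subgroup.zero_closed ideal.axioms(1) by blast
    qed
    ultimately show ?thesis using ext0 by (intro exI[of _ "{}"]) (auto simp: zero_enat_def)
  next
    case False
    then obtain g where g: "g \<in> p" "\<And>f. f \<in> p \<Longrightarrow> \<exists>s\<in>C - p. \<exists>h\<in>C. s * f = h * g"
      using assms(3) by blast
    have gC: "g \<in> C" using g prime_inD(1)[OF prime] by auto
    have g1: "fr g 1 \<in> carrier Lp" using gC denom_one by simp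
    \<comment> \<open>The chain from \<open>ext {0}\<close> to \<open>ext p\<close> gives dimension
      at least 1, so with the assumed bound exactly one generator is permitted.\<close>
    have "enat 1 \<le> krull_dim Lp"
    proof (rule krull_dim_ge[of _ "\<lambda>i. if i = 0 then ext {0} else ext p"])
      have 0: "{0} \<subset> p" using prime_inD(2)[OF prime] False by auto
      show "primeideal (if i = 0 then ext {0} else ext p) Lp" for i :: nat
        using primeideal_ext[OF prime_in_zero psubset_imp_subset[OF 0]] primeideal_ext[OF prime subset_refl] by simp
      show "(if i = 0 then ext {0} else ext p) \<subset> (if Suc i = 0 then ext {0} else ext p)"
        if "i < 1" for i
        using that ext_strict_mono[OF prime_in_zero psubset_imp_subset[OF 0] prime subset_refl 0] by simp
    qed
    then have "krull_dim Lp = 1" using assms(2) by (simp add: one_enat_def)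
    moreover have "ext p = Idl\<^bsub>Lp\<^esub> {fr g 1}"
    proof
      show "Idl\<^bsub>Lp\<^esub> {fr g 1} \<subseteq> ext p"
        using ideal_ext prime fr_in_ext[OF g(1) denom_one]
        by (intro Lp.genideal_minimal) (simp_all add: prime_in_def)
      interpret K: ideal "Idl\<^bsub>Lp\<^esub> {fr g 1}" Lp using g1 by (intro Lp.genideal_ideal) simp
      show "ext p \<subseteq> Idl\<^bsub>Lp\<^esub> {fr g 1}"
      proof
        fix X assume "X \<in> ext p"
        then obtain f t where *: "f \<in> p" "t \<in> C - p" "X = fr f t" by (auto simp: ext_def)
        obtain s h where sh: "s \<in> C - p" "h \<in> C" "s * f = h * g" using g(2) *(1) by blast
        have fC: "f \<in> C" using * prime_inD(1)[OF prime] by auto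
        have st: "s * t \<in> C - p" using denom_mult sh * by simp
        \<comment> \<open>The equation \<open>s * f = h * g\<close> says that f / t is h / (s t)
          times g / 1, which puts \<open>X\<close> into the ideal of \<open>fr g 1\<close>.\<close>
        have "fr h (s * t) \<otimes>\<^bsub>Lp\<^esub> fr g 1 \<in> Idl\<^bsub>Lp\<^esub> {fr g 1}"
          using K.I_l_closed[of "fr g 1" "fr h (s * t)"] Lp.genideal_self'[OF g1] sh st by (simp del: mult_fr)
        moreover have "fr h (s * t) \<otimes>\<^bsub>Lp\<^esub> fr g 1 = X"
        proof -
          have "fr h (s * t) \<otimes>\<^bsub>Lp\<^esub> fr g 1 = fr (h * g) (s * t)" using sh st gC denom_one by simp
          also have "\<dots> = fr f t"
            using sh st gC fC * by (intro fr_eqI) (simp_all add: ac_simps flip: sh(3))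
          finally show ?thesis using * by simp
        qed
        ultimately show "X \<in> Idl\<^bsub>Lp\<^esub> {fr g 1}" by simp
      qed
    qed
    ultimately show ?thesis using g1 by (intro exI[of _ "{fr g 1}"]) (auto simp: one_enat_def)
  qed
  then show ?thesis
    unfolding regular_local_ring_def
    using cring_Lp noetherian_Lp[OF assms(1)] maximalideal_ext maximalideal_unique by blast
qed

end

text \<open>Reduces (R1) to a question inside \<open>C\<close>. The zero prime needs no generator,
  and a prime whose localization has dimension at most 1 has no other nonzero prime below
  it.\<close>

theorem serre_R1_subset_ringI:
  fixes C :: "'a::idom set"
  assumes "subring_set C" "noetherian_ring (subset_ring C)"
    and "\<And>p. prime_in C p \<Longrightarrow> p \<noteq> {0} \<Longrightarrow> (\<And>q. prime_in C q \<Longrightarrow> q \<subseteq> p \<Longrightarrow> q \<noteq> {0} \<Longrightarrow> q = p) \<Longrightarrow>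
      \<exists>g\<in>p. \<forall>f\<in>p. \<exists>s\<in>C - p. \<exists>h\<in>C. s * f = h * g"
  shows "serre_R1 (subset_ring C)"
  unfolding serre_R1_def
proof (intro conjI allI impI)
  interpret subring_set C by fact
  show "cring (subset_ring C)" by (rule cring_subset_ring)
  show "noetherian_ring (subset_ring C)" by fact
  fix p assume p: "primeideal p (subset_ring C)" and dim: "krull_dim (localization_at (subset_ring C) p) \<le> 1"
  interpret subdomain_prime C p
    by unfold_locales (use p primeideal_iff in blast)
  show "regular_local_ring (localization_at (subset_ring C) p)"
    using regular_local_ring_Lp[OF assms(2) dim] assms(3)[OF prime] prime_eq_of_krull_dim_le_1[OF dim]
    by blast
qed

section \<open>Finitely generated semigroup algebras are Noetherian\<close>

text \<open>Inductive, in contrast to \<open>Idl\<close>, so that membership unfolds to an explicit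
  linear combination.\<close>

inductive_set gen_ideal :: "'a::comm_ring_1 set \<Rightarrow> 'a set \<Rightarrow> 'a set"
  for C :: "'a set" and A :: "'a set" where
  zero: "0 \<in> gen_ideal C A"
| mult_add: "r \<in> C \<Longrightarrow> a \<in> A \<Longrightarrow> x \<in> gen_ideal C A \<Longrightarrow> r * a + x \<in> gen_ideal C A"

definition noetherian_set :: "'a::comm_ring_1 set \<Rightarrow> bool" where
  "noetherian_set C \<longleftrightarrow> (\<forall>I. ideal_in C I \<longrightarrow> (\<exists>B. finite B \<and> B \<subseteq> I \<and> I \<subseteq> gen_ideal C B))"

lemma gen_ideal_add: "x \<in> gen_ideal C A \<Longrightarrow> y \<in> gen_ideal C A \<Longrightarrow> x + y \<in> gen_ideal C A"
  by (induction rule: gen_ideal.induct) (auto intro: gen_ideal.intros simp: add.assoc)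

lemma gen_ideal_mono: "A \<subseteq> B \<Longrightarrow> x \<in> gen_ideal C A \<Longrightarrow> x \<in> gen_ideal C B"
  by (rotate_tac 1, induction rule: gen_ideal.induct) (auto intro: gen_ideal.intros)

lemma gen_ideal_finite_subset:
  "x \<in> gen_ideal C A \<Longrightarrow> \<exists>B. finite B \<and> B \<subseteq> A \<and> x \<in> gen_ideal C B"
proof (induction rule: gen_ideal.induct)
  case (mult_add r a x)
  then obtain B where "finite B" "B \<subseteq> A" "x \<in> gen_ideal C B" by blast
  then show ?case using mult_add.hyps gen_ideal_mono[of B "insert a B"]
    by (intro exI[of _ "insert a B"]) (auto intro: gen_ideal.intros)
qed (auto intro: gen_ideal.intros)

lemma gen_ideal_subset:
  assumes "ideal_in C I" "A \<subseteq> I" "x \<in> gen_ideal C A"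
  shows "x \<in> I"
  using assms(3) by induction (use assms ideal_inD[OF assms(1)] in auto)

lemma gen_ideal_imageD:
  assumes "x \<in> gen_ideal C (f ` {..<n::nat})" "0 \<in> C" "\<And>x y. x \<in> C \<Longrightarrow> y \<in> C \<Longrightarrow> x + y \<in> C"
  shows "\<exists>c. (\<forall>i<n. c i \<in> C) \<and> x = (\<Sum>i<n. c i * f i)"
  using assms(1)
proof induction
  case zero
  show ?case using assms by (intro exI[of _ "\<lambda>_. 0"]) simp
next
  case (mult_add r a x)
  then obtain c j where c: "\<forall>i<n. c i \<in> C" "x = (\<Sum>i<n. c i * f i)" and j: "j < n" "a = f j" by auto
  have "r * a + x = (\<Sum>i<n. ((if i = j then r else 0) + c i) * f i)"
    using j by (simp add: c(2) distrib_right sum.distrib if_distrib[of "\<lambda>y. y * _"] sum.delta cong: if_cong)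
  then show ?case
    using c mult_add.hyps assms(2,3) by (intro exI[of _ "\<lambda>i. (if i = j then r else 0) + c i"]) auto
qed

context subring_set
begin

lemma gen_ideal_mult: "x \<in> gen_ideal C A \<Longrightarrow> r \<in> C \<Longrightarrow> r * x \<in> gen_ideal C A"
  by (induction rule: gen_ideal.induct)
    (auto intro: gen_ideal.intros simp: distrib_left mult.assoc[symmetric])

lemma gen_ideal_base: "a \<in> A \<Longrightarrow> a \<in> gen_ideal C A"
  using gen_ideal.mult_add[OF one_mem _ gen_ideal.zero] by fastforce

lemma ideal_in_gen_ideal:
  assumes "A \<subseteq> C"
  shows "ideal_in C (gen_ideal C A)"
proof -
  have "x \<in> C" if "x \<in> gen_ideal C A" for x
    using that by induction (use assms in auto)
  then show ?thesis
    unfolding ideal_in_def by (auto intro: gen_ideal.intros gen_ideal_add gen_ideal_mult)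
qed

lemma noetherian_ring_subset_ring:
  assumes "noetherian_set C"
  shows "noetherian_ring (subset_ring C)"
proof -
  interpret R: cring "subset_ring C" by (rule cring_subset_ring)
  show ?thesis
  proof (rule R.noetherian_ringI)
    fix I assume "ideal I (subset_ring C)"
    then have I: "ideal_in C I" by (simp add: ideal_iff)
    then obtain B where B: "finite B" "B \<subseteq> I" "I \<subseteq> gen_ideal C B"
      using assms by (auto simp: noetherian_set_def)
    have BC: "B \<subseteq> C" using B ideal_inD(1)[OF I] by auto
    have "ideal_in C (Idl\<^bsub>subset_ring C\<^esub> B)" "B \<subseteq> Idl\<^bsub>subset_ring C\<^esub> B"
      using R.genideal_ideal[of B] R.genideal_self[of B] BC by (simp_all add: ideal_iff)
    then have "gen_ideal C B \<subseteq> Idl\<^bsub>subset_ring C\<^esub> B" using gen_ideal_subset by blast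
    moreover have "Idl\<^bsub>subset_ring C\<^esub> B \<subseteq> I"
      using B(2) I by (intro R.genideal_minimal) (simp_all add: ideal_iff)
    ultimately show "\<exists>B\<subseteq>carrier (subset_ring C). finite B \<and> I = Idl\<^bsub>subset_ring C\<^esub> B"
      using B BC by (intro exI[of _ B]) auto
  qed
qed

text \<open>The ascending chain condition in the form needed for leading coefficients: finitely many
  terms generate the ideal of all terms, and the first term after all of these is a combination of
  its predecessors.\<close>

lemma noetherian_set_sequence:
  fixes f :: "nat \<Rightarrow> 'a"
  assumes "noetherian_set C" "\<And>i. f i \<in> C"
  obtains n c where "\<And>i. i < n \<Longrightarrow> c i \<in> C" "f n = (\<Sum>i<n. c i * f i)"
proof -
  have I: "ideal_in C (gen_ideal C (range f))"
    using assms(2) by (intro ideal_in_gen_ideal) auto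
  then obtain B where B: "finite B" "B \<subseteq> gen_ideal C (range f)" "gen_ideal C (range f) \<subseteq> gen_ideal C B"
    using assms(1) unfolding noetherian_set_def by blast
  have "\<exists>F. finite F \<and> F \<subseteq> range f \<and> B \<subseteq> gen_ideal C F"
    using B(1,2)
  proof (induction B rule: finite_induct)
    case (insert b B)
    then obtain F F' where F: "finite F" "F \<subseteq> range f" "B \<subseteq> gen_ideal C F"
      "finite F'" "F' \<subseteq> range f" "b \<in> gen_ideal C F'"
      using gen_ideal_finite_subset by (metis insert_subset)
    then show ?case
      using gen_ideal_mono[of F "F \<union> F'"] gen_ideal_mono[of F' "F \<union> F'"]
      by (intro exI[of _ "F \<union> F'"]) auto
  qed auto
  then obtain F where F: "finite F" "F \<subseteq> range f" "B \<subseteq> gen_ideal C F" by blast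
  then obtain N where N: "finite N" "F = f ` N" by (metis finite_subset_image subset_UNIV)
  \<comment> \<open>The extra \<open>0\<close> keeps \<open>Max\<close> meaningful when
    \<open>N\<close> is empty.\<close>
  define n where "n = Suc (Max (insert 0 N))"
  have "F \<subseteq> f ` {..<n}" using N by (auto simp: n_def less_Suc_eq_le)
  then have "B \<subseteq> gen_ideal C (f ` {..<n})" using F(3) gen_ideal_mono by blast
  then have sub: "gen_ideal C B \<subseteq> gen_ideal C (f ` {..<n})"
    using gen_ideal_subset[OF ideal_in_gen_ideal[of "f ` {..<n}"]] assms(2) by blast
  have "f n \<in> gen_ideal C (range f)" by (rule gen_ideal_base) simp
  then have "f n \<in> gen_ideal C (f ` {..<n})" using B(3) sub by blast
  then show ?thesis using gen_ideal_imageD that by (metis add_mem zero_mem)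
qed

end

text \<open>Hilbert's basis theorem for C = S[x], where \<open>x\<close> may satisfy relations over
  \<open>S\<close>. Instead of passing to a quotient of the polynomial ring, the least-degree
  argument is run on polynomials over \<open>S\<close> judged by their values at \<open>x\<close>: a
  polynomial counts as new if its value is outside the ideal generated by the earlier
  values.\<close>

theorem hilbert_basis_adjoin:
  fixes S C :: "'a::comm_ring_1 set"
  assumes "subring_set S" "subring_set C" "S \<subseteq> C" "x \<in> C" "noetherian_set S"
    and poly: "\<And>y. y \<in> C \<Longrightarrow> \<exists>P. (\<forall>i. Polynomial.coeff P i \<in> S) \<and> y = poly P x"
  shows "noetherian_set C"
  unfolding noetherian_set_def
proof (intro allI impI, rule ccontr)
  interpret S: subring_set S by fact
  interpret C: subring_set C by fact
  fix I assume I: "ideal_in C I"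
    and nfg: "\<not> (\<exists>B. finite B \<and> B \<subseteq> I \<and> I \<subseteq> gen_ideal C B)"
  define J where "J = {P. (\<forall>i. Polynomial.coeff P i \<in> S) \<and> poly P x \<in> I}"
  let ?ev = "\<lambda>P. poly P x"
  let ?ok = "\<lambda>A P. P \<in> J \<and> ?ev P \<notin> gen_ideal C (?ev ` A)"
  have "\<exists>P. ?ok A P \<and> (\<forall>Q. ?ok A Q \<longrightarrow> degree P \<le> degree Q)" if A: "finite A" "A \<subseteq> J" for A
  proof -
    have "finite (?ev ` A)" "?ev ` A \<subseteq> I" using A by (auto simp: J_def)
    then obtain y where y: "y \<in> I" "y \<notin> gen_ideal C (?ev ` A)" using nfg by blast
    then have "y \<in> C" using ideal_inD(1)[OF I] by auto
    then obtain P where "?ok A P" using poly y unfolding J_def by blast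
    then show ?thesis using ex_has_least_nat[of "?ok A" P degree] by blast
  qed
  then obtain g where g: "\<And>A. finite A \<Longrightarrow> A \<subseteq> J \<Longrightarrow> ?ok A (g A) \<and> (\<forall>Q. ?ok A Q \<longrightarrow> degree (g A) \<le> degree Q)"
    by metis
  \<comment> \<open>\<open>A n\<close> collects the first \<open>n\<close> choices, and
    \<open>P n\<close> is a polynomial of least degree whose value is not yet generated by
    theirs.\<close>
  define A where "A = rec_nat {} (\<lambda>_ A. insert (g A) A)"
  define P where "P n = g (A n)" for n
  have A_simps: "A 0 = {}" "\<And>n. A (Suc n) = insert (P n) (A n)" by (simp_all add: A_def P_def)
  have A_J: "finite (A n) \<and> A n \<subseteq> J" for n
    by (induction n) (use g in \<open>auto simp: A_simps P_def\<close>)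
  have A_img: "A n = P ` {..<n}" for n
    by (induction n) (auto simp: A_simps lessThan_Suc)
  have ok: "?ok (A n) (P n)" and least: "\<And>Q. ?ok (A n) Q \<Longrightarrow> degree (P n) \<le> degree Q" for n
    using g A_J by (auto simp: P_def)
  have deg: "degree (P i) \<le> degree (P n)" if "i \<le> n" for i n
  proof (rule least)
    have "?ev ` A i \<subseteq> ?ev ` A n" using that unfolding A_img by auto
    then show "?ok (A i) (P n)" using ok[of n] gen_ideal_mono by blast
  qed
  have PJ: "P n \<in> J" for n using ok by blast
  have "lead_coeff (P n) \<in> S" for n using PJ by (simp add: J_def)
  then obtain n c where c: "\<And>i. i < n \<Longrightarrow> c i \<in> S"
    and lc: "lead_coeff (P n) = (\<Sum>i<n. c i * lead_coeff (P i))"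
    using S.noetherian_set_sequence[OF assms(5), of "\<lambda>n. lead_coeff (P n)"] by blast
  define T where "T i = Polynomial.monom (c i) (degree (P n) - degree (P i)) * P i" for i
  \<comment> \<open>The sum has the same top coefficient as \<open>P n\<close>, and its value lies
    in the ideal of the earlier values. So \<open>Q\<close> is as new as \<open>P n\<close> but has
    lost the top coefficient.\<close>
  define Q where "Q = P n - (\<Sum>i<n. T i)"
  have evT: "?ev (T i) = c i * x ^ (degree (P n) - degree (P i)) * ?ev (P i)" for i
    by (simp add: T_def poly_monom)
  have "?ok (A n) Q"
  proof -
    have cC: "c i * x ^ k \<in> C" if "i < n" for i k using c[OF that] assms(3,4) by auto
    have "?ev (P i) \<in> I" for i using PJ by (simp add: J_def)
    then have "(\<Sum>i<n. ?ev (T i)) \<in> I"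
      using cC by (intro ideal_in_sum[OF I]) (auto simp: evT intro!: ideal_inD(4)[OF I])
    then have "?ev Q \<in> I"
      using C.ideal_in_diff[OF I, of "?ev (P n)"] PJ[of n] by (simp add: Q_def poly_sum J_def)
    moreover have "Polynomial.coeff (T i) k \<in> S" if "i < n" for i k
      using PJ[of i] c[OF that] by (auto simp: T_def coeff_monom_mult J_def)
    then have "Polynomial.coeff Q k \<in> S" for k
      using PJ[of n] by (auto simp: Q_def coeff_sum J_def intro!: S.diff_mem S.sum_mem)
    moreover have "?ev Q \<notin> gen_ideal C (?ev ` A n)"
    proof
      assume Qg: "?ev Q \<in> gen_ideal C (?ev ` A n)"
      have "A n \<subseteq> J" using A_J by blast
      then have "?ev ` A n \<subseteq> C" using ideal_inD(1)[OF I] by (auto simp: J_def)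
      then have id: "ideal_in C (gen_ideal C (?ev ` A n))" by (rule C.ideal_in_gen_ideal)
      have "?ev (T i) \<in> gen_ideal C (?ev ` A n)" if "i < n" for i
        unfolding evT using that cC by (intro C.gen_ideal_mult C.gen_ideal_base) (auto simp: A_img)
      then have "(\<Sum>i<n. ?ev (T i)) \<in> gen_ideal C (?ev ` A n)"
        by (intro ideal_in_sum[OF id]) auto
      then have "?ev Q + (\<Sum>i<n. ?ev (T i)) \<in> gen_ideal C (?ev ` A n)"
        by (rule gen_ideal_add[OF Qg])
      then show False using ok[of n] by (simp add: Q_def poly_sum)
    qed
    ultimately show ?thesis by (simp add: J_def)
  qed
  then have "degree (P n) \<le> degree Q" by (rule least)
  moreover have "degree Q \<le> degree (P n)"
  proof -
    have "degree (T i) \<le> degree (P n)" if "i < n" for i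
    proof -
      have "degree (T i) \<le> degree (Polynomial.monom (c i) (degree (P n) - degree (P i))) + degree (P i)"
        unfolding T_def by (rule degree_mult_le)
      also have "\<dots> \<le> degree (P n)"
        using degree_monom_le[of "c i" "degree (P n) - degree (P i)"] deg[of i n] that by linarith
      finally show ?thesis .
    qed
    then show ?thesis unfolding Q_def by (intro degree_diff_le degree_sum_le) auto
  qed
  moreover have "Polynomial.coeff Q (degree (P n)) = 0"
  proof -
    have "Polynomial.coeff (T i) (degree (P n)) = c i * lead_coeff (P i)" if "i < n" for i
      using deg[of i n] that by (simp add: T_def coeff_monom_mult)
    then show ?thesis by (simp add: Q_def coeff_sum lc)
  qed
  \<comment> \<open>\<open>Q\<close> has the degree of \<open>P n\<close> and its coefficient there
    vanishes, so it is zero, and its value lies in every ideal. This also covers a constant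
    \<open>P n\<close>, below which there is no smaller degree.\<close>
  ultimately have "Q = 0" by (metis le_antisym leading_coeff_0_iff)
  then show False using \<open>?ok (A n) Q\<close> gen_ideal.zero by auto
qed

section \<open>Monoid algebras and their generators\<close>

lemma sum_single_lookup:
  fixes f :: "'m \<Rightarrow>\<^sub>0 'k::comm_monoid_add"
  shows "(\<Sum>a\<in>Poly_Mapping.keys f. Poly_Mapping.single a (Poly_Mapping.lookup f a)) = f"
proof (rule poly_mapping_eqI)
  fix k
  show "Poly_Mapping.lookup (\<Sum>a\<in>Poly_Mapping.keys f. Poly_Mapping.single a (Poly_Mapping.lookup f a)) k
      = Poly_Mapping.lookup f k"
    by (simp add: lookup_sum lookup_single when_def in_keys_iff)
qed

lemma generated_submonoid_base: "a \<in> A \<Longrightarrow> a \<in> generated_submonoid A"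
  using generated_submonoid.add_generator[OF _ generated_submonoid.zero] by fastforce

lemma generated_submonoid_add:
  "a \<in> generated_submonoid A \<Longrightarrow> b \<in> generated_submonoid A \<Longrightarrow> a + b \<in> generated_submonoid A"
  by (induction rule: generated_submonoid.induct)
    (auto intro: generated_submonoid.intros simp: add.assoc)

lemma generated_submonoid_mono:
  "A \<subseteq> B \<Longrightarrow> a \<in> generated_submonoid A \<Longrightarrow> a \<in> generated_submonoid B"
  by (rotate_tac 1, induction rule: generated_submonoid.induct)
    (auto intro: generated_submonoid.intros)

text \<open>The \<open>k\<close>-fold multiple of \<open>a\<close> is written as a constant sum,
  which makes sense in any commutative monoid. Multiples of exponents are written in the same way
  later.\<close>

lemma generated_submonoid_insertD:
  assumes "m \<in> generated_submonoid (insert a A)"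
  shows "\<exists>b k. b \<in> generated_submonoid A \<and> m = b + (\<Sum>i<k::nat. a)"
  using assms
proof induction
  case zero
  show ?case by (intro exI[of _ 0] exI[of _ "0::nat"]) (auto intro: generated_submonoid.zero)
next
  case (add_generator c m)
  then obtain b k where b: "b \<in> generated_submonoid A" "m = b + (\<Sum>i<k::nat. a)" by blast
  show ?case
  proof (cases "c = a")
    case True
    then show ?thesis using b by (intro exI[of _ b] exI[of _ "Suc k"]) (simp add: algebra_simps)
  next
    case False
    then show ?thesis
      using b add_generator.hyps
      by (intro exI[of _ "c + b"] exI[of _ k]) (auto intro: generated_submonoid.intros simp: add.assoc)
  qed
qed

lemma single_sum_eq_power:
  "Poly_Mapping.single (\<Sum>i<k::nat. a) (1::'k::comm_ring_1) = Poly_Mapping.single (a::'m::comm_monoid_add) 1 ^ k"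
proof (induction k)
  case (Suc k)
  have "Poly_Mapping.single (\<Sum>i<Suc k. a) (1::'k)
      = Poly_Mapping.single a 1 * Poly_Mapping.single (\<Sum>i<k. a) 1"
    by (simp add: mult_single add.commute)
  then show ?case using Suc by simp
qed simp

abbreviation monoid_algebra :: "'m::comm_monoid_add set \<Rightarrow> ('m \<Rightarrow>\<^sub>0 'k::field) set" where
  "monoid_algebra M \<equiv> {f. Poly_Mapping.keys f \<subseteq> M}"

lemma semigroup_algebra_eq_subset_ring: "semigroup_algebra M = subset_ring (monoid_algebra M)"
  by (simp add: semigroup_algebra_def subset_ring_def)

lemma subring_set_monoid_algebra:
  assumes "0 \<in> M" "\<And>a b. a \<in> M \<Longrightarrow> b \<in> M \<Longrightarrow> a + b \<in> M"
  shows "subring_set (monoid_algebra M)"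
proof
  show "1 \<in> monoid_algebra M" using assms(1) by simp
  fix f g :: "'a \<Rightarrow>\<^sub>0 'b" assume fg: "f \<in> monoid_algebra M" "g \<in> monoid_algebra M"
  then show "f + g \<in> monoid_algebra M" using keys_add[of f g] by auto
  show "f * g \<in> monoid_algebra M" using fg keys_mult[of f g] assms(2) by fastforce
  show "- f \<in> monoid_algebra M" using fg by (auto simp: in_keys_iff subset_iff)
qed

text \<open>Induction on the generators: over \<open>{}\<close> the algebra is the field, where any
  nonzero element generates, and a new generator \<open>a\<close> adjoins the single monomial with
  exponent \<open>a\<close>, so Hilbert's theorem applies.\<close>

lemma noetherian_set_monoid_algebra:
  assumes "finite A"
  shows "noetherian_set (monoid_algebra (generated_submonoid A) :: ('m::comm_monoid_add \<Rightarrow>\<^sub>0 'k::field) set)"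
  using assms
proof (induction A rule: finite_induct)
  case empty
  have "m = 0" if "m \<in> generated_submonoid {}" for m :: 'm
    using that by induction auto
  then have gen: "generated_submonoid {} = {0::'m}" by (auto intro: generated_submonoid.zero)
  show ?case
    unfolding gen noetherian_set_def
  proof (intro allI impI)
    fix I :: "('m \<Rightarrow>\<^sub>0 'k) set" assume I: "ideal_in (monoid_algebra {0}) I"
    interpret R: subring_set "monoid_algebra {0} :: ('m \<Rightarrow>\<^sub>0 'k) set"
      by (rule subring_set_monoid_algebra) auto
    have const: "\<exists>c. f = Poly_Mapping.single 0 c" if "f \<in> I" for f
    proof
      show "f = Poly_Mapping.single 0 (Poly_Mapping.lookup f 0)"
        using that ideal_inD(1)[OF I]
        by (intro poly_mapping_eqI) (auto simp: lookup_single when_def in_keys_iff subset_iff)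
    qed
    show "\<exists>B. finite B \<and> B \<subseteq> I \<and> I \<subseteq> gen_ideal (monoid_algebra {0}) B"
    proof (cases "I \<subseteq> {0}")
      case True
      then show ?thesis by (intro exI[of _ "{}"]) (auto intro: gen_ideal.zero)
    next
      case False
      then obtain u c where u: "u \<in> I" "u = Poly_Mapping.single 0 c" "c \<noteq> 0"
        using const by (metis insertI1 single_zero subsetI)
      have "f \<in> gen_ideal (monoid_algebra {0}) {u}" if f: "f \<in> I" for f
      proof -
        obtain e where e: "f = Poly_Mapping.single 0 e" using const[OF f] by blast
        have "Poly_Mapping.single 0 (e / c) * u \<in> gen_ideal (monoid_algebra {0}) {u}"
          by (intro R.gen_ideal_mult R.gen_ideal_base) auto
        moreover have "Poly_Mapping.single 0 (e / c) * u = f" using u e by (simp add: mult_single)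
        ultimately show ?thesis by simp
      qed
      then show ?thesis using u by (intro exI[of _ "{u}"]) auto
    qed
  qed
next
  case (insert a A)
  let ?x = "Poly_Mapping.single a 1 :: 'm \<Rightarrow>\<^sub>0 'k"
  let ?S = "monoid_algebra (generated_submonoid A) :: ('m \<Rightarrow>\<^sub>0 'k) set"
  let ?C = "monoid_algebra (generated_submonoid (insert a A)) :: ('m \<Rightarrow>\<^sub>0 'k) set"
  interpret S: subring_set ?S
    by (rule subring_set_monoid_algebra) (auto intro: generated_submonoid.zero generated_submonoid_add)
  show ?case
  proof (rule hilbert_basis_adjoin[of ?S ?C ?x])
    show "subring_set ?S" ..
    show "subring_set ?C"
      by (rule subring_set_monoid_algebra) (auto intro: generated_submonoid.zero generated_submonoid_add)
    show "?S \<subseteq> ?C" using generated_submonoid_mono[of A "insert a A"] by auto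
    show "?x \<in> ?C" by (auto intro: generated_submonoid_base)
    show "noetherian_set ?S" by fact
    fix f assume f: "f \<in> ?C"
    have "\<exists>P. (\<forall>i. Polynomial.coeff P i \<in> ?S) \<and> Poly_Mapping.single m c = poly P ?x"
      if m: "m \<in> Poly_Mapping.keys f" for m and c :: 'k
    proof -
      obtain b k where b: "b \<in> generated_submonoid A" "m = b + (\<Sum>i<k::nat. a)"
        using generated_submonoid_insertD f m by blast
      have "Poly_Mapping.single m c = Poly_Mapping.single b c * ?x ^ k"
        unfolding single_sum_eq_power[symmetric] by (simp add: mult_single b)
      then show ?thesis
        using b by (intro exI[of _ "Polynomial.monom (Poly_Mapping.single b c) k"]) (auto simp: poly_monom)
    qed
    then obtain P where P: "\<And>m c. m \<in> Poly_Mapping.keys f \<Longrightarrow> (\<forall>i. Polynomial.coeff (P m c) i \<in> ?S)"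
      "\<And>m c. m \<in> Poly_Mapping.keys f \<Longrightarrow> Poly_Mapping.single m c = poly (P m c) ?x"
      by metis
    have "f = poly (\<Sum>m\<in>Poly_Mapping.keys f. P m (Poly_Mapping.lookup f m)) ?x"
      by (subst sum_single_lookup[of f, symmetric]) (simp add: poly_sum P(2))
    moreover have "Polynomial.coeff (\<Sum>m\<in>Poly_Mapping.keys f. P m (Poly_Mapping.lookup f m)) i \<in> ?S" for i
      unfolding coeff_sum by (rule S.sum_mem) (use P(1) in blast)
    ultimately show "\<exists>P. (\<forall>i. Polynomial.coeff P i \<in> ?S) \<and> f = poly P ?x" by blast
  qed
qed

section \<open>Gradings of semigroup algebras\<close>

definition restrict_keys :: "'m set \<Rightarrow> ('m \<Rightarrow>\<^sub>0 'k::comm_monoid_add) \<Rightarrow> ('m \<Rightarrow>\<^sub>0 'k)" where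
  "restrict_keys A f = (\<Sum>a\<in>Poly_Mapping.keys f \<inter> A. Poly_Mapping.single a (Poly_Mapping.lookup f a))"

lemma lookup_restrict_keys:
  "Poly_Mapping.lookup (restrict_keys A f) a = (if a \<in> A then Poly_Mapping.lookup f a else 0)"
  by (simp add: restrict_keys_def lookup_sum lookup_single when_def in_keys_iff)

lemma keys_restrict_keys [simp]: "Poly_Mapping.keys (restrict_keys A f) = Poly_Mapping.keys f \<inter> A"
  by (auto simp: in_keys_iff lookup_restrict_keys split: if_splits)

lemma restrict_keys_zero [simp]: "restrict_keys A 0 = 0"
  by (simp add: restrict_keys_def)

lemma restrict_keys_add: "restrict_keys A (f + g) = restrict_keys A f + restrict_keys A g"
  by (intro poly_mapping_eqI) (simp add: lookup_restrict_keys lookup_add)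

lemma restrict_keys_sum: "restrict_keys A (\<Sum>i\<in>I. f i) = (\<Sum>i\<in>I. restrict_keys A (f i))"
  by (induction I rule: infinite_finite_induct) (auto simp: restrict_keys_add)

lemma restrict_keys_restrict_keys: "restrict_keys A (restrict_keys B f) = restrict_keys (A \<inter> B) f"
  by (intro poly_mapping_eqI) (simp add: lookup_restrict_keys)

lemma restrict_keys_id: "Poly_Mapping.keys f \<subseteq> A \<Longrightarrow> restrict_keys A f = f"
  by (intro poly_mapping_eqI) (auto simp: lookup_restrict_keys in_keys_iff subset_iff)

lemma restrict_keys_disjoint: "Poly_Mapping.keys f \<inter> A = {} \<Longrightarrow> restrict_keys A f = 0"
  by (simp add: restrict_keys_def)

lemma restrict_keys_split: "f = restrict_keys A f + restrict_keys (- A) f"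
  by (intro poly_mapping_eqI) (simp add: lookup_restrict_keys lookup_add)

locale graded_monoid_algebra =
  fixes M :: "'m::{ordered_cancel_comm_monoid_add, linorder} set"
    and \<sigma> :: "'m \<Rightarrow> int"
    and C :: "('m \<Rightarrow>\<^sub>0 'k::field) set"
  assumes zero_M: "0 \<in> M" and add_M: "\<And>a b. a \<in> M \<Longrightarrow> b \<in> M \<Longrightarrow> a + b \<in> M"
    and \<sigma>_add: "\<And>a b. \<sigma> (a + b) = \<sigma> a + \<sigma> b"
    and C_def: "C = monoid_algebra M"
begin

sublocale subring_set C
  unfolding C_def using zero_M add_M by (rule subring_set_monoid_algebra)

definition comp :: "int \<Rightarrow> ('m \<Rightarrow>\<^sub>0 'k) \<Rightarrow> ('m \<Rightarrow>\<^sub>0 'k)" where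
  "comp i f = restrict_keys {a. \<sigma> a = i} f"

lemma restrict_keys_mem [simp]: "f \<in> C \<Longrightarrow> restrict_keys A f \<in> C"
  by (auto simp: C_def)

lemma comp_mem [simp]: "f \<in> C \<Longrightarrow> comp i f \<in> C"
  by (simp add: comp_def)

lemma comp_add: "comp i (f + g) = comp i f + comp i g"
  by (simp add: comp_def restrict_keys_add)

lemma comp_sum: "comp i (\<Sum>j\<in>J. f j) = (\<Sum>j\<in>J. comp i (f j))"
  by (simp add: comp_def restrict_keys_sum)

lemma sum_comp: 
  assumes "finite I" "\<sigma> ` Poly_Mapping.keys f \<subseteq> I"
  shows "f = (\<Sum>i\<in>I. comp i f)"
  by (rule poly_mapping_eqI)
    (use assms in \<open>auto simp: lookup_sum comp_def lookup_restrict_keys not_in_keys_iff_lookup_eq_zero[symmetric]\<close>)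

text \<open>The remaining parts of \<open>f\<close> and \<open>g\<close> have degrees strictly below
  \<open>i\<close> and \<open>j\<close>, so every other product falls below degree
  \<open>i + j\<close>.\<close>

lemma comp_mult_top:
  assumes "\<And>a. a \<in> Poly_Mapping.keys f \<Longrightarrow> \<sigma> a \<le> i" "\<And>a. a \<in> Poly_Mapping.keys g \<Longrightarrow> \<sigma> a \<le> j"
  shows "comp (i + j) (f * g) = comp i f * comp j g"
proof -
  define f' g' where "f' = restrict_keys (- {a. \<sigma> a = i}) f" and "g' = restrict_keys (- {a. \<sigma> a = j}) g"
  have f: "f = comp i f + f'" and g: "g = comp j g + g'"
    unfolding comp_def f'_def g'_def by (rule restrict_keys_split)+
  have kf: "Poly_Mapping.keys (comp i f) \<subseteq> {a. \<sigma> a = i}" "Poly_Mapping.keys f' \<subseteq> {a. \<sigma> a < i}"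
    using assms(1) by (force simp: comp_def f'_def)+
  have kg: "Poly_Mapping.keys (comp j g) \<subseteq> {a. \<sigma> a = j}" "Poly_Mapping.keys g' \<subseteq> {a. \<sigma> a < j}"
    using assms(2) by (force simp: comp_def g'_def)+
  have "comp (i + j) (comp i f * comp j g) = comp i f * comp j g"
    unfolding comp_def[of "i + j"] using kf kg keys_mult[of "comp i f" "comp j g"]
    by (intro restrict_keys_id) (fastforce simp: \<sigma>_add)
  moreover have "comp (i + j) (comp i f * g') = 0"
    unfolding comp_def[of "i + j"] using kf kg keys_mult[of "comp i f" g']
    by (intro restrict_keys_disjoint) (fastforce simp: \<sigma>_add)
  moreover have "comp (i + j) (f' * g) = 0"
    unfolding comp_def[of "i + j"] using kf assms(2) keys_mult[of f' g]
    by (intro restrict_keys_disjoint) (fastforce simp: \<sigma>_add)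
  moreover have "f * g = comp i f * comp j g + comp i f * g' + f' * g"
    by (metis f g distrib_left distrib_right)
  ultimately show ?thesis by (simp add: comp_add)
qed

lemma comp_mult_homogeneous:
  assumes "Poly_Mapping.keys r \<subseteq> {a. \<sigma> a = j}"
  shows "comp i (r * f) = r * comp (i - j) f"
proof -
  define f' where "f' = restrict_keys (- {a. \<sigma> a = i - j}) f"
  have f: "f = comp (i - j) f + f'" unfolding comp_def f'_def by (rule restrict_keys_split)
  have "comp i (r * comp (i - j) f) = r * comp (i - j) f"
    unfolding comp_def[of i] using assms keys_mult[of r "comp (i - j) f"]
    by (intro restrict_keys_id) (fastforce simp: \<sigma>_add comp_def)
  moreover have "comp i (r * f') = 0"
    unfolding comp_def[of i] using assms keys_mult[of r f']
    by (intro restrict_keys_disjoint) (fastforce simp: \<sigma>_add f'_def)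
  ultimately show ?thesis by (subst f) (simp add: distrib_left comp_add)
qed

text \<open>For an ideal \<open>p\<close> this is the largest homogeneous ideal contained in
  \<open>p\<close>.\<close>

definition homogeneous_core :: "('m \<Rightarrow>\<^sub>0 'k) set \<Rightarrow> ('m \<Rightarrow>\<^sub>0 'k) set" where
  "homogeneous_core p = {f \<in> C. \<forall>i. comp i f \<in> p}"

lemma finite_\<sigma>_keys: "finite (\<sigma> ` Poly_Mapping.keys f)"
  by simp

lemma homogeneous_core_subset:
  assumes "ideal_in C p"
  shows "homogeneous_core p \<subseteq> p"
proof
  fix f assume "f \<in> homogeneous_core p"
  then have "(\<Sum>i\<in>\<sigma> ` Poly_Mapping.keys f. comp i f) \<in> p"
    by (intro ideal_in_sum[OF assms]) (auto simp: homogeneous_core_def)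
  then show "f \<in> p" using sum_comp[OF finite_\<sigma>_keys subset_refl] by metis
qed

lemma ideal_in_homogeneous_core:
  assumes p: "ideal_in C p"
  shows "ideal_in C (homogeneous_core p)"
  unfolding ideal_in_def
proof (intro conjI ballI)
  show "0 \<in> homogeneous_core p"
    using ideal_inD[OF p] by (simp add: homogeneous_core_def comp_def)
next
  fix f g assume "f \<in> homogeneous_core p" "g \<in> homogeneous_core p"
  then show "f + g \<in> homogeneous_core p"
    using ideal_inD[OF p] by (simp add: homogeneous_core_def comp_add)
next
  fix r f assume r: "r \<in> C" and f: "f \<in> homogeneous_core p"
  let ?I = "\<sigma> ` Poly_Mapping.keys r"
  have "comp i (r * f) \<in> p" for i
  proof -
    have "r * f = (\<Sum>j\<in>?I. comp j r * f)"
      using sum_comp[OF finite_\<sigma>_keys subset_refl, of r] by (metis sum_distrib_right)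
    then have "comp i (r * f) = (\<Sum>j\<in>?I. comp i (comp j r * f))" by (simp add: comp_sum)
    also have "\<dots> = (\<Sum>j\<in>?I. comp j r * comp (i - j) f)"
      by (intro sum.cong refl comp_mult_homogeneous) (auto simp: comp_def)
    also have "\<dots> \<in> p"
      using r f by (intro ideal_in_sum[OF p] ideal_inD(4)[OF p]) (auto simp: homogeneous_core_def)
    finally show ?thesis .
  qed
  then show "r * f \<in> homogeneous_core p"
    using r f by (simp add: homogeneous_core_def)
qed (auto simp: homogeneous_core_def)

text \<open>Modulo the core one may drop the top components that lie in \<open>p\<close>; the top component of a
  product is then the product of the top components.\<close>

lemma prime_in_homogeneous_core:
  assumes p: "prime_in C p"
  shows "prime_in C (homogeneous_core p)"
proof -
  have ip: "ideal_in C p" using p by (simp add: prime_in_def)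
  note ic = ideal_in_homogeneous_core[OF ip]
  have truncate: "\<exists>i F. F \<in> C \<and> f - F \<in> homogeneous_core p \<and> comp i F \<notin> p
      \<and> (\<forall>a\<in>Poly_Mapping.keys F. \<sigma> a \<le> i)"
    if f: "f \<in> C" "f \<notin> homogeneous_core p" for f
  proof -
    obtain i0 where i0: "comp i0 f \<notin> p" using f by (auto simp: homogeneous_core_def)
    define I where "I = {i \<in> \<sigma> ` Poly_Mapping.keys f. comp i f \<notin> p}"
    have mem_I: "i \<in> I" if "comp i f \<notin> p" for i
    proof -
      have "i \<in> \<sigma> ` Poly_Mapping.keys f"
      proof (rule ccontr)
        assume "i \<notin> \<sigma> ` Poly_Mapping.keys f"
        then have "comp i f = 0" unfolding comp_def by (intro restrict_keys_disjoint) auto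
        then show False using that ideal_inD(2)[OF ip] by simp
      qed
      then show ?thesis using that by (simp add: I_def)
    qed
    have I: "finite I" "I \<noteq> {}" using mem_I[OF i0] by (auto simp: I_def)
    define i where "i = Max I"
    define F where "F = restrict_keys {a. \<sigma> a \<le> i} f"
    have "i \<in> I" using I by (simp add: i_def)
    have "comp i F = comp i f"
      by (simp add: comp_def F_def restrict_keys_restrict_keys Collect_conj_eq[symmetric] cong: conj_cong)
    moreover have "f - F \<in> homogeneous_core p"
    proof -
      have "f - F = restrict_keys (- {a. \<sigma> a \<le> i}) f"
        unfolding F_def by (subst diff_eq_eq) (metis restrict_keys_split add.commute)
      moreover have "comp j (restrict_keys (- {a. \<sigma> a \<le> i}) f) \<in> p" for j
      proof (cases "j \<le> i")
        case True
        then have "{a. \<sigma> a = j} \<inter> - {a. \<sigma> a \<le> i} = {}" by auto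
        then have "comp j (restrict_keys (- {a. \<sigma> a \<le> i}) f) = 0"
          by (simp add: comp_def restrict_keys_restrict_keys restrict_keys_disjoint)
        then show ?thesis using ideal_inD(2)[OF ip] by simp
      next
        case False
        then have "{a. \<sigma> a = j} \<inter> - {a. \<sigma> a \<le> i} = {a. \<sigma> a = j}" by auto
        then have "comp j (restrict_keys (- {a. \<sigma> a \<le> i}) f) = comp j f"
          by (simp add: comp_def restrict_keys_restrict_keys)
        moreover have "comp j f \<in> p" using False mem_I[of j] Max_ge[OF I(1), of j] i_def by auto
        ultimately show ?thesis by simp
      qed
      ultimately show ?thesis using f by (simp add: homogeneous_core_def)
    qed
    ultimately show ?thesis
      using \<open>i \<in> I\<close> f by (intro exI[of _ i] exI[of _ F]) (auto simp: I_def F_def)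
  qed
  have "f \<in> homogeneous_core p \<or> g \<in> homogeneous_core p"
    if fg: "f \<in> C" "g \<in> C" "f * g \<in> homogeneous_core p" for f g
  proof (rule ccontr)
    assume "\<not> ?thesis"
    then obtain i F j G where F: "F \<in> C" "f - F \<in> homogeneous_core p" "comp i F \<notin> p"
        "\<And>a. a \<in> Poly_Mapping.keys F \<Longrightarrow> \<sigma> a \<le> i"
      and G: "G \<in> C" "g - G \<in> homogeneous_core p" "comp j G \<notin> p"
        "\<And>a. a \<in> Poly_Mapping.keys G \<Longrightarrow> \<sigma> a \<le> j"
      using truncate fg by metis
    \<comment> \<open>Modulo the core \<open>F * G\<close> agrees with \<open>f * g\<close> and so
      lies in the core, although its component of degree \<open>i + j\<close> is a product of two
      components outside \<open>p\<close>.\<close>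
    have "F * G = f * g - (g * (f - F) + F * (g - G))" by (simp add: algebra_simps)
    also have "\<dots> \<in> homogeneous_core p"
      by (intro ideal_in_diff[OF ic fg(3)] ideal_inD(3)[OF ic] ideal_inD(4)[OF ic fg(2) F(2)]
          ideal_inD(4)[OF ic F(1) G(2)])
    finally have "comp (i + j) (F * G) \<in> p" by (simp add: homogeneous_core_def)
    then have "comp i F * comp j G \<in> p" using comp_mult_top[OF F(4) G(4)] by simp
    then show False using prime_inD(6)[OF p] F(3) G(3) comp_mem[OF F(1)] comp_mem[OF G(1)] by blast
  qed
  moreover have "1 \<notin> homogeneous_core p"
    using homogeneous_core_subset[OF ip] prime_inD(3)[OF p] by auto
  ultimately show ?thesis using ic by (auto simp: prime_in_def)
qed

text \<open>When degrees are nonnegative, degree 0 is the top degree for \<open>- \<sigma>\<close>,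
  so taking the degree 0 part is multiplicative. The set is the kernel of this map into a domain;
  there are no zero divisors because the exponents are linearly ordered.\<close>

lemma prime_in_positive_part:
  assumes "\<And>a. a \<in> M \<Longrightarrow> 0 \<le> \<sigma> a"
  shows "prime_in C {f \<in> C. \<forall>a\<in>Poly_Mapping.keys f. 0 < \<sigma> a}" (is "prime_in C ?p")
proof -
  interpret neg: graded_monoid_algebra M "\<lambda>a. - \<sigma> a" C
    by unfold_locales (auto simp: zero_M add_M \<sigma>_add C_def)
  have p_iff: "f \<in> ?p \<longleftrightarrow> f \<in> C \<and> neg.comp 0 f = 0" for f
  proof -
    have "neg.comp 0 f = 0 \<longleftrightarrow> Poly_Mapping.keys (neg.comp 0 f) = {}" by simp
    also have "\<dots> \<longleftrightarrow> (\<forall>a\<in>Poly_Mapping.keys f. \<sigma> a \<noteq> 0)" by (auto simp: neg.comp_def)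
    finally show ?thesis using assms by (fastforce simp: C_def)
  qed
  have mult: "neg.comp 0 (f * g) = neg.comp 0 f * neg.comp 0 g" if fg: "f \<in> C" "g \<in> C" for f g
  proof -
    have "- \<sigma> a \<le> 0" if "a \<in> Poly_Mapping.keys f \<or> a \<in> Poly_Mapping.keys g" for a
      using fg assms that by (auto simp: C_def)
    then show ?thesis using neg.comp_mult_top[of f 0 g 0] by simp
  qed
  have "\<sigma> 0 = 0" using \<sigma>_add[of 0 0] by simp
  then have "1 \<notin> ?p" by simp
  moreover have "ideal_in C ?p"
    unfolding ideal_in_def p_iff
  proof (intro conjI ballI)
    fix f g assume "f \<in> ?p" "g \<in> ?p"
    then show "f + g \<in> C" "neg.comp 0 (f + g) = 0" unfolding p_iff by (auto simp: neg.comp_add)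
  next
    fix f g assume "f \<in> C" "g \<in> ?p"
    then show "f * g \<in> C" "neg.comp 0 (f * g) = 0" unfolding p_iff by (auto simp: mult)
  qed (auto simp: neg.comp_def)
  moreover have "\<forall>f\<in>C. \<forall>g\<in>C. f * g \<in> ?p \<longrightarrow> f \<in> ?p \<or> g \<in> ?p"
    unfolding p_iff by (auto simp: mult)
  ultimately show ?thesis by (simp add: prime_in_def)
qed

text \<open>Division with remainder by an element of least width: in each step the top component of
  \<open>f\<close> is cancelled after multiplication by the top component of \<open>g\<close>.\<close>

lemma principal_of_no_homogeneous:
  assumes p: "prime_in C p" "p \<noteq> {0}" and core: "homogeneous_core p = {0}"
  shows "\<exists>g\<in>p. \<forall>f\<in>p. \<exists>s\<in>C - p. \<exists>h\<in>C. s * f = h * g"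
proof -
  have ip: "ideal_in C p" using p by (simp add: prime_in_def)
  have comp_comp: "comp j (comp i f) = (if i = j then comp i f else 0)" for i j f
    by (auto simp: comp_def intro!: restrict_keys_id restrict_keys_disjoint)
  \<comment> \<open>A homogeneous element of \<open>p\<close> lies in the core, which is zero. So
    all nonzero homogeneous elements may serve as denominators.\<close>
  have no_hom: "comp i f \<notin> p" if "f \<in> C" "comp i f \<noteq> 0" for i f
  proof
    assume "comp i f \<in> p"
    then have "comp i f \<in> homogeneous_core p"
      using that ideal_inD(2)[OF ip] by (simp add: homogeneous_core_def comp_comp)
    then show False using core that by simp
  qed
  define top where "top f = Max (\<sigma> ` Poly_Mapping.keys f)" for f :: "'m \<Rightarrow>\<^sub>0 'k"
  define bot where "bot f = Min (\<sigma> ` Poly_Mapping.keys f)" for f :: "'m \<Rightarrow>\<^sub>0 'k"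
  define width where "width f = nat (top f - bot f)" for f :: "'m \<Rightarrow>\<^sub>0 'k"
  have bounds: "bot f \<le> \<sigma> a" "\<sigma> a \<le> top f" if "a \<in> Poly_Mapping.keys f" for f :: "'m \<Rightarrow>\<^sub>0 'k" and a
    using that by (auto simp: top_def bot_def)
  have top_comp: "comp (top f) f \<noteq> 0" if "f \<noteq> 0" for f :: "'m \<Rightarrow>\<^sub>0 'k"
  proof -
    have "top f \<in> \<sigma> ` Poly_Mapping.keys f" unfolding top_def using that by (intro Max_in) auto
    then obtain a where "a \<in> Poly_Mapping.keys f" "\<sigma> a = top f" by auto
    then have "a \<in> Poly_Mapping.keys (comp (top f) f)" by (simp add: comp_def)
    then show ?thesis by auto
  qed
  have ex_top: "\<exists>a\<in>Poly_Mapping.keys f. \<sigma> a = top f" "\<exists>a\<in>Poly_Mapping.keys f. \<sigma> a = bot f"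
    if "f \<noteq> 0" for f :: "'m \<Rightarrow>\<^sub>0 'k"
  proof -
    have "top f \<in> \<sigma> ` Poly_Mapping.keys f" "bot f \<in> \<sigma> ` Poly_Mapping.keys f"
      unfolding top_def bot_def using that by (auto intro!: Max_in Min_in)
    then show "\<exists>a\<in>Poly_Mapping.keys f. \<sigma> a = top f" "\<exists>a\<in>Poly_Mapping.keys f. \<sigma> a = bot f"
      by auto
  qed
  have "\<exists>g. g \<in> p \<and> g \<noteq> 0" using p(2) ideal_inD(2)[OF ip] by auto
  then obtain g where g: "g \<in> p" "g \<noteq> 0" and least: "\<And>f. f \<in> p \<Longrightarrow> f \<noteq> 0 \<Longrightarrow> width g \<le> width f"
    using ex_has_least_nat[of "\<lambda>g. g \<in> p \<and> g \<noteq> 0" _ width] by blast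
  have pC: "f \<in> C" if "f \<in> p" for f using that ideal_inD(1)[OF ip] by auto
  define c where "c = comp (top g) g"
  have c: "c \<in> C - p" using no_hom[of g "top g"] top_comp[OF g(2)] pC[OF g(1)] by (simp add: c_def)
  have "\<exists>s\<in>C - p. \<exists>h\<in>C. s * f = h * g" if "f \<in> p" for f
    using that
  proof (induction "width f" arbitrary: f rule: less_induct)
    case less
    show ?case
    proof (cases "f = 0")
      case True
      then show ?thesis using prime_inD(3)[OF p(1)] by (intro bexI[of _ 1] bexI[of _ 0]) auto
    next
      case False
      define b where "b = comp (top f) f"
      \<comment> \<open>Both products have the component \<open>c * b\<close> in degree
        \<open>top g + top f\<close>, which therefore cancels.\<close>
      define f' where "f' = c * f - b * g"
      have bC: "b \<in> C" using pC[OF less.prems] by (simp add: b_def)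
      have f'p: "f' \<in> p"
        unfolding f'_def using c bC less.prems g(1)
        by (intro ideal_in_diff[OF ip] ideal_inD(4)[OF ip]) auto
      have "\<exists>s\<in>C - p. \<exists>h\<in>C. s * f' = h * g"
      proof (cases "f' = 0")
        case True
        then show ?thesis using prime_inD(3)[OF p(1)] by (intro bexI[of _ 1] bexI[of _ 0]) auto
      next
        case f'0: False
        have kc: "\<sigma> a = top g" if "a \<in> Poly_Mapping.keys c" for a using that by (simp add: c_def comp_def)
        have kb: "\<sigma> a = top f" if "a \<in> Poly_Mapping.keys b" for a using that by (simp add: b_def comp_def)
        have "width g \<le> width f" using least less.prems False by blast
        moreover have "bot f \<le> top f" "bot g \<le> top g"
          using ex_top[OF False] ex_top[OF g(2)] bounds by (metis order_trans)+
        ultimately have wd: "top g - bot g \<le> top f - bot f" by (simp add: width_def)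
        \<comment> \<open>The lower bound for \<open>b * g\<close> is where the choice of
          \<open>g\<close> enters: \<open>top f + bot g\<close> is at least
          \<open>top g + bot f\<close> because \<open>g\<close> is no wider than
          \<open>f\<close>.\<close>
        have range: "top g + bot f \<le> \<sigma> a \<and> \<sigma> a \<le> top g + top f" if "a \<in> Poly_Mapping.keys f'" for a
        proof -
          have "a \<in> Poly_Mapping.keys (c * f) \<or> a \<in> Poly_Mapping.keys (b * g)"
            using that unfolding f'_def in_keys_iff lookup_minus by auto
          then show ?thesis
          proof
            assume "a \<in> Poly_Mapping.keys (c * f)"
            then obtain u v where "u \<in> Poly_Mapping.keys c" "v \<in> Poly_Mapping.keys f" "a = u + v"
              using keys_mult by blast
            then show ?thesis using kc[of u] bounds[of v f] by (simp add: \<sigma>_add)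
          next
            assume "a \<in> Poly_Mapping.keys (b * g)"
            then obtain u v where "u \<in> Poly_Mapping.keys b" "v \<in> Poly_Mapping.keys g" "a = u + v"
              using keys_mult by blast
            then show ?thesis using kb[of u] bounds[of v g] wd by (simp add: \<sigma>_add)
          qed
        qed
        have "comp (top g + top f) f' = 0"
        proof -
          have "Poly_Mapping.keys c \<subseteq> {a. \<sigma> a = top g}" "Poly_Mapping.keys b \<subseteq> {a. \<sigma> a = top f}"
            using kb kc by auto
          from this[THEN comp_mult_homogeneous]
          have "comp (top g + top f) (c * f) = c * b" "comp (top g + top f) (b * g) = b * c"
            by (simp_all add: b_def c_def)
          moreover have "c * f = f' + b * g" by (simp add: f'_def)
          ultimately show ?thesis by (simp add: comp_add mult.commute)
        qed
        \<comment> \<open>Relative to the shift by \<open>top g\<close>, the upper end drops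
          strictly and the lower end does not drop, so \<open>f'\<close> is narrower than
          \<open>f\<close>.\<close>
        then have "top f' \<noteq> top g + top f" using top_comp[OF f'0] by metis
        then have "top f' < top g + top f" "top g + bot f \<le> bot f'"
          using ex_top[OF f'0] range by (metis order_le_imp_less_or_eq)+
        moreover have "bot f' \<le> top f'"
          using ex_top[OF f'0] bounds by (metis)
        ultimately have "width f' < width f" by (simp add: width_def)
        then show ?thesis using less.hyps f'p by blast
      qed
      then obtain s h where sh: "s \<in> C - p" "h \<in> C" "s * f' = h * g" by blast
      have "s * c * f = (h + s * b) * g"
        using sh(3) by (simp add: f'_def algebra_simps)
      moreover have "s * c \<in> C - p" using sh c prime_inD(6)[OF p(1), of s c] by auto
      moreover have "h + s * b \<in> C" using sh bC by simp
      ultimately show ?thesis by blast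
    qed
  qed
  then show ?thesis using g by blast
qed

end

section \<open>Lattice points of simplices on the moment curve\<close>

text \<open>A sequence \<open>w\<close> is viewed as the linear functional \<open>X\<^sup>k \<mapsto> w k\<close> on polynomials.\<close>

definition functional :: "(nat \<Rightarrow> 'a::comm_ring_1) \<Rightarrow> 'a poly \<Rightarrow> 'a" where
  "functional w F = (\<Sum>k\<le>degree F. Polynomial.coeff F k * w k)"

lemma functional_altdef:
  assumes "degree F \<le> N"
  shows "functional w F = (\<Sum>k\<le>N. Polynomial.coeff F k * w k)"
  unfolding functional_def using assms
  by (intro sum.mono_neutral_left) (auto simp: coeff_eq_0)

lemma functional_pCons: "functional w (pCons c F) = c * w 0 + functional (\<lambda>k. w (Suc k)) F"
proof -
  have "functional w (pCons c F) = (\<Sum>k\<le>Suc (degree F). Polynomial.coeff (pCons c F) k * w k)"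
    by (rule functional_altdef) (rule degree_pCons_le)
  also have "\<dots> = c * w 0 + (\<Sum>k\<le>degree F. Polynomial.coeff F k * w (Suc k))"
    by (subst sum.atMost_Suc_shift) simp
  finally show ?thesis by (simp add: functional_def)
qed

lemma functional_diff: "functional w (F - G) = functional w F - functional w G"
proof -
  let ?N = "max (degree F) (degree G)"
  have "degree (F - G) \<le> ?N" by (rule degree_diff_le) auto
  then show ?thesis
    by (simp add: functional_altdef[of _ ?N] left_diff_distrib sum_subtractf)
qed

lemma functional_smult: "functional w (Polynomial.smult c F) = c * functional w F"
  by (simp add: functional_altdef[of _ "degree F"] degree_smult_le sum_distrib_left mult.assoc)

text \<open>Multiplication by X - x is dual to the passage from \<open>w\<close> to
  \<open>w (Suc k) - x * w k\<close>, the operation that \<open>quot_shift\<close> inverts.\<close>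

lemma functional_linear_factor:
  "functional w ([:- x, 1:] * G) = functional (\<lambda>k. w (Suc k) - x * w k) G"
proof -
  have "[:- x, 1:] * G = pCons 0 G - Polynomial.smult x G" by simp
  then have "functional w ([:- x, 1:] * G) = functional (\<lambda>k. w (Suc k)) G - x * functional w G"
    by (simp only: functional_diff functional_smult functional_pCons) simp
  then show ?thesis
    by (simp add: functional_def right_diff_distrib sum_subtractf sum_distrib_left ac_simps)
qed

lemma functional_power: "functional (\<lambda>k. y ^ k) F = poly F y"
  by (simp add: functional_def poly_altdef)

lemma functional_add_left: "functional (\<lambda>k. v k + w k) F = functional v F + functional w F"
  by (simp add: functional_def distrib_left sum.distrib)

lemma functional_mult_left: "functional (\<lambda>k. c * w k) F = c * functional w F"
  by (simp add: functional_def sum_distrib_left ac_simps)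

lemma functional_cong: "(\<And>k. k \<le> degree F \<Longrightarrow> v k = w k) \<Longrightarrow> functional v F = functional w F"
  by (simp add: functional_def)

text \<open>Integral moment sequences of probability weights on \<open>Y\<close>, in all degrees at
  once. The dimension only enters later through \<open>truncated\<close>, so the inductions over the
  nodes are free of it.\<close>

definition simplex_points :: "int set \<Rightarrow> (nat \<Rightarrow> int) set" where
  "simplex_points Y = {w. \<exists>u. (\<forall>y\<in>Y. 0 \<le> u y) \<and> sum u Y = 1 \<and>
     (\<forall>k. real_of_int (w k) = (\<Sum>y\<in>Y. u y * real_of_int y ^ k))}"

text \<open>\<open>quot_shift x w\<close> is the functional \<open>F \<mapsto> w ((F - F(x)) / (X - x))\<close>.\<close>

primrec quot_shift :: "'a::comm_ring_1 \<Rightarrow> (nat \<Rightarrow> 'a) \<Rightarrow> nat \<Rightarrow> 'a" where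
  "quot_shift x w 0 = 0"
| "quot_shift x w (Suc k) = x * quot_shift x w k + w k"

lemma quot_shift_add: "quot_shift x (\<lambda>k. v k + w k) = (\<lambda>k. quot_shift x v k + quot_shift x w k)"
proof
  show "quot_shift x (\<lambda>k. v k + w k) k = quot_shift x v k + quot_shift x w k" for k
    by (induction k) (simp_all add: algebra_simps)
qed

lemma quot_shift_diff: "quot_shift x (\<lambda>k. v k - w k) = (\<lambda>k. quot_shift x v k - quot_shift x w k)"
proof
  show "quot_shift x (\<lambda>k. v k - w k) k = quot_shift x v k - quot_shift x w k" for k
    by (induction k) (simp_all add: right_diff_distrib)
qed

lemma quot_shift_zero: "quot_shift x (\<lambda>k. 0) = (\<lambda>k. 0)"
proof
  show "quot_shift x (\<lambda>k. 0) k = 0" for k by (induction k) simp_all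
qed

lemma simplex_points_vertex:
  assumes "finite Y" "x \<in> Y"
  shows "(\<lambda>k. x ^ k) \<in> simplex_points Y"
  unfolding simplex_points_def using assms
  by (auto intro!: exI[of _ "\<lambda>y. if y = x then 1 else 0"] simp: if_distrib[of "\<lambda>u. u * _"] sum.delta cong: if_cong)

text \<open>As \<open>x\<close> lies to one side of \<open>Y\<close> at integral distance, the weights of \<open>Y\<close> divided by
  \<open>\<bar>y - x\<bar>\<close> are nonnegative and sum to at most \<open>1\<close>; the rest of the weight goes to \<open>x\<close>.\<close>

lemma simplex_points_insert:
  assumes Y: "finite Y" and w: "w \<in> simplex_points Y"
    and e: "e = 1 \<or> e = - 1" "\<And>y. y \<in> Y \<Longrightarrow> 0 < e * (y - x)"
  shows "(\<lambda>k. x ^ k + e * quot_shift x w k) \<in> simplex_points (insert x Y)"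
proof -
  obtain u where u: "\<And>y. y \<in> Y \<Longrightarrow> 0 \<le> u y" "sum u Y = 1"
    "\<And>k. real_of_int (w k) = (\<Sum>y\<in>Y. u y * real_of_int y ^ k)"
    using w unfolding simplex_points_def by blast
  have x: "x \<notin> Y" using e(2)[of x] by auto
  have ne: "real_of_int y - real_of_int x \<noteq> 0" if "y \<in> Y" for y using that x by auto
  \<comment> \<open>\<open>quot_shift\<close> turns the powers of \<open>y\<close> into difference
    quotients against \<open>x\<close>; linearity extends this to weighted sums.\<close>
  have qs: "real_of_int (quot_shift x w k)
      = (\<Sum>y\<in>Y. u y * ((real_of_int y ^ k - real_of_int x ^ k) / (real_of_int y - real_of_int x)))" for k
  proof (induction k)
    case (Suc k)
    have "real_of_int (quot_shift x w (Suc k))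
        = (\<Sum>y\<in>Y. real_of_int x * (u y * ((real_of_int y ^ k - real_of_int x ^ k) / (real_of_int y - real_of_int x)))
            + u y * real_of_int y ^ k)"
      by (simp add: Suc u(3) sum.distrib sum_distrib_left)
    also have "\<dots> = (\<Sum>y\<in>Y. u y * ((real_of_int y ^ Suc k - real_of_int x ^ Suc k) / (real_of_int y - real_of_int x)))"
      by (intro sum.cong refl) (use ne in \<open>simp add: field_simps\<close>)
    finally show ?case .
  qed simp
  define c where "c y = real_of_int e / (real_of_int y - real_of_int x)" for y
  have c: "0 \<le> c y" "c y \<le> 1" if "y \<in> Y" for y
  proof -
    have "0 < e * (y - x)" using e(2) that by blast
    then consider "e = 1" "y - x \<ge> 1" | "e = - 1" "x - y \<ge> 1" using e(1) by auto
    then have "0 \<le> c y \<and> c y \<le> 1"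
    proof cases
      case 1
      then have "real_of_int y - real_of_int x \<ge> 1" by linarith
      then show ?thesis using 1 by (simp add: c_def field_simps)
    next
      case 2
      then have "real_of_int x - real_of_int y \<ge> 1" by linarith
      moreover have "c y = 1 / (real_of_int x - real_of_int y)"
        using 2 by (simp add: c_def field_simps)
      ultimately show ?thesis by (simp only: zero_le_divide_1_iff) (simp add: divide_le_eq_1)
    qed
    then show "0 \<le> c y" "c y \<le> 1" by auto
  qed
  define u' where "u' y = (if y = x then 1 - (\<Sum>y\<in>Y. u y * c y) else u y * c y)" for y
  have sumu': "(\<Sum>y\<in>insert x Y. u' y * f y) = (1 - (\<Sum>y\<in>Y. u y * c y)) * f x + (\<Sum>y\<in>Y. u y * c y * f y)"
    for f :: "int \<Rightarrow> real"
    using Y x by (subst sum.insert) (auto simp: u'_def intro!: sum.cong)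
  have "(\<Sum>y\<in>Y. u y * c y) \<le> (\<Sum>y\<in>Y. u y)"
    using u(1) c by (intro sum_mono) (simp add: mult_left_le)
  then have "\<forall>y\<in>insert x Y. 0 \<le> u' y" using u c by (auto simp: u'_def)
  moreover have "sum u' (insert x Y) = 1" using sumu'[of "\<lambda>_. 1"] by simp
  moreover have "real_of_int (x ^ k + e * quot_shift x w k) = (\<Sum>y\<in>insert x Y. u' y * real_of_int y ^ k)" for k
    unfolding sumu' by (simp add: qs c_def sum_distrib_left sum_distrib_right left_diff_distrib
        diff_divide_distrib right_diff_distrib sum_subtractf ac_simps)
  ultimately show ?thesis unfolding simplex_points_def by blast
qed

text \<open>The nodes of \<open>S\<close> are inserted one after another, starting from the vertex
  at \<open>r\<close>. An inserted node \<open>x\<close> absorbs its own linear factor and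
  multiplies the value by \<open>e\<close>, so the value stays 1 up to sign. For a facet on
  \<open>S\<close> this provides a lattice point at height one.\<close>

lemma ex_simplex_point_unit:
  assumes "finite S" "r \<notin> S"
  shows "\<exists>w\<in>simplex_points (insert r S). \<bar>functional w (\<Prod>s\<in>S. [:- s, 1:])\<bar> = 1"
  using assms
proof (induction "card S" arbitrary: S)
  case 0
  then have "(\<lambda>k. r ^ k) \<in> simplex_points (insert r S)" by (intro simplex_points_vertex) auto
  moreover have "S = {}" using 0 by simp
  ultimately show ?case by (intro bexI[of _ "\<lambda>k. r ^ k"]) (simp_all add: functional_power)
next
  case (Suc n)
  let ?X = "insert r S"
  have X: "finite ?X" "?X \<noteq> {}" using Suc.prems by auto
  \<comment> \<open>The node to be removed must be extremal in \<open>insert r S\<close> and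
    different from \<open>r\<close>. As there are at least two elements, the minimum or the maximum
    qualifies.\<close>
  have "Min ?X \<noteq> Max ?X"
  proof
    assume eq: "Min ?X = Max ?X"
    obtain s where s: "s \<in> S" using Suc.hyps(2) by (metis card.empty ex_in_conv nat.distinct(1))
    then have "s = r" using eq Min_le[OF X(1), of s] Min_le[OF X(1), of r] Max_ge[OF X(1), of s] Max_ge[OF X(1), of r] by auto
    then show False using s Suc.prems by simp
  qed
  then have "\<exists>x e. x \<in> S \<and> (e = 1 \<or> e = - 1) \<and> (\<forall>y\<in>?X - {x}. 0 < e * (y - x))"
  proof (cases "Min ?X = r")
    case True
    with \<open>Min ?X \<noteq> Max ?X\<close> have "Max ?X \<in> S" using Max_in[OF X] by auto
    moreover have "\<forall>y\<in>?X - {Max ?X}. 0 < - 1 * (y - Max ?X)"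
      using Max_ge[OF X(1)] by fastforce
    ultimately show ?thesis by blast
  next
    case False
    then have "Min ?X \<in> S" using Min_in[OF X] by auto
    moreover have "\<forall>y\<in>?X - {Min ?X}. 0 < 1 * (y - Min ?X)"
      using Min_le[OF X(1)] by fastforce
    ultimately show ?thesis by blast
  qed
  then obtain x e where x: "x \<in> S" "e = 1 \<or> e = - 1" "\<And>y. y \<in> ?X - {x} \<Longrightarrow> 0 < e * (y - x)" by blast
  have X': "?X - {x} = insert r (S - {x})" using x Suc.prems by auto
  have "n = card (S - {x})" using Suc x by simp
  then obtain w where w: "w \<in> simplex_points (insert r (S - {x}))"
    "\<bar>functional w (\<Prod>s\<in>S - {x}. [:- s, 1:])\<bar> = 1"
    using Suc.hyps(1)[of "S - {x}"] Suc.prems by auto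
  let ?w = "\<lambda>k. x ^ k + e * quot_shift x w k"
  have "?w \<in> simplex_points (insert x (insert r (S - {x})))"
    using w x Suc.prems X' by (intro simplex_points_insert) auto
  moreover have "insert x (insert r (S - {x})) = ?X" using x by auto
  moreover have "functional ?w (\<Prod>s\<in>S. [:- s, 1:]) = e * functional w (\<Prod>s\<in>S - {x}. [:- s, 1:])"
  proof -
    have "(\<Prod>s\<in>S. [:- s, 1:]) = [:- x, 1:] * (\<Prod>s\<in>S - {x}. [:- s, 1:])"
      using x(1) Suc.prems by (simp add: prod.remove)
    then have "functional ?w (\<Prod>s\<in>S. [:- s, 1:])
        = functional (\<lambda>k. ?w (Suc k) - x * ?w k) (\<Prod>s\<in>S - {x}. [:- s, 1:])"
      by (simp only: functional_linear_factor)
    also have "(\<lambda>k. ?w (Suc k) - x * ?w k) = (\<lambda>k. e * w k)"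
      by (simp add: algebra_simps)
    finally show ?thesis by (simp add: functional_mult_left)
  qed
  ultimately show ?case using w(2) x(2) by (intro bexI[of _ ?w]) (auto simp: abs_mult)
qed

lemma group_closed_int_mult:
  fixes G :: "(nat \<Rightarrow> int) set"
  assumes "(\<lambda>k. 0) \<in> G" "\<And>v w. v \<in> G \<Longrightarrow> w \<in> G \<Longrightarrow> (\<lambda>k. v k + w k) \<in> G"
    "\<And>v w. v \<in> G \<Longrightarrow> w \<in> G \<Longrightarrow> (\<lambda>k. v k - w k) \<in> G" "w \<in> G"
  shows "(\<lambda>k. c * w k) \<in> G"
proof (induction c rule: int_induct[where k = 0])
  case (step1 i)
  from assms(2)[OF this(2) assms(4)] show ?case by (simp add: algebra_simps)
next
  case (step2 i)
  from assms(3)[OF this(2) assms(4)] show ?case by (simp add: algebra_simps)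
qed (use assms in simp)

text \<open>Newton interpolation with integral coefficients: the differences of the points constructed
  by \<open>simplex_points_insert\<close> are the divided differences on initial segments of \<open>S\<close>.\<close>

lemma kernel_generated_by_simplex_points:
  fixes G :: "(nat \<Rightarrow> int) set"
  assumes "finite S" "functional b (\<Prod>s\<in>S. [:- s, 1:]) = 0"
    and "(\<lambda>k. 0) \<in> G" "\<And>v w. v \<in> G \<Longrightarrow> w \<in> G \<Longrightarrow> (\<lambda>k. v k + w k) \<in> G"
    "\<And>v w. v \<in> G \<Longrightarrow> w \<in> G \<Longrightarrow> (\<lambda>k. v k - w k) \<in> G" "simplex_points S \<subseteq> G"
  shows "\<exists>g\<in>G. \<forall>k\<le>card S. g k = b k"
  using assms
proof (induction "card S" arbitrary: S b G)
  case 0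
  then have "S = {}" by simp
  then show ?case using 0 by (intro bexI[of _ "\<lambda>k. 0"]) (auto simp: functional_def)
next
  case (Suc n)
  note G = Suc.prems(3-6)
  define x where "x = Min S"
  have S: "finite S" "S \<noteq> {}" using Suc by auto
  have x: "x \<in> S" "\<And>y. y \<in> S - {x} \<Longrightarrow> 0 < 1 * (y - x)"
    using S Min_in[OF S] Min_le[OF S(1)] unfolding x_def by fastforce+
  have card: "card S = Suc (card (S - {x}))" using S(1) x(1) by (rule card.remove)
  \<comment> \<open>As a functional \<open>b'\<close> sends F to the value of \<open>b\<close> at (X
    - x) F, so it kills the product over the remaining nodes. \<open>G'\<close> is the preimage of
    \<open>G\<close> under \<open>quot_shift x\<close>, hence again a group.\<close>
  define b' where "b' k = b (Suc k) - x * b k" for k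
  define G' where "G' = {v. quot_shift x v \<in> G}"
  have "(\<Prod>s\<in>S. [:- s, 1:]) = [:- x, 1:] * (\<Prod>s\<in>S - {x}. [:- s, 1:])"
    using S(1) x(1) by (rule prod.remove)
  then have b': "functional b' (\<Prod>s\<in>S - {x}. [:- s, 1:]) = 0"
    using Suc.prems(2) unfolding b'_def by (simp only: functional_linear_factor)
  have power: "(\<lambda>k. x ^ k) \<in> G" using simplex_points_vertex[OF S(1) x(1)] G(4) by auto
  have "simplex_points (S - {x}) \<subseteq> G'"
  proof
    fix w assume "w \<in> simplex_points (S - {x})"
    then have "(\<lambda>k. x ^ k + 1 * quot_shift x w k) \<in> simplex_points (insert x (S - {x}))"
      using S x(2) by (intro simplex_points_insert) auto
    moreover have "insert x (S - {x}) = S" using x by auto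
    ultimately have "(\<lambda>k. x ^ k + quot_shift x w k) \<in> G" using G(4) by auto
    from G(3)[OF this power] show "w \<in> G'" by (simp add: G'_def)
  qed
  moreover have "(\<lambda>k. v k + w k) \<in> G'" "(\<lambda>k. v k - w k) \<in> G'" if "v \<in> G'" "w \<in> G'" for v w
    using G(2,3)[of "quot_shift x v" "quot_shift x w"] that
    by (simp_all add: G'_def quot_shift_add quot_shift_diff)
  moreover have "(\<lambda>k. 0) \<in> G'" using G(1) by (simp add: G'_def quot_shift_zero)
  moreover have "n = card (S - {x})" "finite (S - {x})" using Suc.hyps(2) card S by simp_all
  ultimately have "\<exists>g\<in>G'. \<forall>k\<le>card (S - {x}). g k = b' k"
    by (intro Suc.hyps(1)[OF _ _ b', of G']) assumption+
  then obtain v where v: "quot_shift x v \<in> G" "\<And>k. k \<le> card (S - {x}) \<Longrightarrow> v k = b' k"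
    unfolding G'_def by blast
  \<comment> \<open>The multiple of the vertex at \<open>x\<close> matches \<open>b\<close> at index
    0. From there \<open>g\<close> and \<open>b\<close> obey the same recursion, with increments
    \<open>v k\<close> and \<open>b' k\<close>, so they agree one index further than
    \<open>v\<close> and \<open>b'\<close> do.\<close>
  define g where "g k = b 0 * x ^ k + quot_shift x v k" for k
  have "(\<lambda>k. b 0 * x ^ k) \<in> G" by (rule group_closed_int_mult[OF G(1-3) power])
  from G(2)[OF this v(1)] have "g \<in> G" unfolding g_def[abs_def] .
  moreover have "g k = b k" if "k \<le> card S" for k
    using that
  proof (induction k)
    case (Suc k)
    have "g (Suc k) = x * g k + v k" by (simp add: g_def algebra_simps)
    then show ?case using Suc v(2)[of k] card by (simp add: b'_def)
  qed (simp add: g_def)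
  ultimately show ?case by blast
qed

section \<open>Gale's evenness condition\<close>

lemma sgn_prod_diff:
  fixes x :: "'a::linordered_idom"
  assumes "finite S" "x \<notin> S"
  shows "sgn (\<Prod>s\<in>S. x - s) = (- 1) ^ card {s \<in> S. x < s}"
  using assms
proof (induction S rule: finite_induct)
  case (insert y S)
  have "{s \<in> insert y S. x < s} = (if x < y then insert y {s \<in> S. x < s} else {s \<in> S. x < s})" by auto
  then show ?case using insert by (auto simp: sgn_mult)
qed simp

text \<open>Greedy from the left: the least uncovered element of \<open>V\<close> is taken together
  with its successor in \<open>T\<close>, or alone if there is none. Elements of \<open>S\<close>
  preceded by an even number of others are the first members of these blocks, which belong to
  \<open>V\<close>; a gap only sees complete pairs below it.\<close>

lemma even_cover:
  fixes T V :: "'a::linorder set"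
  assumes "finite T"
  shows "\<exists>S\<subseteq>T. V \<inter> T \<subseteq> S \<and> (\<forall>r\<in>T - S. even (card {s \<in> S. s < r}))
    \<and> (\<forall>s\<in>S. even (card {s' \<in> S. s' < s}) \<longrightarrow> s \<in> V)"
  using assms
proof (induction "card T" arbitrary: T rule: less_induct)
  case less
  show ?case
  proof (cases "T = {}")
    case False
    define m where "m = Min T"
    have m: "m \<in> T" "\<And>t. t \<in> T \<Longrightarrow> m \<le> t" using False less.prems by (auto simp: m_def)
    define T1 where "T1 = T - {m}"
    have T1: "finite T1" "card T1 < card T" "T = insert m T1" "m \<notin> T1" "\<And>t. t \<in> T1 \<Longrightarrow> m < t"
      using m less.prems card_Diff1_less[OF less.prems m(1)] by (auto simp: T1_def order_less_le)
    show ?thesis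
    proof (cases "m \<in> V")
      case False
      obtain S where S: "S \<subseteq> T1" "V \<inter> T1 \<subseteq> S" "\<forall>r\<in>T1 - S. even (card {s \<in> S. s < r})"
        "\<forall>s\<in>S. even (card {s' \<in> S. s' < s}) \<longrightarrow> s \<in> V"
        using less.hyps[OF T1(2,1)] by blast
      have "{s \<in> S. s < m} = {}" using S(1) T1(5) by (auto dest: less_asym)
      then have "even (card {s \<in> S. s < m})" by (simp only: card.empty even_zero)
      then show ?thesis using S False T1(3) by (intro exI[of _ S]) auto
    next
      case mV: True
      show ?thesis
      proof (cases "T1 = {}")
        case True
        then show ?thesis using mV T1(3) by (intro exI[of _ "{m}"]) auto
      next
        case False
        define m2 where "m2 = Min T1"
        have m2: "m2 \<in> T1" "\<And>t. t \<in> T1 \<Longrightarrow> m2 \<le> t" using False T1(1) by (auto simp: m2_def)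
        define T2 where "T2 = T1 - {m2}"
        have T2: "finite T2" "card T2 < card T1" "T1 = insert m2 T2" "m2 \<notin> T2" "\<And>t. t \<in> T2 \<Longrightarrow> m2 < t"
          using m2 T1(1) card_Diff1_less[OF T1(1) m2(1)] by (auto simp: T2_def order_less_le)
        obtain S where S: "S \<subseteq> T2" "V \<inter> T2 \<subseteq> S" "\<forall>r\<in>T2 - S. even (card {s \<in> S. s < r})"
          "\<forall>s\<in>S. even (card {s' \<in> S. s' < s}) \<longrightarrow> s \<in> V"
          using less.hyps[of T2] T1 T2 by auto
        have finS: "finite S" using S(1) T2(1) finite_subset by blast
        have mm2: "m < m2" using T1(5) m2 by auto
        have count: "card {s \<in> insert m (insert m2 S). s < t} = Suc (Suc (card {s \<in> S. s < t}))"
          if "t \<in> T2" for t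
        proof -
          have "{s \<in> insert m (insert m2 S). s < t} = insert m (insert m2 {s \<in> S. s < t})"
            using that T2(5)[OF that] mm2 by auto
          then show ?thesis using finS S(1) T1 T2 mm2 by (auto simp: card_insert_if)
        qed
        let ?S = "insert m (insert m2 S)"
        have "{s \<in> ?S. s < m2} = {m}"
          using mm2 S(1) T2(5) by (auto dest: less_asym)
        then have odd: "odd (card {s \<in> ?S. s < m2})" by (simp only: card.insert card.empty) simp
        have TT: "T = insert m (insert m2 T2)" using T1(3) T2(3) by simp
        have sub: "?S \<subseteq> T" "V \<inter> T \<subseteq> ?S" using S(1,2) TT by auto
        have gaps: "even (card {s \<in> ?S. s < r})" if "r \<in> T - ?S" for r
        proof -
          have "r \<in> T2 - S" using that TT by auto
          then show ?thesis using S(3) count[of r] by simp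
        qed
        have mem: "s \<in> V" if "s \<in> ?S" "even (card {s' \<in> ?S. s' < s})" for s
        proof -
          have "s \<noteq> m2" using odd that(2) by auto
          then have "s = m \<or> s \<in> S" using that(1) by auto
          then show ?thesis
          proof
            assume "s \<in> S"
            moreover from this have "s \<in> T2" using S(1) by auto
            ultimately show ?thesis using that(2) S(4) count[of s] by simp
          qed (use mV in simp)
        qed
        show ?thesis by (intro exI[of _ ?S] conjI ballI impI sub) (rule gaps mem, assumption+)+
      qed
    qed
  qed auto
qed

text \<open>Cover \<open>V\<close> by its initial segment below the first gap \<open>g\<close> and consecutive pairs above. This
  satisfies Gale's evenness condition, and in \<open>insert g S\<close> the elements outside \<open>V\<close> all have the
  same parity as \<open>g\<close>.\<close>

lemma gale_cover:
  fixes T V :: "'a::linordered_idom set"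
  assumes "finite T" "V \<subset> T"
  obtains S g e where "S \<subseteq> T" "V \<subseteq> S" "g \<in> T" "g \<notin> S" "e = 1 \<or> e = - 1"
    "\<And>r. r \<in> T - S \<Longrightarrow> sgn (\<Prod>s\<in>S. r - s) = e"
    "\<And>x. x \<in> insert g S - V \<Longrightarrow> sgn (\<Prod>y\<in>insert g S - {x}. x - y) = e"
proof -
  define g where "g = Min (T - V)"
  have "finite (T - V)" "T - V \<noteq> {}" using assms by auto
  then have g: "g \<in> T" "g \<notin> V" "\<And>t. t \<in> T - V \<Longrightarrow> g \<le> t"
    using Min_in[of "T - V"] Min_le[of "T - V"] unfolding g_def by auto
  define Tl where "Tl = {t \<in> T. t < g}"
  define Tg where "Tg = {t \<in> T. g < t}"
  have Tl: "Tl \<subseteq> V" using g(3) by (force simp: Tl_def)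
  have fin: "finite Tl" "finite Tg" using assms by (auto simp: Tl_def Tg_def)
  obtain S where S: "S \<subseteq> Tg" "V \<inter> Tg \<subseteq> S" "\<forall>r\<in>Tg - S. even (card {s \<in> S. s < r})"
    "\<forall>s\<in>S. even (card {s' \<in> S. s' < s}) \<longrightarrow> s \<in> V"
    using even_cover[OF fin(2), of V] by blast
  have finS: "finite S" using S fin finite_subset by blast
  have Sg: "g < s" if "s \<in> S" for s using S(1) that by (auto simp: Tg_def)
  let ?S = "Tl \<union> S"
  have gS: "g \<notin> ?S" using Sg by (auto simp: Tl_def)
  show ?thesis
  proof (rule that[of ?S g "(- 1) ^ card S"])
    show "?S \<subseteq> T" using S by (auto simp: Tl_def Tg_def)
    show "V \<subseteq> ?S"
    proof
      fix v assume v: "v \<in> V"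
      then have "v \<in> T" "v \<noteq> g" using assms g by auto
      then show "v \<in> ?S" using S(2) v by (cases "v < g") (auto simp: Tl_def Tg_def)
    qed
    show "g \<in> T" "g \<notin> ?S" by fact+
    show "(- 1 :: 'a) ^ card S = 1 \<or> (- 1 :: 'a) ^ card S = - 1" by (simp add: minus_one_power_iff)
    fix r assume r: "r \<in> T - ?S"
    have rg: "g \<le> r" using r by (auto simp: Tl_def)
    \<comment> \<open>\<open>Tl\<close> lies entirely below \<open>r\<close>, and \<open>S\<close>
      has an even number of elements below \<open>r\<close>, so the number of elements above
      \<open>r\<close> has the parity of \<open>card S\<close>.\<close>
    have "{s \<in> ?S. r < s} = {s \<in> S. r < s}" using rg by (auto simp: Tl_def)
    moreover have "card S = card {s \<in> S. s < r} + card {s \<in> S. r < s}"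
    proof -
      have "card ({s \<in> S. s < r} \<union> {s \<in> S. r < s}) = card {s \<in> S. s < r} + card {s \<in> S. r < s}"
        using finS by (intro card_Un_disjoint) auto
      moreover have "s < r \<or> r < s" if "s \<in> S" for s
        using r that neq_iff[of s r] by auto
      then have "{s \<in> S. s < r} \<union> {s \<in> S. r < s} = S" by blast
      ultimately show ?thesis by simp
    qed
    moreover have "even (card {s \<in> S. s < r})"
    proof (cases "r = g")
      case True
      then have "{s \<in> S. s < r} = {}" using Sg by (auto dest: less_asym)
      then show ?thesis by (simp only: card.empty even_zero)
    next
      case False
      then have "r \<in> Tg - S" using r rg by (auto simp: Tg_def)
      then show ?thesis using S(3) by blast
    qed
    ultimately show "sgn (\<Prod>s\<in>?S. r - s) = (- 1) ^ card S"
      using r fin finS by (subst sgn_prod_diff) (auto simp: minus_one_power_iff)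
  next
    fix x assume x: "x \<in> insert g ?S - V"
    then have xg: "x = g \<or> x \<in> S" using Tl by auto
    have "even (card {y \<in> insert g ?S - {x}. x < y} + card S)"
    proof (cases "x = g")
      case True
      then have "{y \<in> insert g ?S - {x}. x < y} = S" using Sg by (auto simp: Tl_def)
      then show ?thesis by simp
    next
      case False
      \<comment> \<open>By the last property of the even cover, \<open>x\<close> has an odd number
        of elements of \<open>S\<close> below it. Together with \<open>x\<close> itself this is
        even, so the number above again has the parity of \<open>card S\<close>.\<close>
      then have xS: "x \<in> S" "odd (card {s \<in> S. s < x})" using x xg S(4) by auto
      have "{y \<in> insert g ?S - {x}. x < y} = {s \<in> S. x < s}"
        using Sg[OF xS(1)] by (auto simp: Tl_def)
      moreover have "card S = Suc (card {s \<in> S. s < x} + card {s \<in> S. x < s})"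
      proof -
        have "S = insert x ({s \<in> S. s < x} \<union> {s \<in> S. x < s})" using xS(1) by (auto simp: neq_iff)
        then have "card S = card (insert x ({s \<in> S. s < x} \<union> {s \<in> S. x < s}))" by simp
        also have "\<dots> = Suc (card ({s \<in> S. s < x} \<union> {s \<in> S. x < s}))"
          using finS by (subst card_insert_disjoint) auto
        also have "card ({s \<in> S. s < x} \<union> {s \<in> S. x < s}) = card {s \<in> S. s < x} + card {s \<in> S. x < s}"
          using finS by (intro card_Un_disjoint) auto
        finally show ?thesis .
      qed
      ultimately show ?thesis using xS(2) by simp
    qed
    then show "sgn (\<Prod>y\<in>insert g ?S - {x}. x - y) = (- 1) ^ card S"
      using fin finS by (subst sgn_prod_diff) (auto simp: minus_one_power_iff)
  qed
qed

text \<open>The least missing element \<open>m\<close> is added each time, so every remaining gap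
  \<open>r\<close> lies to its right and the new factor \<open>r - m\<close> is positive.\<close>

lemma gale_extend:
  fixes T S :: "'a::linordered_idom set"
  assumes "finite T" "S \<subseteq> T" "card S \<le> d" "d < card T" "e \<noteq> 0"
    and "\<And>r. r \<in> T - S \<Longrightarrow> sgn (\<Prod>s\<in>S. r - s) = e"
  shows "\<exists>S'. S \<subseteq> S' \<and> S' \<subseteq> T \<and> card S' = d \<and> (\<forall>r\<in>T - S'. sgn (\<Prod>s\<in>S'. r - s) = e)"
  using assms(2,3,6)
proof (induction "d - card S" arbitrary: S)
  case 0
  then show ?case by (intro exI[of _ S]) auto
next
  case (Suc k)
  define m where "m = Min (T - S)"
  have finS: "finite S" using Suc.prems assms(1) finite_subset by blast
  have "T - S \<noteq> {}" using Suc.prems assms(4) finS by (metis Diff_eq_empty_iff card_mono leD order_trans)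
  then have m: "m \<in> T" "m \<notin> S" "\<And>t. t \<in> T - S \<Longrightarrow> m \<le> t"
    using Min_in[of "T - S"] Min_le[of "T - S"] assms(1) unfolding m_def by auto
  have "sgn (\<Prod>s\<in>insert m S. r - s) = e" if "r \<in> T - insert m S" for r
  proof -
    have "m < r" using m(3)[of r] that by (auto simp: order_less_le)
    then show ?thesis using Suc.prems(3)[of r] that m finS by (simp add: sgn_mult)
  qed
  moreover have "card (insert m S) = Suc (card S)" using m finS by simp
  ultimately have "\<exists>S'. insert m S \<subseteq> S' \<and> S' \<subseteq> T \<and> card S' = d \<and> (\<forall>r\<in>T - S'. sgn (\<Prod>s\<in>S'. r - s) = e)"
    using Suc.hyps(2) Suc.prems m by (intro Suc.hyps(1)) auto
  then show ?case by blast
qed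

text \<open>The sum is the divided difference of X^k on all of \<open>X\<close>. Lagrange
  interpolation \<open>P\<close> reproduces X^k, whose degree is below \<open>card X - 1\<close>,
  and the sum is the coefficient of \<open>P\<close> in degree \<open>card X - 1\<close>.\<close>

lemma sum_power_div_prod_diff_eq_0:
  fixes X :: "'a::field set"
  assumes X: "finite X" and k: "k + 2 \<le> card X"
  shows "(\<Sum>x\<in>X. x ^ k / (\<Prod>y\<in>X - {x}. x - y)) = 0"
proof -
  define c where "c x = x ^ k / (\<Prod>y\<in>X - {x}. x - y)" for x
  define P where "P = (\<Sum>x\<in>X. Polynomial.smult (c x) (\<Prod>y\<in>X - {x}. [:- y, 1:]))"
  have deg: "degree (\<Prod>y\<in>Y. [:- y, 1:]) = card Y" if "finite Y" for Y :: "'a set"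
    using that by (subst degree_prod_eq_sum_degree) auto
  have degX: "degree (\<Prod>y\<in>X - {x}. [:- y, 1:]) = card X - 1" if "x \<in> X" for x
    using X that by (simp add: deg)
  have "degree P \<le> card X - 1"
    unfolding P_def using degX X by (intro degree_sum_le) (auto intro: order_trans[OF degree_smult_le])
  then have degPX: "degree (P - Polynomial.monom 1 k) < card X"
    using k by (intro le_less_trans[OF degree_diff_le[of _ "card X - 1"]]) (auto simp: degree_monom_eq)
  have "poly (P - Polynomial.monom 1 k) z = 0" if z: "z \<in> X" for z
  proof -
    have "poly (Polynomial.smult (c x) (\<Prod>y\<in>X - {x}. [:- y, 1:])) z = (if x = z then z ^ k else 0)" if x: "x \<in> X" for x
    proof (cases "x = z")
      case True
      have "(\<Prod>y\<in>X - {z}. z - y) \<noteq> 0" using X by auto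
      then show ?thesis using True by (simp add: c_def poly_prod)
    next
      case False
      then have "(\<Prod>y\<in>X - {x}. z - y) = 0" using X z by (intro prod_zero) auto
      then show ?thesis using False by (simp add: poly_prod)
    qed
    then have "poly P z = (\<Sum>x\<in>X. if x = z then z ^ k else 0)"
      unfolding P_def poly_sum by (intro sum.cong refl) blast
    then show ?thesis using X z by (simp add: poly_monom)
  qed
  then have roots: "X \<subseteq> {z. poly (P - Polynomial.monom 1 k) z = 0}" by blast
  have "P - Polynomial.monom 1 k = 0"
  proof (rule ccontr)
    assume nz: "P - Polynomial.monom 1 k \<noteq> 0"
    have "card X \<le> degree (P - Polynomial.monom 1 k)"
      using card_mono[OF poly_roots_finite[OF nz] roots] card_poly_roots_bound[OF nz] by (rule order_trans)
    then show False using degPX by simp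
  qed
  then have "P = Polynomial.monom 1 k" by simp
  then have "Polynomial.coeff P (card X - 1) = 0" using k by simp
  moreover have "Polynomial.coeff P (card X - 1) = (\<Sum>x\<in>X. c x)"
  proof -
    have "Polynomial.coeff (\<Prod>y\<in>X - {x}. [:- y, 1:]) (card X - 1) = 1" if "x \<in> X" for x
    proof -
      have "lead_coeff (\<Prod>y\<in>X - {x}. [:- y, 1:]) = 1" by (simp add: lead_coeff_prod)
      then show ?thesis by (simp only: degX[OF that])
    qed
    then show ?thesis by (simp add: P_def coeff_sum)
  qed
  ultimately show ?thesis by (simp add: c_def)
qed

text \<open>The divided difference relation, made integral by a positive common denominator so that
  its signs are preserved; these are the signs that \<open>gale_cover\<close> controls.\<close>

lemma moment_curve_relation:
  fixes X :: "int set"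
  assumes X: "finite X"
  obtains c :: "int \<Rightarrow> int" where "\<And>x. x \<in> X \<Longrightarrow> sgn (c x) = sgn (\<Prod>y\<in>X - {x}. x - y)"
    "\<And>k. k + 2 \<le> card X \<Longrightarrow> (\<Sum>x\<in>X. c x * x ^ k) = 0"
proof -
  define q where "q x = (\<Prod>y\<in>X - {x}. x - y)" for x
  have q: "q x \<noteq> 0" for x using X by (auto simp: q_def)
  \<comment> \<open>On \<open>X\<close> this is \<open>D / q x\<close>, written without
    division.\<close>
  define c where "c x = sgn (q x) * (\<Prod>x'\<in>X - {x}. \<bar>q x'\<bar>)" for x
  define D where "D = (\<Prod>x\<in>X. \<bar>q x\<bar>)"
  have "sgn (c x) = sgn (q x)" if "x \<in> X" for x
  proof -
    have "(\<Prod>x'\<in>X - {x}. \<bar>q x'\<bar>) > 0" using q by (intro prod_pos) auto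
    then show ?thesis by (simp add: c_def sgn_mult)
  qed
  moreover have "(\<Sum>x\<in>X. c x * x ^ k) = 0" if k: "k + 2 \<le> card X" for k
  proof -
    have "real_of_int (c x) = real_of_int D / real_of_int (q x)" if "x \<in> X" for x
    proof -
      have "D = \<bar>q x\<bar> * (\<Prod>x'\<in>X - {x}. \<bar>q x'\<bar>)" unfolding D_def using that X by (rule prod.remove[rotated])
      then have "D = q x * c x" by (simp add: c_def abs_sgn ac_simps)
      then show ?thesis using q by (simp add: field_simps)
    qed
    then have "real_of_int (\<Sum>x\<in>X. c x * x ^ k)
        = real_of_int D * (\<Sum>x\<in>X. real_of_int x ^ k / real_of_int (q x))"
      by (simp add: sum_distrib_left)
    also have "(\<Sum>x\<in>X. real_of_int x ^ k / real_of_int (q x))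
        = (\<Sum>x\<in>real_of_int ` X. x ^ k / (\<Prod>y\<in>real_of_int ` X - {x}. x - y))"
    proof (subst sum.reindex)
      have "real_of_int ` X - {real_of_int x} = real_of_int ` (X - {x})" for x by auto
      then show "(\<Sum>x\<in>X. real_of_int x ^ k / real_of_int (q x)) =
          (\<Sum>x\<in>X. ((\<lambda>x. x ^ k / (\<Prod>y\<in>real_of_int ` X - {x}. x - y)) \<circ> real_of_int) x)"
        by (simp add: q_def prod.reindex inj_on_def)
    qed (simp add: inj_on_def)
    also have "\<dots> = 0"
      using X k by (intro sum_power_div_prod_diff_eq_0) (auto simp: card_image inj_on_def)
    finally show ?thesis by (simp only: mult_zero_right of_int_eq_0_iff)
  qed
  ultimately show ?thesis using that[of c] by (simp add: q_def)
qed

section \<open>The monoid of a cyclic polytope\<close>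

text \<open>The condition for \<open>k = 0\<close> says that the homogenizing coordinate is \<open>1\<close>.\<close>

definition cyclic_generators :: "nat \<Rightarrow> int set \<Rightarrow> (nat \<Rightarrow>\<^sub>0 int) set" where
  "cyclic_generators d T = {a. Poly_Mapping.keys a \<subseteq> {..d} \<and> (\<exists>u. (\<forall>y\<in>T. 0 \<le> u y) \<and> sum u T = 1 \<and>
     (\<forall>k\<le>d. real_of_int (Poly_Mapping.lookup a k) = (\<Sum>y\<in>T. u y * real_of_int y ^ k)))}"

definition truncated :: "nat \<Rightarrow> (nat \<Rightarrow> int) \<Rightarrow> (nat \<Rightarrow>\<^sub>0 int)" where
  "truncated d w = (\<Sum>k\<le>d. Poly_Mapping.single k (w k))"

lemma lookup_truncated: "Poly_Mapping.lookup (truncated d w) k = (if k \<le> d then w k else 0)"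
  by (simp add: truncated_def lookup_sum lookup_single when_def)

lemma keys_truncated: "Poly_Mapping.keys (truncated d w) \<subseteq> {..d}"
  by (auto simp: in_keys_iff lookup_truncated split: if_splits)

lemma lookup_scaleR: "Poly_Mapping.lookup (r *\<^sub>R f) k = r *\<^sub>R Poly_Mapping.lookup f k"
  for f :: "'a \<Rightarrow>\<^sub>0 'b::real_vector"
proof -
  have "finite {i. r *\<^sub>R Poly_Mapping.lookup f i \<noteq> 0}"
    by (rule finite_subset[OF _ finite_lookup[of f]]) auto
  then show ?thesis by (simp add: scaleR_poly_mapping_def)
qed

lemma lookup_moment_point:
  "Poly_Mapping.lookup (moment_point d t) k = (if 1 \<le> k \<and> k \<le> d then t ^ k else 0)"
  by (simp add: moment_point_def lookup_sum lookup_single when_def)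

lemma lookup_map_real_of_int:
  "Poly_Mapping.lookup (Poly_Mapping.map real_of_int a) k = real_of_int (Poly_Mapping.lookup a k)"
  by (simp add: Poly_Mapping.map.rep_eq when_def)

text \<open>\<open>convex_hull_finite\<close> puts the weights on points. They pull back to the
  nodes because the moment map is injective, as its first coordinate shows when
  \<open>1 \<le> d\<close>.\<close>

lemma mem_convex_hull_moment_points:
  assumes "finite T" "1 \<le> d"
  shows "\<alpha> \<in> convex hull ((\<lambda>y. moment_point d (real_of_int y)) ` T) \<longleftrightarrow>
    (\<exists>u. (\<forall>y\<in>T. 0 \<le> u y) \<and> sum u T = 1 \<and> \<alpha> = (\<Sum>y\<in>T. u y *\<^sub>R moment_point d (real_of_int y)))"
    (is "_ \<in> convex hull (?f ` T) \<longleftrightarrow> ?R")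
proof
  have inj: "inj_on ?f T"
  proof (rule inj_onI)
    fix x y assume "?f x = ?f y"
    then have "Poly_Mapping.lookup (?f x) 1 = Poly_Mapping.lookup (?f y) 1" by simp
    then show "x = y" using assms by (simp add: lookup_moment_point)
  qed
  assume "\<alpha> \<in> convex hull (?f ` T)"
  then obtain v where v: "\<forall>x\<in>?f ` T. 0 \<le> v x" "sum v (?f ` T) = 1" "(\<Sum>x\<in>?f ` T. v x *\<^sub>R x) = \<alpha>"
    using assms by (auto simp: convex_hull_finite)
  then show ?R by (intro exI[of _ "v \<circ> ?f"]) (simp add: sum.reindex[OF inj])
next
  assume ?R
  then obtain u where u: "\<forall>y\<in>T. 0 \<le> u y" "sum u T = 1" "\<alpha> = (\<Sum>y\<in>T. u y *\<^sub>R ?f y)" by blast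
  show "\<alpha> \<in> convex hull (?f ` T)"
    unfolding u(3) using assms u by (intro convex_sum) (auto intro: hull_inc)
qed

lemma lattice_points_cyclic_polytope:
  assumes "1 \<le> d"
  shows "lattice_points (cyclic_polytope d n (\<lambda>i. real_of_int (\<tau> i))) = cyclic_generators d (\<tau> ` {1..n})"
proof (rule Set.set_eqI)
  fix a :: "nat \<Rightarrow>\<^sub>0 int"
  let ?T = "\<tau> ` {1..n}"
  have img: "(\<lambda>i. moment_point d (real_of_int (\<tau> i))) ` {1..n} = (\<lambda>y. moment_point d (real_of_int y)) ` ?T"
    by (simp add: image_image)
  have eq: "Poly_Mapping.map real_of_int a
        = Poly_Mapping.single 0 1 + (\<Sum>y\<in>?T. u y *\<^sub>R moment_point d (real_of_int y))
      \<longleftrightarrow> Poly_Mapping.keys a \<subseteq> {..d} \<and>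
        (\<forall>k\<le>d. real_of_int (Poly_Mapping.lookup a k) = (\<Sum>y\<in>?T. u y * real_of_int y ^ k))"
    (is "?l \<longleftrightarrow> ?r") if u: "sum u ?T = 1" for u
  proof -
    have "?l \<longleftrightarrow> (\<forall>k. real_of_int (Poly_Mapping.lookup a k) = (1 when 0 = k)
        + (\<Sum>y\<in>?T. u y * (if 1 \<le> k \<and> k \<le> d then real_of_int y ^ k else 0)))"
      by (simp add: poly_mapping_eq_iff fun_eq_iff lookup_map_real_of_int lookup_add lookup_single lookup_one
          lookup_sum lookup_scaleR lookup_moment_point)
    also have "\<dots> \<longleftrightarrow> (\<forall>k. real_of_int (Poly_Mapping.lookup a k)
        = (if k \<le> d then (\<Sum>y\<in>?T. u y * real_of_int y ^ k) else 0))"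
    proof (intro all_cong1)
      fix k
      \<comment> \<open>At \<open>k = 0\<close> the moment points contribute nothing on the left,
        and the sum on the right is the total weight 1.\<close>
      show "(real_of_int (Poly_Mapping.lookup a k) = (1 when 0 = k)
            + (\<Sum>y\<in>?T. u y * (if 1 \<le> k \<and> k \<le> d then real_of_int y ^ k else 0)))
          \<longleftrightarrow> (real_of_int (Poly_Mapping.lookup a k)
            = (if k \<le> d then (\<Sum>y\<in>?T. u y * real_of_int y ^ k) else 0))"
        using u by (cases "k = 0") (auto simp: when_def)
    qed
    also have "\<dots> \<longleftrightarrow> ?r"
    proof
      assume L: "\<forall>k. real_of_int (Poly_Mapping.lookup a k)
        = (if k \<le> d then (\<Sum>y\<in>?T. u y * real_of_int y ^ k) else 0)"
      have "Poly_Mapping.keys a \<subseteq> {..d}"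
      proof
        fix k assume "k \<in> Poly_Mapping.keys a"
        then have "Poly_Mapping.lookup a k \<noteq> 0" by (simp add: in_keys_iff)
        then show "k \<in> {..d}" using L[rule_format, of k] by (cases "k \<le> d") simp_all
      qed
      then show ?r using L by simp
    next
      assume R: ?r
      have "Poly_Mapping.lookup a k = 0" if "\<not> k \<le> d" for k
        using R that by (auto simp: in_keys_iff)
      then show "\<forall>k. real_of_int (Poly_Mapping.lookup a k)
        = (if k \<le> d then (\<Sum>y\<in>?T. u y * real_of_int y ^ k) else 0)"
        using R by simp
    qed
    finally show ?thesis .
  qed
  have "a \<in> lattice_points (cyclic_polytope d n (\<lambda>i. real_of_int (\<tau> i))) \<longleftrightarrow>
    (\<exists>u. (\<forall>y\<in>?T. 0 \<le> u y) \<and> sum u ?T = 1 \<and> Poly_Mapping.map real_of_int a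
        = Poly_Mapping.single 0 1 + (\<Sum>y\<in>?T. u y *\<^sub>R moment_point d (real_of_int y)))"
    unfolding lattice_points_def cyclic_polytope_def img
    using mem_convex_hull_moment_points[of ?T d] assms by (auto simp: image_iff Bex_def)
  also have "\<dots> \<longleftrightarrow> a \<in> cyclic_generators d ?T"
    unfolding cyclic_generators_def mem_Collect_eq using eq by blast
  finally show "a \<in> lattice_points (cyclic_polytope d n (\<lambda>i. real_of_int (\<tau> i))) \<longleftrightarrow> a \<in> cyclic_generators d ?T" .
qed

lemma finite_cyclic_generators:
  assumes "finite T"
  shows "finite (cyclic_generators d T)"
proof -
  \<comment> \<open>A crude common bound for the coordinates of all moment points; convex
    combinations obey it as well.\<close>
  define B where "B = (\<Sum>y\<in>T. \<Sum>k\<le>d. \<bar>y\<bar> ^ k)"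
  have B: "\<bar>y\<bar> ^ k \<le> B" if "y \<in> T" "k \<le> d" for y k
  proof -
    have "\<bar>y\<bar> ^ k \<le> (\<Sum>k\<le>d. \<bar>y\<bar> ^ k)" using that by (intro member_le_sum) auto
    also have "\<dots> \<le> B" unfolding B_def using assms that by (intro member_le_sum) (auto intro: sum_nonneg)
    finally show ?thesis .
  qed
  let ?F = "{f. \<forall>k. (k \<in> {..d} \<longrightarrow> f k \<in> {- B..B}) \<and> (k \<notin> {..d} \<longrightarrow> f k = 0)}"
  have "finite ?F" by (rule finite_set_of_finite_funs) auto
  moreover have "Poly_Mapping.lookup ` cyclic_generators d T \<subseteq> ?F"
  proof
    fix f assume "f \<in> Poly_Mapping.lookup ` cyclic_generators d T"
    then obtain a u where a: "f = Poly_Mapping.lookup a" "Poly_Mapping.keys a \<subseteq> {..d}"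
      and u: "\<And>y. y \<in> T \<Longrightarrow> 0 \<le> u y" "sum u T = 1"
      "\<And>k. k \<le> d \<Longrightarrow> real_of_int (Poly_Mapping.lookup a k) = (\<Sum>y\<in>T. u y * real_of_int y ^ k)"
      unfolding cyclic_generators_def by blast
    have "Poly_Mapping.lookup a k = 0" if "k \<notin> {..d}" for k
      using a(2) that by (auto simp: in_keys_iff)
    moreover have "Poly_Mapping.lookup a k \<in> {- B..B}" if k: "k \<le> d" for k
    proof -
      have "\<bar>real_of_int (Poly_Mapping.lookup a k)\<bar> \<le> (\<Sum>y\<in>T. \<bar>u y * real_of_int y ^ k\<bar>)"
        unfolding u(3)[OF k] by (rule sum_abs)
      also have "\<dots> \<le> (\<Sum>y\<in>T. u y * real_of_int B)"
      proof (rule sum_mono)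
        fix y assume y: "y \<in> T"
        have "real_of_int (\<bar>y\<bar> ^ k) \<le> real_of_int B" using B[OF y k] by (rule of_int_le_iff[THEN iffD2])
        then show "\<bar>u y * real_of_int y ^ k\<bar> \<le> u y * real_of_int B"
          using u(1)[OF y] by (simp add: abs_mult power_abs mult_left_mono)
      qed
      also have "\<dots> = real_of_int B" by (simp add: u(2) flip: sum_distrib_right)
      finally have "\<bar>Poly_Mapping.lookup a k\<bar> \<le> B" by linarith
      then show ?thesis by auto
    qed
    ultimately show "f \<in> ?F" unfolding a(1) by simp
  qed
  ultimately have "finite (Poly_Mapping.lookup ` cyclic_generators d T)"
    by (meson finite_subset)
  then show ?thesis by (rule finite_imageD) (auto intro: inj_onI simp: poly_mapping.lookup_inject)
qed

text \<open>Dirichlet approximation makes the barycentric coordinates simultaneously almost integral; the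
  resulting error is an integral vector of norm less than \<open>1\<close>, hence zero.\<close>

lemma cyclic_generators_integral_relation:
  assumes T: "finite T" and u: "\<And>y. y \<in> T \<Longrightarrow> 0 \<le> u y"
    and a: "\<And>k. k \<le> d \<Longrightarrow> real_of_int (b k) = (\<Sum>y\<in>T. u y * real_of_int y ^ k)"
  obtains N :: nat and m :: "int \<Rightarrow> nat" where "0 < N" "\<And>y. y \<in> T \<Longrightarrow> 0 < m y \<longleftrightarrow> 0 < u y"
    "\<And>k. k \<le> d \<Longrightarrow> int N * b k = (\<Sum>y\<in>T. int (m y) * y ^ k)"
proof -
  obtain h where h: "bij_betw h {0..<card T} T" using ex_bij_betw_nat_finite[OF T] by blast
  \<comment> \<open>The first summand keeps the accumulated rounding error in each coordinate below
    1. The second makes 1 / N0 smaller than each positive weight, so that a positive weight keeps a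
    positive numerator; zero weights contribute 0, since 1 / 0 = 0.\<close>
  define B where "B = (\<Sum>k\<le>d. \<Sum>y\<in>T. \<bar>real_of_int y\<bar> ^ k) + (\<Sum>y\<in>T. 1 / u y)"
  have pos: "0 \<le> (\<Sum>k\<le>d. \<Sum>y\<in>T. \<bar>real_of_int y\<bar> ^ k)" "0 \<le> (\<Sum>y\<in>T. 1 / u y)"
    using u by (auto intro!: sum_nonneg)
  define N0 where "N0 = Suc (nat \<lceil>B\<rceil>)"
  have N0: "B < real N0" "N0 > 0" unfolding N0_def by linarith+
  obtain q p where q: "0 < q" "\<And>i. i < card T \<Longrightarrow> \<bar>of_int q * u (h i) - of_int (p i)\<bar> < 1 / real N0"
    using Dirichlet_approx_simult[OF N0(2), where \<theta> = "\<lambda>i. u (h i)" and n = "card T"] by metis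
  define m where "m y = p (the_inv_into {0..<card T} h y)" for y
  have m: "\<bar>of_int q * u y - of_int (m y)\<bar> < 1 / real N0" if "y \<in> T" for y
  proof -
    have "the_inv_into {0..<card T} h y < card T" "h (the_inv_into {0..<card T} h y) = y"
      using h that the_inv_into_into[of h "{0..<card T}" y "{0..<card T}"] f_the_inv_into_f_bij_betw[OF h]
      by (auto simp: bij_betw_def)
    then show ?thesis using q(2)[of "the_inv_into {0..<card T} h y"] by (simp add: m_def)
  qed
  have N01: "1 / real N0 \<le> 1" using N0 by (simp add: N0_def)
  have mpos: "0 \<le> m y \<and> (0 < m y \<longleftrightarrow> 0 < u y)" if y: "y \<in> T" for y
  proof (cases "u y = 0")
    case True
    then have "\<bar>real_of_int (m y)\<bar> < 1" using m[OF y] N01 by simp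
    then have "m y = 0" by linarith
    then show ?thesis using True by simp
  next
    case False
    then have uy: "0 < u y" using u[OF y] by simp
    have "1 / u y \<le> (\<Sum>y\<in>T. 1 / u y)" using y T u by (intro member_le_sum) auto
    then have "1 / u y < real N0" using N0(1) pos unfolding B_def by linarith
    then have "1 / real N0 < u y" using uy N0(2) by (simp add: field_simps)
    also have "u y \<le> of_int q * u y" using uy q(1) by (simp add: mult_le_cancel_right1)
    finally have "0 < real_of_int (m y)" using m[OF y] by linarith
    then show ?thesis using uy by simp
  qed
  have "q * b k = (\<Sum>y\<in>T. m y * y ^ k)" if k: "k \<le> d" for k
  proof -
    have "real_of_int (q * b k - (\<Sum>y\<in>T. m y * y ^ k))
        = (\<Sum>y\<in>T. (of_int q * u y - of_int (m y)) * real_of_int y ^ k)"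
      by (simp add: a[OF k] sum_distrib_left sum_subtractf left_diff_distrib mult.assoc)
    then have "\<bar>real_of_int (q * b k - (\<Sum>y\<in>T. m y * y ^ k))\<bar>
        \<le> (\<Sum>y\<in>T. \<bar>(of_int q * u y - of_int (m y)) * real_of_int y ^ k\<bar>)"
      by (metis sum_abs)
    also have "\<dots> \<le> (\<Sum>y\<in>T. 1 / real N0 * \<bar>real_of_int y\<bar> ^ k)"
      using m by (intro sum_mono) (simp only: abs_mult power_abs, intro mult_right_mono, auto intro: less_imp_le)
    also have "\<dots> = (\<Sum>y\<in>T. \<bar>real_of_int y\<bar> ^ k) / real N0" by (simp add: sum_divide_distrib)
    also have "\<dots> < 1"
    proof -
      have "(\<Sum>y\<in>T. \<bar>real_of_int y\<bar> ^ k) \<le> (\<Sum>k\<le>d. \<Sum>y\<in>T. \<bar>real_of_int y\<bar> ^ k)"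
        using k by (intro member_le_sum[of k "{..d}" "\<lambda>k. \<Sum>y\<in>T. \<bar>real_of_int y\<bar> ^ k"]) (auto intro: sum_nonneg)
      then have "(\<Sum>y\<in>T. \<bar>real_of_int y\<bar> ^ k) < real N0" using N0(1) pos unfolding B_def by linarith
      then show ?thesis using N0(2) by simp
    qed
    finally show ?thesis by linarith
  qed
  then show ?thesis
    using that[of "nat q" "\<lambda>y. nat (m y)"] q(1) mpos by simp
qed

section \<open>Height one primes\<close>

text \<open>A polynomial of degree at most \<open>d\<close> read as a linear form on exponents; on
  the vertex of a node \<open>y\<close> it takes the value \<open>poly F y\<close>.\<close>

definition form :: "int poly \<Rightarrow> (nat \<Rightarrow>\<^sub>0 int) \<Rightarrow> int" where
  "form F a = functional (Poly_Mapping.lookup a) F"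

lemma form_add: "form F (a + b) = form F a + form F b"
  by (simp add: form_def functional_def lookup_add distrib_left sum.distrib)

lemma form_zero [simp]: "form F 0 = 0"
  by (simp add: form_def functional_def)

lemma form_truncated: "degree F \<le> d \<Longrightarrow> form F (truncated d w) = functional w F"
  unfolding form_def by (intro functional_cong) (simp add: lookup_truncated)

lemma lookup_sum_const: "Poly_Mapping.lookup (\<Sum>i<N::nat. a) k = int N * Poly_Mapping.lookup a k"
  by (simp add: lookup_sum)

declare sum_constant [simp del] \<comment> \<open>it would rewrite multiples of exponents into convolution products\<close>

locale cyclic_monoid =
  fixes d :: nat and T :: "int set"
  assumes finite_T: "finite T" and card_T: "d < card T"
begin

abbreviation "A \<equiv> cyclic_generators d T"
abbreviation "M \<equiv> generated_submonoid A"

definition vertex :: "int \<Rightarrow> nat \<Rightarrow>\<^sub>0 int" where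
  "vertex y = truncated d (\<lambda>k. y ^ k)"

lemma keys_M: "a \<in> M \<Longrightarrow> Poly_Mapping.keys a \<subseteq> {..d}"
proof (induction rule: generated_submonoid.induct)
  case (add_generator a b)
  then show ?case using keys_add[of a b] by (auto simp: cyclic_generators_def)
qed simp

lemma lookup_M: "a \<in> M \<Longrightarrow> d < k \<Longrightarrow> Poly_Mapping.lookup a k = 0"
  using keys_M[of a] by (auto simp: in_keys_iff subset_iff)

lemma truncated_mem:
  assumes "w \<in> simplex_points Y" "Y \<subseteq> T"
  shows "truncated d w \<in> A"
proof -
  obtain u where u: "\<forall>y\<in>Y. 0 \<le> u y" "sum u Y = 1"
    "\<forall>k. real_of_int (w k) = (\<Sum>y\<in>Y. u y * real_of_int y ^ k)"
    using assms(1) unfolding simplex_points_def by blast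
  define u' where "u' y = (if y \<in> Y then u y else 0)" for y
  have "(\<Sum>y\<in>T. u' y * f y) = (\<Sum>y\<in>Y. u y * f y)" for f :: "int \<Rightarrow> real"
    using assms(2) finite_T by (intro sum.mono_neutral_cong_right) (auto simp: u'_def)
  from this[of "\<lambda>_. 1"] this have "sum u' T = 1"
    "\<And>k. k \<le> d \<Longrightarrow> real_of_int (Poly_Mapping.lookup (truncated d w) k) = (\<Sum>y\<in>T. u' y * real_of_int y ^ k)"
    using u by (simp_all add: lookup_truncated)
  moreover have "\<forall>y\<in>T. 0 \<le> u' y" using u by (simp add: u'_def)
  ultimately show ?thesis
    unfolding cyclic_generators_def using keys_truncated by blast
qed

lemma vertex_mem: "y \<in> T \<Longrightarrow> vertex y \<in> A"
  unfolding vertex_def using simplex_points_vertex[of "{y}" y] by (intro truncated_mem[of _ "{y}"]) auto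

lemma lookup_vertex: "Poly_Mapping.lookup (vertex y) k = (if k \<le> d then y ^ k else 0)"
  by (simp add: vertex_def lookup_truncated)

lemma sum_mem_M: "(\<And>i. i \<in> I \<Longrightarrow> f i \<in> M) \<Longrightarrow> sum f I \<in> M"
  by (induction I rule: infinite_finite_induct)
    (auto intro: generated_submonoid.zero generated_submonoid_add)

lemma A_M: "a \<in> A \<Longrightarrow> a \<in> M"
  by (rule generated_submonoid_base)

lemma form_A:
  assumes "degree F \<le> d"
    and "\<And>k. k \<le> d \<Longrightarrow> real_of_int (Poly_Mapping.lookup a k) = (\<Sum>y\<in>T. u y * real_of_int y ^ k)"
  shows "real_of_int (form F a) = (\<Sum>y\<in>T. u y * real_of_int (poly F y))"
proof -
  have "real_of_int (form F a) = (\<Sum>k\<le>d. \<Sum>y\<in>T. real_of_int (Polynomial.coeff F k) * (u y * real_of_int y ^ k))"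
    by (simp add: form_def functional_altdef[OF assms(1)] assms(2) sum_distrib_left)
  also have "\<dots> = (\<Sum>y\<in>T. \<Sum>k\<le>d. real_of_int (Polynomial.coeff F k) * (u y * real_of_int y ^ k))"
    by (rule sum.swap)
  also have "\<dots> = (\<Sum>y\<in>T. u y * real_of_int (functional (\<lambda>k. y ^ k) F))"
    by (simp add: functional_altdef[OF assms(1)] sum_distrib_left ac_simps)
  finally show ?thesis by (simp add: functional_power)
qed

lemma form_nonneg:
  assumes "degree F \<le> d" "\<And>y. y \<in> T \<Longrightarrow> 0 \<le> poly F y" "a \<in> M"
  shows "0 \<le> form F a"
  using assms(3)
proof induction
  case (add_generator a b)
  obtain u where u: "\<And>y. y \<in> T \<Longrightarrow> 0 \<le> u y"
    "\<And>k. k \<le> d \<Longrightarrow> real_of_int (Poly_Mapping.lookup a k) = (\<Sum>y\<in>T. u y * real_of_int y ^ k)"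
    using add_generator.hyps(1) unfolding cyclic_generators_def by blast
  have "0 \<le> (\<Sum>y\<in>T. u y * real_of_int (poly F y))"
    using u(1) assms(2) by (intro sum_nonneg mult_nonneg_nonneg) auto
  then have "0 \<le> real_of_int (form F a)" by (simp only: form_A[OF assms(1) u(2)])
  then show ?case using add_generator.IH by (simp add: form_add)
qed simp

text \<open>Subtracting \<open>form F a\<close> copies of \<open>x\<close> from \<open>a\<close>
  leads into the kernel of the form, a lattice generated by the lattice points of the facet. In
  terms of monomials: after multiplication by a monomial on the facet, every monomial off the facet
  is divisible by that of \<open>x\<close>.\<close>

lemma facet_lattice:
  assumes S: "S \<subseteq> T" "card S = d" and F: "F = Polynomial.smult e (\<Prod>s\<in>S. [:- s, 1:])" "e \<noteq> 0" "degree F \<le> d"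
    and x: "x \<in> M" "form F x = 1" and a: "a \<in> M" "0 < form F a"
  shows "\<exists>t\<in>M. \<exists>h\<in>M. form F t = 0 \<and> t + a = h + x"
proof -
  have finS: "finite S" using S finite_T finite_subset by blast
  let ?P = "\<Prod>s\<in>S. [:- s, 1:]"
  \<comment> \<open>Differences of monoid elements on the facet. Only coordinates up to
    \<open>d\<close> are compared, because the interpolation controls no others.\<close>
  define G where "G = {w. \<exists>t\<in>M. \<exists>t'\<in>M. form F t = 0 \<and> form F t' = 0 \<and>
    (\<forall>k\<le>d. w k = Poly_Mapping.lookup t k - Poly_Mapping.lookup t' k)}"
  have G0: "(\<lambda>k. 0) \<in> G"
    unfolding G_def mem_Collect_eq
    by (intro bexI[OF _ generated_submonoid.zero]) simp
  have Gadd: "(\<lambda>k. v k + w k) \<in> G" and Gdiff: "(\<lambda>k. v k - w k) \<in> G" if vw: "v \<in> G" "w \<in> G" for v w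
  proof -
    obtain t t' where t: "t \<in> M" "t' \<in> M" "form F t = 0" "form F t' = 0"
      "\<forall>k\<le>d. v k = Poly_Mapping.lookup t k - Poly_Mapping.lookup t' k"
      using vw(1) unfolding G_def by blast
    obtain s s' where s: "s \<in> M" "s' \<in> M" "form F s = 0" "form F s' = 0"
      "\<forall>k\<le>d. w k = Poly_Mapping.lookup s k - Poly_Mapping.lookup s' k"
      using vw(2) unfolding G_def by blast
    note m = generated_submonoid_add[OF t(1) s(1)] generated_submonoid_add[OF t(2) s(2)]
      generated_submonoid_add[OF t(1) s(2)] generated_submonoid_add[OF t(2) s(1)]
    show "(\<lambda>k. v k + w k) \<in> G"
      unfolding G_def mem_Collect_eq
      by (rule bexI[OF _ m(1)], rule bexI[OF _ m(2)])
        (simp add: form_add lookup_add t(3-5) s(3-5))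
    show "(\<lambda>k. v k - w k) \<in> G"
      unfolding G_def mem_Collect_eq
      by (rule bexI[OF _ m(3)], rule bexI[OF _ m(4)])
        (simp add: form_add lookup_add t(3-5) s(3-5))
  qed
  have "simplex_points S \<subseteq> G"
  proof
    fix w assume w: "w \<in> simplex_points S"
    then obtain u where u: "\<forall>k. real_of_int (w k) = (\<Sum>y\<in>S. u y * real_of_int y ^ k)"
      unfolding simplex_points_def by blast
    define u' where "u' y = (if y \<in> S then u y else 0)" for y
    have "(\<Sum>y\<in>T. u' y * real_of_int y ^ k) = (\<Sum>y\<in>S. u y * real_of_int y ^ k)" for k
      using S finite_T by (intro sum.mono_neutral_cong_right) (auto simp: u'_def)
    then have "real_of_int (form F (truncated d w)) = (\<Sum>y\<in>T. u' y * real_of_int (poly F y))"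
      using u by (intro form_A[OF F(3)]) (simp add: lookup_truncated)
    also have "\<dots> = 0"
    proof (intro sum.neutral ballI)
      fix y
      have "poly F y = 0" if "y \<in> S" using that finS by (simp add: F(1) poly_prod)
      then show "u' y * real_of_int (poly F y) = 0" by (simp add: u'_def)
    qed
    finally show "w \<in> G"
      unfolding G_def mem_Collect_eq
      by (intro bexI[OF _ A_M[OF truncated_mem[OF w S(1)]]] bexI[OF _ generated_submonoid.zero])
        (simp add: lookup_truncated)
  qed
  define b where "b k = Poly_Mapping.lookup a k + (- form F a) * Poly_Mapping.lookup x k" for k
  have "functional b F = form F a + (- form F a) * form F x"
    unfolding b_def functional_add_left functional_mult_left form_def ..
  then have "e * functional b ?P = 0" using x(2) by (simp add: F(1) functional_smult)
  then have "functional b ?P = 0" using F(2) by simp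
  then have "\<exists>w\<in>G. \<forall>k\<le>card S. w k = b k"
    by (rule kernel_generated_by_simplex_points[OF finS _ G0]) (fact Gadd Gdiff \<open>simplex_points S \<subseteq> G\<close>)+
  then obtain w where w: "w \<in> G" "\<And>k. k \<le> d \<Longrightarrow> w k = b k" unfolding S(2) by blast
  obtain t t' where t: "t \<in> M" "t' \<in> M" "form F t' = 0"
    "\<And>k. k \<le> d \<Longrightarrow> w k = Poly_Mapping.lookup t k - Poly_Mapping.lookup t' k"
    using w(1) unfolding G_def by blast
  \<comment> \<open>One of the \<open>form F a\<close> copies of \<open>x\<close> is kept apart as
    the divisor in the conclusion.\<close>
  define N where "N = nat (form F a) - 1"
  have N: "form F a = int N + 1" using a(2) by (simp add: N_def)
  have "t' + a = (t + (\<Sum>i<N. x)) + x"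
  proof (rule poly_mapping_eqI)
    fix k
    show "Poly_Mapping.lookup (t' + a) k = Poly_Mapping.lookup (t + (\<Sum>i<N. x) + x) k"
    proof (cases "k \<le> d")
      case True
      then show ?thesis using t(4)[OF True] unfolding w(2)[OF True] b_def N
        by (simp add: lookup_add lookup_sum_const algebra_simps)
    next
      case False
      then have dk: "d < k" by simp
      show ?thesis
        by (simp add: lookup_add lookup_sum_const lookup_M[OF _ dk] x(1) a(1) t(1,2))
    qed
  qed
  moreover have "t + (\<Sum>i<N. x) \<in> M" by (intro generated_submonoid_add sum_mem_M t(1) x(1))
  ultimately show ?thesis using t(2,3) by blast
qed

end

section \<open>The face of the monoid determined by a prime ideal\<close>

locale cyclic_prime = cyclic_monoid d T for d T +
  fixes p :: "((nat \<Rightarrow>\<^sub>0 int) \<Rightarrow>\<^sub>0 'k::field) set"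
  assumes prime: "prime_in (monoid_algebra M) p"
begin

abbreviation C :: "((nat \<Rightarrow>\<^sub>0 int) \<Rightarrow>\<^sub>0 'k) set" where
  "C \<equiv> monoid_algebra M"

definition face :: "(nat \<Rightarrow>\<^sub>0 int) set" where
  "face = {a \<in> M. Poly_Mapping.single a 1 \<notin> p}"

lemma graded: "(\<And>a b. \<sigma> (a + b) = \<sigma> a + \<sigma> b) \<Longrightarrow> graded_monoid_algebra M \<sigma> C"
  by unfold_locales (auto intro: generated_submonoid.zero generated_submonoid_add)

sublocale subring_set C
  by (rule subring_set_monoid_algebra) (auto intro: generated_submonoid.zero generated_submonoid_add)

lemma ideal_p: "ideal_in C p"
  using prime by (simp add: prime_in_def)

lemma single_mem_C: "a \<in> M \<Longrightarrow> Poly_Mapping.single a c \<in> C"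
  by simp

text \<open>This is primality of \<open>p\<close> on monomials; it makes \<open>face\<close> a face
  of the monoid in the algebraic sense.\<close>

lemma face_add_iff:
  assumes "a \<in> M" "b \<in> M"
  shows "a + b \<in> face \<longleftrightarrow> a \<in> face \<and> b \<in> face"
proof -
  let ?s = "\<lambda>a. Poly_Mapping.single a (1::'k)"
  have "?s (a + b) = ?s a * ?s b" by (simp add: mult_single)
  then have "?s (a + b) \<in> p \<longleftrightarrow> ?s a \<in> p \<or> ?s b \<in> p"
    using prime_inD(5)[OF prime] prime_inD(6)[OF prime] single_mem_C assms by (metis mult.commute)
  then show ?thesis using assms by (auto simp: face_def intro: generated_submonoid_add)
qed

lemma face_zero: "0 \<in> face"
  using prime_inD(3)[OF prime] by (auto simp: face_def intro: generated_submonoid.zero)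

lemma face_sum_iff:
  assumes "finite I" "\<And>i. i \<in> I \<Longrightarrow> f i \<in> M"
  shows "sum f I \<in> face \<longleftrightarrow> (\<forall>i\<in>I. f i \<in> face)"
  using assms
proof (induction I rule: finite_induct)
  case (insert i I)
  then show ?case using face_add_iff[of "f i" "sum f I"] sum_mem_M[of I f] by simp
qed (simp add: face_zero)

lemma face_vertices_iff:
  assumes Y: "finite Y" "Y \<subseteq> T"
  shows "(\<Sum>y\<in>Y. \<Sum>i<(m y)::nat. vertex y) \<in> face \<longleftrightarrow> (\<forall>y\<in>Y. 0 < m y \<longrightarrow> vertex y \<in> face)"
proof -
  have v: "vertex y \<in> M" if "y \<in> Y" for y using that Y A_M vertex_mem by blast
  have "(\<Sum>i<m y. vertex y) \<in> face \<longleftrightarrow> (0 < m y \<longrightarrow> vertex y \<in> face)" if "y \<in> Y" for y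
    using v[OF that] by (subst face_sum_iff) auto
  moreover have "(\<Sum>i<m y. vertex y) \<in> M" if "y \<in> Y" for y
    using v[OF that] by (rule sum_mem_M)
  ultimately show ?thesis using Y(1) by (simp add: face_sum_iff)
qed

lemma lookup_sum_vertices:
  "Poly_Mapping.lookup (\<Sum>y\<in>Y. \<Sum>i<(m y)::nat. vertex y) k = (if k \<le> d then \<Sum>y\<in>Y. int (m y) * y ^ k else 0)"
  unfolding lookup_sum[of _ Y] lookup_sum_const lookup_vertex by simp

text \<open>A positive multiple of \<open>a\<close> is a sum of vertices in which exactly those of
  positive weight occur. Multiples do not affect membership in \<open>face\<close>, so the
  supporting vertices decide.\<close>

lemma face_A_iff:
  assumes "a \<in> A" "\<And>y. y \<in> T \<Longrightarrow> 0 \<le> u y"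
    and "\<And>k. k \<le> d \<Longrightarrow> real_of_int (Poly_Mapping.lookup a k) = (\<Sum>y\<in>T. u y * real_of_int y ^ k)"
  shows "a \<in> face \<longleftrightarrow> (\<forall>y\<in>T. 0 < u y \<longrightarrow> vertex y \<in> face)"
proof -
  obtain N m where N: "0 < N" "\<And>y. y \<in> T \<Longrightarrow> 0 < m y \<longleftrightarrow> 0 < u y"
    "\<And>k. k \<le> d \<Longrightarrow> int N * Poly_Mapping.lookup a k = (\<Sum>y\<in>T. int (m y) * y ^ k)"
    using cyclic_generators_integral_relation[OF finite_T assms(2,3)] by blast
  have "(\<Sum>i<N. a) = (\<Sum>y\<in>T. \<Sum>i<m y. vertex y)"
    by (rule poly_mapping_eqI)
      (use N(3) lookup_M[OF A_M[OF assms(1)]] in \<open>simp add: lookup_sum_const lookup_sum_vertices not_le\<close>)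
  moreover have "(\<Sum>i<N. a) \<in> face \<longleftrightarrow> a \<in> face"
    using N(1) A_M[OF assms(1)] by (subst face_sum_iff) auto
  ultimately show ?thesis using face_vertices_iff[OF finite_T] N(2) by auto
qed

definition V :: "int set" where
  "V = {y \<in> T. vertex y \<in> face}"

text \<open>Used contrapositively: a monomial in \<open>p\<close> forces the monomial of some vertex
  into \<open>p\<close>.\<close>

lemma V_eq_T_imp_face:
  assumes "V = T" "a \<in> M"
  shows "a \<in> face"
  using assms(2)
proof induction
  case (add_generator a b)
  obtain u where "\<And>y. y \<in> T \<Longrightarrow> 0 \<le> u y"
    "\<And>k. k \<le> d \<Longrightarrow> real_of_int (Poly_Mapping.lookup a k) = (\<Sum>y\<in>T. u y * real_of_int y ^ k)"
    using add_generator.hyps(1) unfolding cyclic_generators_def by blast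
  then have "a \<in> face" using face_A_iff[OF add_generator.hyps(1)] assms(1) by (auto simp: V_def)
  then show ?case using add_generator A_M face_add_iff by blast
qed (rule face_zero)

text \<open>If a cover \<open>S\<close> of \<open>V\<close> had more than \<open>d\<close> elements, then \<open>insert g S\<close> would carry an affine relation
  in which all vertices outside \<open>V\<close> have the same sign.\<close>

lemma ex_facet_cover:
  assumes "V \<noteq> T"
  obtains S e where "V \<subseteq> S" "S \<subseteq> T" "card S = d" "e = 1 \<or> e = - 1"
    "\<And>r. r \<in> T - S \<Longrightarrow> sgn (\<Prod>s\<in>S. r - s) = e"
proof -
  have VT: "V \<subset> T" using assms by (auto simp: V_def)
  obtain S g e where S: "S \<subseteq> T" "V \<subseteq> S" "g \<in> T" "g \<notin> S" "e = 1 \<or> e = - 1"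
    "\<And>r. r \<in> T - S \<Longrightarrow> sgn (\<Prod>s\<in>S. r - s) = e"
    "\<And>x. x \<in> insert g S - V \<Longrightarrow> sgn (\<Prod>y\<in>insert g S - {x}. x - y) = e"
    using gale_cover[OF finite_T VT] by metis
  have finS: "finite S" using S finite_T finite_subset by blast
  have "card S \<le> d"
  proof (rule ccontr)
    assume "\<not> card S \<le> d"
    define X where "X = insert g S"
    have X: "finite X" "X \<subseteq> T" "d + 2 \<le> card X" "g \<in> X"
      using S finS \<open>\<not> card S \<le> d\<close> by (auto simp: X_def)
    obtain c :: "int \<Rightarrow> int" where c: "\<And>x. x \<in> X \<Longrightarrow> sgn (c x) = sgn (\<Prod>y\<in>X - {x}. x - y)"
      "\<And>k. k + 2 \<le> card X \<Longrightarrow> (\<Sum>x\<in>X. c x * x ^ k) = 0"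
      using moment_curve_relation[OF X(1)] by blast
    have nz: "c x \<noteq> 0" if "x \<in> X" for x
    proof -
      have "(\<Prod>y\<in>X - {x}. x - y) \<noteq> 0" using X(1) by simp
      then show ?thesis using c(1)[OF that] by (metis sgn_0_0)
    qed
    define m where "m x = nat \<bar>c x\<bar>" for x
    \<comment> \<open>Split by sign, the relation equates two sums of vertices. Vertices outside
      \<open>V\<close> all carry the sign \<open>e\<close>, so the sum over \<open>Xn\<close> lies
      in \<open>face\<close>; then so does the one over \<open>Xp\<close>, in which \<open>g\<close>
      occurs with a positive multiplicity.\<close>
    define Xp where "Xp = {x \<in> X. sgn (c x) = e}"
    define Xn where "Xn = {x \<in> X. sgn (c x) = - e}"
    have part: "X = Xp \<union> Xn" "Xp \<inter> Xn = {}"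
      using S(5) nz by (auto simp: Xp_def Xn_def sgn_if split: if_splits)
    have fin: "finite Xp" "finite Xn" using X(1) by (auto simp: Xp_def Xn_def)
    have cm: "c x = sgn (c x) * int (m x)" for x by (simp add: m_def sgn_mult_abs)
    have rel: "(\<Sum>x\<in>Xp. int (m x) * x ^ k) = (\<Sum>x\<in>Xn. int (m x) * x ^ k)" if "k \<le> d" for k
    proof -
      have "(\<Sum>x\<in>X. c x * x ^ k) = (\<Sum>x\<in>Xp. c x * x ^ k) + (\<Sum>x\<in>Xn. c x * x ^ k)"
        using part fin by (metis sum.union_disjoint)
      also have "(\<Sum>x\<in>Xp. c x * x ^ k) = e * (\<Sum>x\<in>Xp. int (m x) * x ^ k)"
        unfolding sum_distrib_left
        by (intro sum.cong refl, subst cm) (simp add: Xp_def mult.assoc)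
      also have "(\<Sum>x\<in>Xn. c x * x ^ k) = - e * (\<Sum>x\<in>Xn. int (m x) * x ^ k)"
        unfolding sum_distrib_left
        by (intro sum.cong refl, subst cm) (simp add: Xn_def mult.assoc)
      finally show ?thesis using c(2)[of k] that X(3) S(5) by auto
    qed
    have "(\<Sum>x\<in>Xp. \<Sum>i<m x. vertex x) = (\<Sum>x\<in>Xn. \<Sum>i<m x. vertex x)"
      by (rule poly_mapping_eqI) (simp add: lookup_sum_vertices rel)
    moreover have "(\<Sum>x\<in>Xn. \<Sum>i<m x. vertex x) \<in> face"
    proof -
      have "x \<in> V" if "x \<in> Xn" for x
      proof (rule ccontr)
        assume "x \<notin> V"
        then have "sgn (c x) = e" using c(1)[of x] S(7)[of x] that by (auto simp: X_def Xn_def)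
        then show False using that S(5) by (auto simp: Xn_def)
      qed
      then show ?thesis using fin X(2) by (subst face_vertices_iff) (auto simp: Xn_def V_def)
    qed
    ultimately have "\<forall>x\<in>Xp. 0 < m x \<longrightarrow> vertex x \<in> face"
      using face_vertices_iff[OF fin(1), of m] part X(2) by auto
    moreover have gV: "g \<notin> V" using S by auto
    have "g \<in> Xp" using S(7)[of g] c(1)[OF X(4)] X(4) gV by (simp add: Xp_def X_def)
    moreover have "0 < m g" using nz[OF X(4)] by (simp add: m_def)
    ultimately show False using gV S(3) by (simp add: V_def)
  qed
  then have "\<exists>S'. S \<subseteq> S' \<and> S' \<subseteq> T \<and> card S' = d \<and> (\<forall>r\<in>T - S'. sgn (\<Prod>s\<in>S'. r - s) = e)"
    using S card_T finite_T by (intro gale_extend) auto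
  then show ?thesis using that S(2,5) by blast
qed

text \<open>A priori the face of \<open>p\<close> may be smaller than a facet. The monomials off a
  facet that contains it span a nonzero prime inside \<open>p\<close>, and minimality forces
  equality. From then on membership in \<open>p\<close> is decided by the form
  \<open>F\<close>.\<close>

lemma principal_of_monomial:
  assumes minimal: "\<And>q. prime_in C q \<Longrightarrow> q \<subseteq> p \<Longrightarrow> q \<noteq> {0} \<Longrightarrow> q = p"
    and b: "b \<in> M" "Poly_Mapping.single b 1 \<in> p"
  shows "\<exists>g\<in>p. \<forall>f\<in>p. \<exists>s\<in>C - p. \<exists>h\<in>C. s * f = h * g"
proof -
  have "V \<noteq> T" using V_eq_T_imp_face b by (auto simp: face_def)
  then obtain S e where S: "V \<subseteq> S" "S \<subseteq> T" "card S = d" "e = 1 \<or> e = - 1"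
    "\<And>r. r \<in> T - S \<Longrightarrow> sgn (\<Prod>s\<in>S. r - s) = e"
    using ex_facet_cover by metis
  have finS: "finite S" using S finite_T finite_subset by blast
  let ?P = "\<Prod>s\<in>S. [:- s, 1:]"
  \<comment> \<open>The sign \<open>e\<close> makes the form positive on the nodes outside
    \<open>S\<close>; on \<open>S\<close> it vanishes.\<close>
  define F where "F = Polynomial.smult e ?P"
  have e: "e \<noteq> 0" "e * e = 1" using S(4) by auto
  have degP: "degree ?P = d" using finS S(3) by (subst degree_prod_eq_sum_degree) (auto simp: sum_constant)
  have degF: "degree F \<le> d" using degree_smult_le[of e ?P] by (simp only: F_def degP)
  have F0: "poly F s = 0" if "s \<in> S" for s using that finS by (simp add: F_def poly_prod)
  have F1: "0 < poly F r" if "r \<in> T - S" for r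
  proof -
    have "poly F r = e * (\<Prod>s\<in>S. r - s)" by (simp add: F_def poly_prod)
    also have "\<dots> = \<bar>\<Prod>s\<in>S. r - s\<bar>" unfolding S(5)[OF that, symmetric] by (simp add: abs_sgn mult.commute)
    finally show ?thesis using that finS by auto
  qed
  have Fnn: "0 \<le> poly F y" if "y \<in> T" for y using F0 F1 that by (cases "y \<in> S") (auto intro: less_imp_le)
  have \<sigma>nn: "0 \<le> form F a" if "a \<in> M" for a by (rule form_nonneg[OF degF Fnn that])
  interpret gr: graded_monoid_algebra M "form F" C by (rule graded) (rule form_add)
  have \<sigma>face: "form F a = 0" if "a \<in> M" "a \<in> face" for a
    using that
  proof induction
    case (add_generator a c)
    then have ac: "a \<in> face" "form F c = 0" using face_add_iff A_M by blast+
    obtain u where u: "\<And>y. y \<in> T \<Longrightarrow> 0 \<le> u y"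
      "\<And>k. k \<le> d \<Longrightarrow> real_of_int (Poly_Mapping.lookup a k) = (\<Sum>y\<in>T. u y * real_of_int y ^ k)"
      using add_generator.hyps(1) unfolding cyclic_generators_def by blast
    have "u y * real_of_int (poly F y) = 0" if "y \<in> T" for y
    proof (cases "u y = 0")
      case False
      then have "y \<in> V" using face_A_iff[OF add_generator.hyps(1) u] u(1)[OF that] ac(1) that by (auto simp: V_def)
      then show ?thesis using F0 S(1) by auto
    qed simp
    then have "(\<Sum>y\<in>T. u y * real_of_int (poly F y)) = 0" by (rule sum.neutral[OF ballI])
    moreover have "real_of_int (form F a) = (\<Sum>y\<in>T. u y * real_of_int (poly F y))"
      by (rule form_A[OF degF u(2)])
    ultimately have "form F a = 0" by (simp only: of_int_eq_0_iff)
    then show ?case using ac(2) by (simp add: form_add)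
  qed simp
  define q :: "((nat \<Rightarrow>\<^sub>0 int) \<Rightarrow>\<^sub>0 'k) set" where "q = {f \<in> C. \<forall>a\<in>Poly_Mapping.keys f. 0 < form F a}"
  have "prime_in C q" unfolding q_def by (rule gr.prime_in_positive_part) (rule \<sigma>nn)
  moreover have "q \<subseteq> p"
  proof
    fix f assume f: "f \<in> q"
    have "Poly_Mapping.single a (Poly_Mapping.lookup f a) \<in> p" if a: "a \<in> Poly_Mapping.keys f" for a
    proof -
      have aM: "a \<in> M" "0 < form F a" using f a by (auto simp: q_def)
      then have "a \<notin> face" using \<sigma>face by fastforce
      then have "Poly_Mapping.single a 1 \<in> p" using aM by (simp add: face_def)
      then have "Poly_Mapping.single 0 (Poly_Mapping.lookup f a) * Poly_Mapping.single a 1 \<in> p"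
        by (intro ideal_inD(4)[OF ideal_p] single_mem_C generated_submonoid.zero)
      then show ?thesis by (simp add: mult_single)
    qed
    then have "(\<Sum>a\<in>Poly_Mapping.keys f. Poly_Mapping.single a (Poly_Mapping.lookup f a)) \<in> p"
      by (rule ideal_in_sum[OF ideal_p])
    then show "f \<in> p" by (simp only: sum_single_lookup)
  qed
  moreover obtain r where r: "r \<in> T - S"
    using S(2,3) card_T finS by (metis DiffI less_irrefl subset_antisym subset_iff)
  have "q \<noteq> {0}"
  proof -
    have "form F (vertex r) = poly F r" unfolding vertex_def form_truncated[OF degF] functional_power ..
    then have "Poly_Mapping.single (vertex r) 1 \<in> q"
      using F1[OF r] r A_M[OF vertex_mem] by (simp add: q_def)
    then show ?thesis by (metis insertE empty_iff single_zero inj_single injD zero_neq_one)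
  qed
  ultimately have pq: "p = q" using minimal by blast
  obtain w where w: "w \<in> simplex_points (insert r S)" "\<bar>functional w ?P\<bar> = 1"
    using ex_simplex_point_unit[OF finS, of r] r by blast
  define x where "x = truncated d w"
  have xM: "x \<in> M" unfolding x_def using w(1) r S(2) by (intro A_M truncated_mem[of w "insert r S"]) auto
  have "form F x = e * functional w ?P"
    unfolding x_def form_truncated[OF degF] by (simp add: F_def functional_smult)
  then have "\<bar>form F x\<bar> = 1" using w(2) S(4) by (auto simp: abs_mult)
  then have \<sigma>x: "form F x = 1" using \<sigma>nn[OF xM] by simp
  let ?g = "Poly_Mapping.single x 1 :: (nat \<Rightarrow>\<^sub>0 int) \<Rightarrow>\<^sub>0 'k"
  have "\<exists>s\<in>C - p. \<exists>h\<in>C. s * f = h * ?g" if f: "f \<in> p" for f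
  proof -
    let ?K = "Poly_Mapping.keys f"
    have K: "a \<in> M" "0 < form F a" if "a \<in> ?K" for a using f that by (auto simp: pq q_def)
    have "\<exists>t h. t \<in> M \<and> h \<in> M \<and> form F t = 0 \<and> t + a = h + x" if "a \<in> ?K" for a
      using facet_lattice[OF S(2,3) F_def e(1) degF xM \<sigma>x K[OF that]] by blast
    then obtain t h where th: "\<And>a. a \<in> ?K \<Longrightarrow> t a \<in> M" "\<And>a. a \<in> ?K \<Longrightarrow> h a \<in> M"
      "\<And>a. a \<in> ?K \<Longrightarrow> form F (t a) = 0" "\<And>a. a \<in> ?K \<Longrightarrow> t a + a = h a + x"
      by metis
    \<comment> \<open>A common denominator for all monomials of \<open>f\<close>. It stays on the
      facet, so its monomial is outside \<open>p\<close>. In \<open>H\<close>, the term for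
      \<open>a\<close> has \<open>h a\<close> in place of the summand \<open>t a\<close> of
      \<open>s\<close>.\<close>
    define s where "s = (\<Sum>a\<in>?K. t a)"
    have sM: "s \<in> M" unfolding s_def using th(1) by (rule sum_mem_M)
    have form_sum: "form F (sum t I) = (\<Sum>a\<in>I. form F (t a))" for I
      by (induction I rule: infinite_finite_induct) (auto simp: form_add)
    have \<sigma>s: "form F s = 0" unfolding s_def form_sum using th(3) by (intro sum.neutral) blast
    define H where "H = (\<Sum>a\<in>?K. Poly_Mapping.single ((\<Sum>a'\<in>?K - {a}. t a') + h a) (Poly_Mapping.lookup f a))"
    have "H \<in> C"
      unfolding H_def
    proof (rule sum_mem)
      fix a assume a: "a \<in> ?K"
      have "(\<Sum>a'\<in>?K - {a}. t a') \<in> M" using th(1) by (intro sum_mem_M) auto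
      then show "Poly_Mapping.single ((\<Sum>a'\<in>?K - {a}. t a') + h a) (Poly_Mapping.lookup f a) \<in> C"
        using th(2)[OF a] by (intro single_mem_C generated_submonoid_add)
    qed
    moreover have "Poly_Mapping.single s 1 \<in> C - p"
      using sM \<sigma>s by (auto simp: pq q_def)
    moreover have "Poly_Mapping.single s 1 * f = H * ?g"
    proof -
      have "Poly_Mapping.single s 1 * f
          = (\<Sum>a\<in>?K. Poly_Mapping.single (s + a) (Poly_Mapping.lookup f a))"
        by (subst sum_single_lookup[of f, symmetric]) (simp add: sum_distrib_left mult_single)
      also have "\<dots> = H * ?g"
        unfolding H_def sum_distrib_right mult_single
      proof (intro sum.cong refl)
        fix a assume a: "a \<in> ?K"
        have s: "s = t a + (\<Sum>a'\<in>?K - {a}. t a')"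
          unfolding s_def using finite_keys a by (rule sum.remove)
        have "s + a = (\<Sum>a'\<in>?K - {a}. t a') + (t a + a)"
          unfolding s by (simp only: ac_simps)
        also have "\<dots> = (\<Sum>a'\<in>?K - {a}. t a') + h a + x"
          unfolding th(4)[OF a] by (simp only: ac_simps)
        finally show "Poly_Mapping.single (s + a) (Poly_Mapping.lookup f a) =
            Poly_Mapping.single ((\<Sum>a'\<in>?K - {a}. t a') + h a + x) (Poly_Mapping.lookup f a * 1)"
          by simp
      qed
      finally show ?thesis .
    qed
    ultimately show ?thesis by blast
  qed
  moreover have "?g \<in> p" using xM \<sigma>x by (simp add: pq q_def)
  ultimately show ?thesis by blast
qed

text \<open>If \<open>p\<close> were homogeneous with respect to every coordinate, it would contain a monomial.\<close>

lemma principal_of_no_monomial: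
  assumes minimal: "\<And>q. prime_in C q \<Longrightarrow> q \<subseteq> p \<Longrightarrow> q \<noteq> {0} \<Longrightarrow> q = p" and "p \<noteq> {0}"
    and no_mon: "\<And>b. b \<in> M \<Longrightarrow> Poly_Mapping.single b 1 \<notin> p"
  shows "\<exists>g\<in>p. \<forall>f\<in>p. \<exists>s\<in>C - p. \<exists>h\<in>C. s * f = h * g"
proof -
  have gr: "graded_monoid_algebra M (\<lambda>a. Poly_Mapping.lookup a j) C" for j
    by (rule graded) (rule lookup_add)
  let ?core = "\<lambda>j. graded_monoid_algebra.homogeneous_core (\<lambda>a. Poly_Mapping.lookup a j) C p"
  have "\<exists>j\<le>d. ?core j \<noteq> p"
  proof (rule ccontr)
    assume "\<not> ?thesis"
    then have core: "?core j = p" if "j \<le> d" for j using that by blast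
    obtain f where f: "f \<in> p" "f \<noteq> 0" using assms(2) prime_inD(2)[OF prime] by auto
    then obtain b where b: "b \<in> Poly_Mapping.keys f" by (metis ex_in_conv keys_eq_empty)
    have fC: "f \<in> C" using f prime_inD(1)[OF prime] by auto
    then have bM: "b \<in> M" using b by auto
    \<comment> \<open>Since \<open>p\<close> equals each core, it contains the components of its
      elements in every coordinate. Fixing the coordinates one after another leaves, after all
      \<open>d + 1\<close> of them, only the term of \<open>b\<close>.\<close>
    have "restrict_keys {a. \<forall>j<m. Poly_Mapping.lookup a j = Poly_Mapping.lookup b j} f \<in> p" if "m \<le> Suc d" for m
      using that
    proof (induction m)
      case 0
      then show ?case using f(1) by (simp add: restrict_keys_id)
    next
      case (Suc m)
      interpret gr: graded_monoid_algebra M "\<lambda>a. Poly_Mapping.lookup a m" C by (rule gr)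
      let ?f = "restrict_keys {a. \<forall>j<m. Poly_Mapping.lookup a j = Poly_Mapping.lookup b j} f"
      have "?f \<in> gr.homogeneous_core p" using Suc core by simp
      then have "gr.comp (Poly_Mapping.lookup b m) ?f \<in> p" by (simp add: gr.homogeneous_core_def)
      moreover have "{a. Poly_Mapping.lookup a m = Poly_Mapping.lookup b m}
          \<inter> {a. \<forall>j<m. Poly_Mapping.lookup a j = Poly_Mapping.lookup b j}
        = {a. \<forall>j<Suc m. Poly_Mapping.lookup a j = Poly_Mapping.lookup b j}"
        by (auto simp: less_Suc_eq)
      ultimately show ?case by (simp add: gr.comp_def restrict_keys_restrict_keys)
    qed
    from this[of "Suc d"]
    have "restrict_keys {a. \<forall>j<Suc d. Poly_Mapping.lookup a j = Poly_Mapping.lookup b j} f \<in> p" by simp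
    moreover have "restrict_keys {a. \<forall>j<Suc d. Poly_Mapping.lookup a j = Poly_Mapping.lookup b j} f
        = Poly_Mapping.single b (Poly_Mapping.lookup f b)"
    proof (rule poly_mapping_eqI)
      fix a
      have "a = b" if "a \<in> Poly_Mapping.keys f" "\<forall>j<Suc d. Poly_Mapping.lookup a j = Poly_Mapping.lookup b j"
      proof (rule poly_mapping_eqI)
        fix k
        have "a \<in> M" using that(1) fC by auto
        then show "Poly_Mapping.lookup a k = Poly_Mapping.lookup b k"
          using that(2) lookup_M[OF _ , of a k] lookup_M[OF bM, of k] by (cases "k \<le> d") auto
      qed
      then show "Poly_Mapping.lookup (restrict_keys {a. \<forall>j<Suc d. Poly_Mapping.lookup a j = Poly_Mapping.lookup b j} f) a
          = Poly_Mapping.lookup (Poly_Mapping.single b (Poly_Mapping.lookup f b)) a"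
        by (auto simp: lookup_restrict_keys lookup_single when_def in_keys_iff)
    qed
    ultimately have "Poly_Mapping.single 0 (inverse (Poly_Mapping.lookup f b)) *
        Poly_Mapping.single b (Poly_Mapping.lookup f b) \<in> p"
      by (intro ideal_inD(4)[OF ideal_p] single_mem_C generated_submonoid.zero) simp
    then have "Poly_Mapping.single b 1 \<in> p" using b by (simp add: mult_single in_keys_iff)
    then show False using no_mon bM by blast
  qed
  then obtain j where j: "j \<le> d" "?core j \<noteq> p" by blast
  interpret gr: graded_monoid_algebra M "\<lambda>a. Poly_Mapping.lookup a j" C by (rule gr)
  have "gr.homogeneous_core p = {0}"
    using minimal[OF gr.prime_in_homogeneous_core[OF prime] gr.homogeneous_core_subset[OF ideal_p]] j(2)
    by blast
  then show ?thesis using gr.principal_of_no_homogeneous[OF prime assms(2)] by blast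
qed

end

theorem proposition2p2:
  fixes d n :: nat and \<tau> :: "nat \<Rightarrow> int"
  assumes "d \<ge> 1" and "n \<ge> d + 1"
    and "strict_mono_on {1..n} \<tau>"
  shows "serre_R1 (polytope_algebra (cyclic_polytope d n (\<lambda>i. real_of_int (\<tau> i)))
           :: ((nat \<Rightarrow>\<^sub>0 int) \<Rightarrow>\<^sub>0 'k::field) ring)"
proof -
  let ?T = "\<tau> ` {1..n}"
  have "card ?T = n" using strict_mono_on_imp_inj_on[OF assms(3)] by (simp add: card_image)
  then interpret cyclic_monoid d ?T using assms(2) by unfold_locales auto
  \<comment> \<open>The exponents carry a linear order compatible with addition, so the ambient
    algebra is a domain, as the criterion requires.\<close>
  have "serre_R1 (subset_ring (monoid_algebra M :: ((nat \<Rightarrow>\<^sub>0 int) \<Rightarrow>\<^sub>0 'k) set))"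
  proof (rule serre_R1_subset_ringI)
    show sub: "subring_set (monoid_algebra M :: ((nat \<Rightarrow>\<^sub>0 int) \<Rightarrow>\<^sub>0 'k) set)"
      by (rule subring_set_monoid_algebra) (auto intro: generated_submonoid.zero generated_submonoid_add)
    show "noetherian_ring (subset_ring (monoid_algebra M :: ((nat \<Rightarrow>\<^sub>0 int) \<Rightarrow>\<^sub>0 'k) set))"
      using noetherian_set_monoid_algebra[OF finite_cyclic_generators[OF finite_T]]
      by (rule subring_set.noetherian_ring_subset_ring[OF sub])
    fix p :: "((nat \<Rightarrow>\<^sub>0 int) \<Rightarrow>\<^sub>0 'k) set"
    assume p: "prime_in (monoid_algebra M) p" "p \<noteq> {0}"
      and minimal: "\<And>q. prime_in (monoid_algebra M) q \<Longrightarrow> q \<subseteq> p \<Longrightarrow> q \<noteq> {0} \<Longrightarrow> q = p"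
    interpret cyclic_prime d ?T p by unfold_locales (rule p(1))
    show "\<exists>g\<in>p. \<forall>f\<in>p. \<exists>s\<in>monoid_algebra M - p. \<exists>h\<in>monoid_algebra M. s * f = h * g"
      using principal_of_monomial[OF minimal] principal_of_no_monomial[OF minimal p(2)] by blast
  qed
  then show ?thesis
    by (simp only: polytope_algebra_def semigroup_algebra_eq_subset_ring lattice_points_cyclic_polytope[OF assms(1)])
qed

end
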